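(* Let $0<\beta<1/2$ and let $K=\mathcal I_{\beta,2}$ be the Besov-Liouville space on $[0,1]$. For $\lambda>0$ let $N_\lambda$ be a Poisson process with intensity $\lambda$ and set $X_\lambda(t)=\dfrac{N_\lambda(t)-\lambda t}{\sqrt\lambda}$, $t\in[0,1]$, regarded as a $K$-valued random variable. Let $Z$ be a Brownian motion on $\mathcal I_{\beta,2}$, i.e. a centered $\mathcal I_{\beta,2}$-valued Gaussian random variable with covariance operator $S'=I^\beta_{0^+}I^{1-\beta}_{0^+}I^{1-\beta}_{1^-}D^\beta_{0^+}$. Then the distributions of $X_\lambda$ and $Z$ are asymptotically close as $\lambda\to\infty$, with $$d_3(X_\lambda,Z)\lesssim\frac1{\sqrt\lambda}.$$
   Context: For $f\in L^p([0,1])$ and $\beta>0$ the left and right fractional integrals are $$(I^\beta_{0^+}f)(s)=\frac1{\Gamma(\beta)}\int_0^s(s-r)^{\beta-1}f(r)\,dr,\qquad(I^\beta_{1^-}f)(s)=\frac1{\Gamma(\beta)}\int_s^1(r-s)^{\beta-1}f(r)\,dr.$$ The left fractional derivative is $(D^\beta_{0^+}f)(s)=\frac1{\Gamma(1-\beta)}\frac d{ds}\int_0^s(s-r)^{-\beta}f(r)\,dr$, which is the inverse of $I^\beta_{0^+}$. The Besov-Liouville space is $\mathcal I^+_{\beta,p}=\{I^\beta_{0^+}\widehat f:\widehat f\in L^p([0,1])\}$ with norm $\|I^\beta_{0^+}\widehat f\|_{\mathcal I^+_{\beta,p}}=\|\widehat f\|_{L^p([0,1])}$; for $\beta p<1$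 it is canonically isomorphic to the analogous space defined with right fractional integrals, and is denoted $\mathcal I_{\beta,p}$. For $p=2$, $K=\mathcal I_{\beta,2}$ is a Hilbert space with inner product $\langle f,g\rangle_K=\int_0^1(D^\beta_{0^+}f)(s)(D^\beta_{0^+}g)(s)\,ds$; it contains the sample paths of the Poisson process and of Brownian motion on $[0,1]$. The covariance operator of $Y\in L^2(\Omega;K)$ is $Su=\mathbb E[\langle Y,u\rangle_KY]$. $C_b^3(K)$ is the class of real-valued functions on $K$ with bounded Fréchet derivatives up to order three, with norm $\|h\|_{C_b^3(K)}=\sup_{j=1,2,3}\sup_{x\in K}\|D^jh(x)\|_{K^{\otimes j}}$, where $K^{\otimes j}$ is the Hilbert space tensor product, and $d_3(X_1,X_2)=\sup\{|\mathbb E[h(X_1)-h(X_2)]|:h\in C_b^3(K),\|h\|_{C_b^3(K)}\le1\}$. $A_\lambda\lesssim B_\lambda$ means $A_\lambda\le C B_\lambda$ for all sufficiently large $\lambda$, with a constant $C$ not depending on $\lambda$. *)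

theory Defs
  imports "HOL-Probability.Probability"
begin

section \<open>Fractional calculus on the unit interval\<close>

definition frac_int_left :: "real \<Rightarrow> (real \<Rightarrow> real) \<Rightarrow> real \<Rightarrow> real" where
  "frac_int_left \<beta> f s =
     1 / Gamma \<beta> * set_lebesgue_integral lebesgue {0..s} (\<lambda>r. (s - r) powr (\<beta> - 1) * f r)"

definition frac_int_right :: "real \<Rightarrow> (real \<Rightarrow> real) \<Rightarrow> real \<Rightarrow> real" where
  "frac_int_right \<beta> f s =
     1 / Gamma \<beta> * set_lebesgue_integral lebesgue {s..1} (\<lambda>r. (r - s) powr (\<beta> - 1) * f r)"

text \<open>
  The derivative below is only claimed to exist for almost every \<open>s\<close>; the values on the
  exceptional null set are irrelevant, since the result is always used up to null sets.
\<close>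

definition frac_deriv_left :: "real \<Rightarrow> (real \<Rightarrow> real) \<Rightarrow> real \<Rightarrow> real" where
  "frac_deriv_left \<beta> f s =
     1 / Gamma (1 - \<beta>) *
     deriv (\<lambda>s. set_lebesgue_integral lebesgue {0..s} (\<lambda>r. (s - r) powr (- \<beta>) * f r)) s"


section \<open>The Besov-Liouville space with \<open>p = 2\<close>\<close>

abbreviation unit_leb :: "real measure" where
  "unit_leb \<equiv> lebesgue_on {0..1}"

definition L2_unit :: "(real \<Rightarrow> real) set" where
  "L2_unit = {f \<in> borel_measurable unit_leb. integrable unit_leb (\<lambda>s. (f s)\<^sup>2)}"

text \<open>All representatives, with respect to almost everywhere equality, of elements of the space.\<close>

definition besov_liouville :: "real \<Rightarrow> (real \<Rightarrow> real) set" where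
  "besov_liouville \<beta> = {f. \<exists>g\<in>L2_unit. AE s in unit_leb. f s = frac_int_left \<beta> g s}"

definition besov_liouville_inner :: "real \<Rightarrow> (real \<Rightarrow> real) \<Rightarrow> (real \<Rightarrow> real) \<Rightarrow> real" where
  "besov_liouville_inner \<beta> f g =
     (\<integral>s. frac_deriv_left \<beta> f s * frac_deriv_left \<beta> g s \<partial>unit_leb)"

text \<open>
  A type cannot depend on the real number \<open>\<beta>\<close>.  To have the type-class based Frechet derivative
  and Bochner integral available on the space, its elements are therefore the elements of a Hilbert
  space type \<open>'k\<close>, identified with \<open>besov_liouville \<beta>\<close> modulo almost everywhere equality,
  with its linear structure and its inner product, by a map \<open>\<rho>\<close> that picks a representing function.
  Injectivity of the identification follows from the last clause.  Such \<open>'k\<close> and \<open>\<rho>\<close> exist for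
  every \<open>\<beta>\<close> between 0 and 1/2: take the Hilbert space of classes of functions in \<open>L2_unit\<close>, and
  let \<open>\<rho>\<close> be \<open>frac_int_left \<beta>\<close> on representatives.
\<close>

definition is_besov_liouville_space ::
  "real \<Rightarrow> ('k::{real_inner, banach, second_countable_topology} \<Rightarrow> real \<Rightarrow> real) \<Rightarrow> bool" where
  "is_besov_liouville_space \<beta> \<rho> \<longleftrightarrow>
     (\<forall>x. \<rho> x \<in> besov_liouville \<beta>) \<and>
     (\<forall>f\<in>besov_liouville \<beta>. \<exists>x. AE s in unit_leb. \<rho> x s = f s) \<and>
     (\<forall>a b x y. AE s in unit_leb. \<rho> (a *\<^sub>R x + b *\<^sub>R y) s = a * \<rho> x s + b * \<rho> y s) \<and>
     (\<forall>x y. x \<bullet> y = besov_liouville_inner \<beta> (\<rho> x) (\<rho> y))"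

text \<open>The element of the space that a function in \<open>besov_liouville \<beta>\<close> represents.\<close>

definition element_of :: "('k \<Rightarrow> real \<Rightarrow> real) \<Rightarrow> (real \<Rightarrow> real) \<Rightarrow> 'k" where
  "element_of \<rho> f = (THE x. AE s in unit_leb. \<rho> x s = f s)"


section \<open>Test functions and the distance\<close>

definition fderiv :: "('k::real_normed_vector \<Rightarrow> 'v::real_normed_vector) \<Rightarrow> 'k \<Rightarrow> 'k \<Rightarrow>\<^sub>L 'v" where
  "fderiv h x = Blinfun (frechet_derivative h (at x))"

definition thrice_differentiable :: "('k::real_normed_vector \<Rightarrow> real) \<Rightarrow> bool" where
  "thrice_differentiable h \<longleftrightarrow>
     (\<forall>x. h differentiable at x) \<and>
     (\<forall>x. fderiv h differentiable at x) \<and>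
     (\<forall>x. fderiv (fderiv h) differentiable at x)"

text \<open>
  The norm in the \<open>j\<close>-fold Hilbert space tensor product of a \<open>j\<close>-linear form is its
  Hilbert-Schmidt norm, the square root of the sum of its squared coefficients with respect to an
  orthonormal basis.  By Bessel's inequality this sum is the supremum of the sums over finite
  orthonormal families; it is infinite if the form is not in the tensor product.
  For \<open>j = 1\<close> it is the dual norm.
\<close>

definition finite_orthonormal :: "'k::real_inner set \<Rightarrow> bool" where
  "finite_orthonormal E \<longleftrightarrow> finite E \<and> pairwise orthogonal E \<and> (\<forall>u\<in>E. norm u = 1)"

definition tensor2_norm :: "('k::real_inner \<Rightarrow>\<^sub>L 'k \<Rightarrow>\<^sub>L real) \<Rightarrow> ennreal" where
  "tensor2_norm T =
     (SUP E\<in>Collect finite_orthonormal.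
        ennreal (sqrt (\<Sum>u\<in>E. \<Sum>v\<in>E. (blinfun_apply (blinfun_apply T u) v)\<^sup>2)))"

definition tensor3_norm :: "('k::real_inner \<Rightarrow>\<^sub>L 'k \<Rightarrow>\<^sub>L 'k \<Rightarrow>\<^sub>L real) \<Rightarrow> ennreal" where
  "tensor3_norm T =
     (SUP E\<in>Collect finite_orthonormal.
        ennreal (sqrt (\<Sum>u\<in>E. \<Sum>v\<in>E. \<Sum>w\<in>E.
          (blinfun_apply (blinfun_apply (blinfun_apply T u) v) w)\<^sup>2)))"

definition Cb3_norm :: "('k::real_inner \<Rightarrow> real) \<Rightarrow> ennreal" where
  "Cb3_norm h =
     (SUP x. Sup {ennreal (norm (fderiv h x)),
                  tensor2_norm (fderiv (fderiv h) x),
                  tensor3_norm (fderiv (fderiv (fderiv h)) x)})"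

definition Cb3 :: "('k::real_inner \<Rightarrow> real) set" where
  "Cb3 = {h. thrice_differentiable h \<and> Cb3_norm h < \<infinity>}"

definition d3 ::
  "'a measure \<Rightarrow> ('a \<Rightarrow> 'k::real_inner) \<Rightarrow> 'b measure \<Rightarrow> ('b \<Rightarrow> 'k) \<Rightarrow> ennreal" where
  "d3 M X P Y =
     (SUP h\<in>{h \<in> Cb3. Cb3_norm h \<le> 1}.
        ennreal \<bar>(\<integral>\<omega>. h (X \<omega>) \<partial>M) - (\<integral>\<omega>. h (Y \<omega>) \<partial>P)\<bar>)"


section \<open>Poisson processes\<close>

text \<open>Paths are nondecreasing, so the subtractions of natural numbers below are not truncated.\<close>

definition poisson_process :: "'a measure \<Rightarrow> real \<Rightarrow> (real \<Rightarrow> 'a \<Rightarrow> nat) \<Rightarrow> bool" where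
  "poisson_process M l N \<longleftrightarrow>
     prob_space M \<and>
     (\<forall>t\<ge>0. N t \<in> measurable M (count_space UNIV)) \<and>
     (\<forall>\<omega>\<in>space M. N 0 \<omega> = 0) \<and>
     (\<forall>\<omega>\<in>space M. mono_on {0..} (\<lambda>t. N t \<omega>)) \<and>
     (\<forall>\<omega>\<in>space M. \<forall>t\<ge>0. continuous (at_right t) (\<lambda>s. real (N s \<omega>))) \<and>
     (\<forall>n. \<forall>t::nat \<Rightarrow> real. 0 \<le> t 0 \<longrightarrow> mono t \<longrightarrow>
        prob_space.indep_vars M (\<lambda>_. count_space UNIV)
          (\<lambda>i \<omega>. N (t (Suc i)) \<omega> - N (t i) \<omega>) {..<n}) \<and>
     (\<forall>s t. 0 \<le> s \<longrightarrow> s < t \<longrightarrow>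
        distr M (count_space UNIV) (\<lambda>\<omega>. N t \<omega> - N s \<omega>) = measure_pmf (poisson_pmf (l * (t - s))))"

definition normalized_poisson ::
  "('k \<Rightarrow> real \<Rightarrow> real) \<Rightarrow> real \<Rightarrow> (real \<Rightarrow> 'a \<Rightarrow> nat) \<Rightarrow> 'a \<Rightarrow> 'k" where
  "normalized_poisson \<rho> l N \<omega> =
     element_of \<rho> (\<lambda>t. (real (N t \<omega>) - l * t) / sqrt l)"


section \<open>Gaussian random variables and Brownian motion\<close>

text \<open>Constants are Gaussian, with variance 0.\<close>

definition gaussian_law :: "real measure \<Rightarrow> bool" where
  "gaussian_law \<mu> \<longleftrightarrow>
     (\<exists>m. \<mu> = return borel m) \<or>
     (\<exists>m \<sigma>. \<sigma> > 0 \<and> \<mu> = density lborel (\<lambda>x. ennreal (normal_density m \<sigma> x)))"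

definition gaussian_variable :: "'b measure \<Rightarrow> ('b \<Rightarrow> 'k::real_inner) \<Rightarrow> bool" where
  "gaussian_variable P Z \<longleftrightarrow>
     prob_space P \<and> Z \<in> borel_measurable P \<and>
     (\<forall>u. gaussian_law (distr P borel (\<lambda>\<omega>. Z \<omega> \<bullet> u)))"

definition covariance_operator ::
  "'b measure \<Rightarrow> ('b \<Rightarrow> 'k::{real_inner, banach, second_countable_topology}) \<Rightarrow> 'k \<Rightarrow> 'k" where
  "covariance_operator P Y u = (\<integral>\<omega>. (Y \<omega> \<bullet> u) *\<^sub>R Y \<omega> \<partial>P)"

definition brownian_covariance :: "real \<Rightarrow> (real \<Rightarrow> real) \<Rightarrow> real \<Rightarrow> real" where
  "brownian_covariance \<beta> f =
     frac_int_left \<beta> (frac_int_left (1 - \<beta>) (frac_int_right (1 - \<beta>) (frac_deriv_left \<beta> f)))"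

definition brownian_motion_on ::
  "real \<Rightarrow> ('k::{real_inner, banach, second_countable_topology} \<Rightarrow> real \<Rightarrow> real) \<Rightarrow>
   'b measure \<Rightarrow> ('b \<Rightarrow> 'k) \<Rightarrow> bool" where
  "brownian_motion_on \<beta> \<rho> P Z \<longleftrightarrow>
     gaussian_variable P Z \<and>
     integrable P (\<lambda>\<omega>. (norm (Z \<omega>))\<^sup>2) \<and>
     (\<integral>\<omega>. Z \<omega> \<partial>P) = 0 \<and>
     (\<forall>u. AE s in unit_leb.
        \<rho> (covariance_operator P Z u) s = brownian_covariance \<beta> (\<rho> u) s)"

end

theory Submission
  imports Defs
begin

text \<open>
  Let \<open>e\<^sub>t\<close> be the element of the space that the indicator of \<open>[t, 1]\<close> represents. It exists since
  \<open>\<beta> < 1/2\<close>, and \<open>t \<mapsto> e\<^sub>t\<close> is Hoelder continuous. A Poisson path with jumps at \<open>\<tau>\<^sub>1, \<tau>\<^sub>2, \<dots>\<close>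
  is the sum of the \<open>e\<close> at the jump times, so that the normalized process is the limit of the sums
  of \<open>(N(t\<^sub>i\<^sub>+\<^sub>1) - N(t\<^sub>i) - \<lambda>/n) e(t\<^sub>i\<^sub>+\<^sub>1) / \<surd>\<lambda>\<close> over the grid \<open>t\<^sub>i = i/n\<close>. By Lindeberg's argument these sums
  can be replaced by the Rademacher sums of \<open>\<plusminus>e(t\<^sub>i\<^sub>+\<^sub>1) / \<surd>n\<close>. The first two moments agree, and the
  third order remainders add up to a multiple of \<open>1/\<surd>\<lambda> + \<surd>\<lambda>/n + 1/\<surd>n\<close>, which tends to a multiple
  of \<open>1/\<surd>\<lambda>\<close> as \<open>n\<close> grows. Finally, the Rademacher sums converge to the given Gaussian variable:
  both have the characteristic function with exponent \<open>- 1/2 \<integral> \<langle>e\<^sub>t, u\<rangle>\<^sup>2 dt\<close>, by the formula for the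
  covariance operator, and the path of \<open>e\<close> is compact, which reduces the convergence to finite
  dimensions.
\<close>


subsection \<open>Differentiation of the indefinite integral\<close>

text \<open>Rademacher sums stand between the two sides because \<open>Z\<close> is known only
  through its law: there are no increments of \<open>Z\<close> to exchange against Poisson
  increments. Signs have the right first two moments, their expectations are finite averages that
  need no probability space, and the passage from them to \<open>Z\<close> is a plain limit that
  costs nothing in the rate. One exchange costs at most \<open>hoelder_const ^ 3 / 6\<close> times
  the rescaled third moment, which is \<open>1 / sqrt l / n\<close> to leading order; the n cells
  together give the final constant \<open>hoelder_const ^ 3 / 6\<close>, where
  \<open>hoelder_const\<close> bounds the norm of every \<open>e\<^sub>t\<close>. The inner product
  is defined by derivatives that exist only almost everywhere. Lebesgue's differentiation theorem
  turns it into an L2 product of densities. Then \<open>e\<^sub>t\<close> has an explicit density,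
  and the covariance operator turns out to send \<open>u\<close> to the weak integral of
  \<open>\<langle>e\<^sub>t, u\<rangle> e\<^sub>t\<close> over t.\<close>

text \<open>Henstock's lemma bounds the total length of the disjoint intervals that Vitali's covering theorem
  selects around the points where the difference quotients stay away from \<open>f\<close>.\<close>

lemma indefinite_integral_has_derivative_ae:
  fixes f :: "real \<Rightarrow> real"
  assumes f: "f integrable_on {a..b}"
  shows "negligible {x\<in>{a<..<b}. \<not> ((\<lambda>u. integral {a..u} f) has_real_derivative f x) (at x)}"
proof -
  \<comment> \<open>The point \<open>x\<close> may lie anywhere in the interval, end points
    included, so the one-sided difference quotients of the primitive are covered by
    \<open>c = x\<close> and \<open>d = x\<close>.\<close>
  define bad where "bad r \<delta> x c d \<longleftrightarrow> a < c \<and> c < d \<and> d < b \<and> c \<le> x \<and> x \<le> d \<and> d - c < \<delta>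
      \<and> r * (d - c) < \<bar>(d - c) * f x - integral {c..d} f\<bar>" for r \<delta> x c d :: real
  define E where "E r = {x. \<forall>\<delta>>0. \<exists>c d. bad r \<delta> x c d}" for r
  have neg: "negligible (E r)" if r: "r > 0" for r
    unfolding negligible_outer_le
  proof (intro allI impI)
    fix \<epsilon> :: real assume \<epsilon>: "\<epsilon> > 0"
    have f': "f integrable_on cbox a b" using f by simp
    \<comment> \<open>The tolerance is \<open>r * \<epsilon>\<close> because each selected interval
      contributes more than \<open>r\<close> times its length to Henstock's sum; the total length is
      then at most \<open>\<epsilon>\<close>.\<close>
    obtain \<gamma> where \<gamma>: "gauge \<gamma>" and
      \<gamma>2: "\<And>p. \<lbrakk>p tagged_partial_division_of (cbox a b); \<gamma> fine p\<rbrakk> \<Longrightarrow>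
             sum (\<lambda>(x,k). norm(measure lborel k *\<^sub>R f x - integral k f)) p < r * \<epsilon>"
      using Henstock_lemma[OF f' mult_pos_pos[OF r \<epsilon>]] by blast
    define K where "K = {(x,c,d). \<exists>\<delta>. bad r \<delta> x c d \<and> {c..d} \<subseteq> \<gamma> x}"
    let ?c = "\<lambda>(x::real,c::real,d::real). (c+d)/2" and ?r = "\<lambda>(x::real,c::real,d::real). (d-c)/2"
    define B where "B i = {fst (snd i)..snd (snd i)}" for i :: "real \<times> real \<times> real"
    have cb: "cball (?c i) (?r i) = B i" for i
      by (cases i) (auto simp: cball_eq_atLeastAtMost field_simps B_def)
    have r0: "0 < ?r i" if "i \<in> K" for i using that by (auto simp: K_def bad_def)
    have V: "\<exists>i. i \<in> K \<and> x \<in> cball (?c i) (?r i) \<and> ?r i < d" if x: "x \<in> E r" and d: "0 < d" for x d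
    proof -
      obtain \<eta> where \<eta>: "\<eta> > 0" "ball x \<eta> \<subseteq> \<gamma> x"
        using \<gamma> by (meson gauge_def openE)
      obtain c e where ce: "bad r (min \<eta> d) x c e"
        using x[unfolded E_def, simplified, rule_format, of "min \<eta> d"] \<eta> d by auto
      have "{c..e} \<subseteq> ball x \<eta>" using ce by (auto simp: bad_def dist_real_def)
      then have "(x,c,e) \<in> K" using \<eta> ce unfolding K_def by blast
      then show ?thesis using ce unfolding cb
        by (intro exI[of _ "(x,c,e)"]) (auto simp: bad_def B_def)
    qed
    obtain C where C: "countable C" "C \<subseteq> K"
      "pairwise (\<lambda>i j. disjnt (B i) (B j)) C"
      "negligible (E r - (\<Union>i\<in>C. B i))"
      using Vitali_covering_theorem_cballs[OF r0 V] unfolding cb by blast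
    have disj: "disjnt (B i) (B j)" if "i \<in> C" "j \<in> C" "i \<noteq> j" for i j
      using C(3) that by (auto simp: pairwise_def)
    \<comment> \<open>Henstock's lemma speaks of finite partial divisions, so the countable Vitali
      family is bounded through its finite subfamilies.\<close>
    have bnd: "measure lebesgue (\<Union>i\<in>F. B i) \<le> \<epsilon>" if F: "F \<subseteq> C" "finite F" for F
    proof -
      define p where "p = (\<lambda>i. (fst i, B i)) ` F"
      have inj: "inj_on (\<lambda>i. (fst i, B i)) F"
      proof (rule inj_onI)
        fix i j assume ij: "i \<in> F" "j \<in> F" "(fst i, B i) = (fst j, B j)"
        then have "i \<in> K" using F C by auto
        then have m: "fst (snd i) \<in> B i" by (auto simp: K_def bad_def B_def)
        have eq: "B i = B j" using ij(3) by (rule conjunct2[OF iffD1[OF prod.inject]])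
        show "i = j"
        proof (rule ccontr)
          assume "i \<noteq> j"
          then have "disjnt (B i) (B j)"
            by (intro disj) (use ij F in auto)
          then show False unfolding eq[symmetric] using m by (metis disjnt_iff)
        qed
      qed
      have Kp: "fst i \<in> B i" "B i \<subseteq> {a..b}" "B i \<subseteq> \<gamma> (fst i)"
        if "i \<in> F" for i
      proof -
        have "i \<in> K" using that F C by auto
        then obtain x c d \<delta> where i: "i = (x,c,d)" "bad r \<delta> x c d" "{c..d} \<subseteq> \<gamma> x"
          unfolding K_def by blast
        show "fst i \<in> B i" "B i \<subseteq> {a..b}" "B i \<subseteq> \<gamma> (fst i)"
          unfolding B_def using i by (auto simp: bad_def)
      qed
      have p: "p tagged_partial_division_of cbox a b"
        unfolding tagged_partial_division_of_def
      proof (intro conjI allI impI)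
        show "finite p" using F by (simp add: p_def)
      next
        fix x L assume "(x,L) \<in> p"
        then obtain i where i: "i \<in> F" "x = fst i" "L = B i" by (auto simp: p_def)
        show "x \<in> L" "L \<subseteq> cbox a b" using Kp[OF i(1)] i by auto
        show "\<exists>a b. L = cbox a b" using i unfolding B_def by (metis cbox_interval)
      next
        fix x L y M assume "(x, L) \<in> p \<and> (y, M) \<in> p \<and> (x, L) \<noteq> (y, M)"
        then have pp: "(x,L) \<in> p" "(y,M) \<in> p" and ne: "(x, L) \<noteq> (y, M)" by simp_all
        from pp(1) obtain i where ij: "i \<in> F" "(x,L) = (fst i, B i)"
          unfolding p_def by (rule imageE)
        from pp(2) obtain j where ij': "j \<in> F" "(y,M) = (fst j, B j)"
          unfolding p_def by (rule imageE)
        note ij = ij ij'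
        have LM: "L = B i" "M = B j" "x = fst i" "y = fst j"
          using ij(2,4) unfolding prod.inject by blast+
        have "i \<noteq> j"
        proof
          assume "i = j"
          then have "(x, L) = (y, M)" using LM by (simp only:)
          then show False using ne by contradiction
        qed
        then have "disjnt (B i) (B j)"
          by (intro disj) (use ij F in auto)
        then have "L \<inter> M = {}" unfolding LM disjnt_def .
        then show "interior L \<inter> interior M = {}" using interior_subset by blast
      qed
      have fine: "\<gamma> fine p" unfolding fine_def p_def using Kp by auto
      have "measure lebesgue (\<Union>i\<in>F. B i) \<le> (\<Sum>i\<in>F. measure lebesgue (B i))"
        by (intro measure_UNION_le) (use F in \<open>auto simp: B_def\<close>)
      also have "\<dots> \<le> (\<Sum>i\<in>F. (1/r) * norm (measure lborel (B i) *\<^sub>R f (fst i) - integral (B i) f))"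
      proof (rule sum_mono)
        fix i assume "i \<in> F"
        then have "i \<in> K" using F C by auto
        then obtain x c d \<delta> where i: "i = (x,c,d)" "bad r \<delta> x c d" by (auto simp: K_def)
        show "measure lebesgue (B i) \<le> (1/r) * norm (measure lborel (B i) *\<^sub>R f (fst i) - integral (B i) f)"
        proof -
          have "c < d" and *: "r * (d - c) \<le> \<bar>(d - c) * f x - integral {c..d} f\<bar>"
            using i(2) by (simp_all add: bad_def)
          from * have "d - c \<le> 1/r * \<bar>(d - c) * f x - integral {c..d} f\<bar>"
            using r by (simp add: pos_le_divide_eq mult.commute)
          then show ?thesis using \<open>c < d\<close> by (simp add: B_def i(1))
        qed
      qed
      also have "\<dots> = (1/r) * (\<Sum>(x,k)\<in>p. norm (measure lborel k *\<^sub>R f x - integral k f))"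
        unfolding p_def by (subst sum.reindex[OF inj]) (simp add: sum_distrib_left)
      also have "\<dots> \<le> (1/r) * (r * \<epsilon>)"
        using \<gamma>2[OF p fine] r by (intro mult_left_mono) auto
      finally show ?thesis using r by simp
    qed
    let ?U = "\<Union>i\<in>C. B i"
    have U: "?U \<in> lmeasurable" "measure lebesgue ?U \<le> \<epsilon>"
      using fmeasurable_UN_bound[OF C(1) _ bnd] measure_UN_bound[OF C(1) _ bnd] by (auto simp: B_def)
    let ?T = "?U \<union> (E r - ?U)"
    have "?T \<in> lmeasurable"
      by (intro fmeasurable.Un U) (use C(4) negligible_imp_measurable in blast)
    moreover have "measure lebesgue ?T \<le> measure lebesgue ?U + measure lebesgue (E r - ?U)"
      by (intro measure_Un_le) (use U C(4) negligible_imp_measurable in blast)+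
    ultimately show "\<exists>T. E r \<subseteq> T \<and> T \<in> lmeasurable \<and> measure lebesgue T \<le> \<epsilon>"
      using U negligible_imp_measure0[OF C(4)] by (intro exI[of _ ?T] conjI) (blast, assumption, linarith)
  qed
  \<comment> \<open>A failing derivative leaves a fixed positive relative error on arbitrarily short
    intervals; the thresholds 1/(n+1) catch every such error.\<close>
  have "negligible (\<Union>n. E (inverse (real (Suc n))))"
    by (intro negligible_countable_Union) (auto intro!: neg)
  moreover have "{x\<in>{a<..<b}. \<not> ((\<lambda>u. integral {a..u} f) has_real_derivative f x) (at x)}
      \<subseteq> (\<Union>n. E (inverse (real (Suc n))))"
  proof (rule subsetI, rule ccontr)
    fix x assume x: "x \<in> {x\<in>{a<..<b}. \<not> ((\<lambda>u. integral {a..u} f) has_real_derivative f x) (at x)}"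
      and nx: "x \<notin> (\<Union>n. E (inverse (real (Suc n))))"
    have ab: "a < x" "x < b" using x by auto
    have sub: "f integrable_on {c..d}" if "a \<le> c" "d \<le> b" for c d
      using f that integrable_on_subinterval by fastforce
    have "((\<lambda>u. integral {a..u} f) has_derivative (*) (f x)) (at x)"
      unfolding has_derivative_at_alt
    proof (intro conjI allI impI)
      fix e :: real assume e: "e > 0"
      then obtain n where n: "inverse (real (Suc n)) < e" using reals_Archimedean by blast
      let ?q = "inverse (real (Suc n))"
      have "x \<notin> E ?q" using nx by simp
      then obtain \<delta> where \<delta>: "\<delta> > 0" "\<And>c d. \<not> bad ?q \<delta> x c d"
        by (auto simp: E_def)
      have key: "\<bar>(d - c) * f x - integral {c..d} f\<bar> \<le> e * (d - c)"
        if "a < c" "c < d" "d < b" "c \<le> x" "x \<le> d" "d - c < \<delta>" for c d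
      proof -
        have "\<bar>(d - c) * f x - integral {c..d} f\<bar> \<le> ?q * (d - c)"
          using \<delta>(2)[of c d] that by (auto simp: bad_def)
        also have "\<dots> \<le> e * (d - c)" using n that by (intro mult_right_mono) auto
        finally show ?thesis .
      qed
      let ?d = "min \<delta> (min (x - a) (b - x))"
      show "\<exists>d>0. \<forall>y. norm (y - x) < d \<longrightarrow>
           norm (integral {a..y} f - integral {a..x} f - f x * (y - x)) \<le> e * norm (y - x)"
      proof (intro exI[of _ ?d] conjI allI impI)
        show "0 < ?d" using \<delta> ab by auto
        fix y assume y: "norm (y - x) < ?d"
        show "norm (integral {a..y} f - integral {a..x} f - f x * (y - x)) \<le> e * norm (y - x)"
        proof (cases x y rule: linorder_cases)
          case less
          have "integral {a..x} f + integral {x..y} f = integral {a..y} f"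
            using less ab y by (intro Henstock_Kurzweil_Integration.integral_combine sub) auto
          then show ?thesis using key[of x y] less y ab by (auto simp: algebra_simps)
        next
          case greater
          have "integral {a..y} f + integral {y..x} f = integral {a..x} f"
            using greater ab y by (intro Henstock_Kurzweil_Integration.integral_combine sub) auto
          then show ?thesis using key[of y x] greater y ab by (auto simp: algebra_simps)
        qed auto
      qed
    qed (rule bounded_linear_mult_right)
    then show False using x by (simp add: has_field_derivative_def)
  qed
  ultimately show ?thesis by (rule negligible_subset)
qed


subsection \<open>Fractional kernels\<close>

text \<open>The Riemann-Liouville kernel. Its vanishing on the negative half line encodes the limits
  of integration, so left and right fractional integrals become integrals over the whole
  line.\<close>

definition frac_kernel :: "real \<Rightarrow> real \<Rightarrow> real" where
  "frac_kernel a x = (if 0 < x then x powr (a - 1) / Gamma a else 0)"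

abbreviation frac_conv :: "real \<Rightarrow> (real \<Rightarrow> real) \<Rightarrow> real \<Rightarrow> real" where
  "frac_conv a g s \<equiv> \<integral>r. frac_kernel a (s - r) * g r \<partial>lborel"

lemma frac_kernel_measurable [measurable]: "frac_kernel a \<in> borel_measurable borel"
  unfolding frac_kernel_def by measurable

lemma frac_kernel_nonneg: "0 < a \<Longrightarrow> 0 \<le> frac_kernel a x"
  by (simp add: frac_kernel_def Gamma_real_pos less_imp_le)

text \<open>The substitution \<open>r = x * t\<close> cancels all powers of \<open>x\<close> and
  leaves the Beta integral \<open>Gamma a * Gamma (1 - a)\<close>, which the normalizations of the
  two kernels remove. The nonnegative integral is computed so that the result also serves as a
  Tonelli bound.\<close>

lemma nn_integral_frac_kernel_conv:
  assumes a: "0 < a" "a < 1"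
  shows "(\<integral>\<^sup>+r. ennreal (frac_kernel a (x - r) * frac_kernel (1 - a) r) \<partial>lborel) = indicator {0<..} x"
proof (cases "0 < x")
  case False
  then have "frac_kernel a (x - r) * frac_kernel (1 - a) r = 0" for r by (auto simp: frac_kernel_def)
  then have "(\<integral>\<^sup>+r. ennreal (frac_kernel a (x - r) * frac_kernel (1 - a) r) \<partial>lborel) = (\<integral>\<^sup>+r. 0 \<partial>(lborel :: real measure))"
    by (intro nn_integral_cong) (simp only: ennreal_0)
  then show ?thesis using False by simp
next
  case x: True
  have G: "Gamma a > 0" "Gamma (1 - a) > 0" using a by (auto intro!: Gamma_real_pos)
  let ?c = "1 / (Gamma a * Gamma (1 - a))"
  let ?h = "\<lambda>t. t powr ((1 - a) - 1) * (1 - t) powr (a - 1)"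
  have B: "(?h has_integral Gamma (1 - a) * Gamma a) {0..1}"
    using has_integral_Beta_real[of "1 - a" a] a by (simp add: Beta_def)
  have "(\<integral>\<^sup>+r. ennreal (frac_kernel a (x - r) * frac_kernel (1 - a) r) \<partial>lborel) =
     ennreal \<bar>x\<bar> * (\<integral>\<^sup>+t. ennreal (frac_kernel a (x - (0 + x * t)) * frac_kernel (1 - a) (0 + x * t)) \<partial>lborel)"
    using x by (intro nn_integral_real_affine) auto
  also have "\<dots> = (\<integral>\<^sup>+t. ennreal \<bar>x\<bar> * ennreal (frac_kernel a (x - (0 + x * t)) * frac_kernel (1 - a) (0 + x * t)) \<partial>lborel)"
    by (intro nn_integral_cmult[symmetric]) measurable
  also have "\<dots> = (\<integral>\<^sup>+t. ennreal ?c * ennreal (indicator {0..1} t * ?h t) \<partial>lborel)"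
  proof (intro nn_integral_cong)
    fix t :: real
    have "x * (frac_kernel a (x - x * t) * frac_kernel (1 - a) (x * t)) = ?c * (indicator {0..1} t * ?h t)"
    proof (cases "0 < t \<and> t < 1")
      case True
      have e: "x - x * t = x * (1 - t)" by (simp add: algebra_simps)
      have "0 < x * (1 - t)" using x True by simp
      then have "frac_kernel a (x - x * t) = x powr (a - 1) * (1 - t) powr (a - 1) / Gamma a"
        unfolding e frac_kernel_def using x True by (simp add: powr_mult)
      moreover have "frac_kernel (1 - a) (x * t) = x powr (- a) * t powr (- a) / Gamma (1 - a)"
        unfolding frac_kernel_def using x True by (simp add: powr_mult)
      ultimately have "x * (frac_kernel a (x - x * t) * frac_kernel (1 - a) (x * t))
          = (x * (x powr (a - 1) * x powr (- a))) * (?c * (t powr (- a) * (1 - t) powr (a - 1)))"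
        by (simp only:) (simp add: mult_ac)
      also have "x powr (a - 1) * x powr (- a) = x powr (- 1)"
        by (simp add: powr_add[symmetric])
      also have "x * x powr (- 1) = 1" using x by (simp add: powr_minus)
      finally show ?thesis using True by simp
    next
      case False
      have z: "frac_kernel a (x - x * t) * frac_kernel (1 - a) (x * t) = 0"
      proof (cases "t \<le> 0")
        case True
        then have "x * t \<le> 0" using x by (simp add: mult_nonneg_nonpos)
        then show ?thesis by (simp add: frac_kernel_def)
      next
        case f: False
        then have "t \<ge> 1" using False by auto
        then have "x - x * t \<le> 0" using x by simp
        then show ?thesis by (simp add: frac_kernel_def)
      qed
      have "indicator {0..1} t * ?h t = 0"
        using False by (auto simp: indicator_def)
      then show ?thesis by (simp only: z mult_zero_right)
    qed
    then have "ennreal (x * (frac_kernel a (x - x * t) * frac_kernel (1 - a) (x * t))) = ennreal (?c * (indicator {0..1} t * ?h t))"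
      by simp
    then show "ennreal \<bar>x\<bar> * ennreal (frac_kernel a (x - (0 + x * t)) * frac_kernel (1 - a) (0 + x * t)) = ennreal ?c * ennreal (indicator {0..1} t * ?h t)"
      using x a G by (subst (1 2) ennreal_mult'[symmetric]) (auto simp: indicator_def)
  qed
  also have "\<dots> = ennreal ?c * (\<integral>\<^sup>+t. ennreal (indicator {0..1} t * ?h t) \<partial>lborel)"
    by (intro nn_integral_cmult) measurable
  also have "(\<integral>\<^sup>+t. ennreal (indicator {0..1} t * ?h t) \<partial>lborel) = ennreal (Gamma (1 - a) * Gamma a)"
    by (rule nn_integral_has_integral_lebesgue[OF _ B]) simp
  also have "ennreal ?c * ennreal (Gamma (1 - a) * Gamma a) = 1"
    using G by (subst ennreal_mult''[symmetric]) (auto simp: field_simps)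
  finally show ?thesis using x by simp
qed

lemma nn_integral_frac_kernel_conv_shift:
  assumes a: "0 < a" "a < 1"
  shows "(\<integral>\<^sup>+r. ennreal (frac_kernel a (s - r) * frac_kernel (1 - a) (r - q)) \<partial>lborel) = indicator {q<..} s"
proof -
  have "(\<integral>\<^sup>+r. ennreal (frac_kernel a (s - r) * frac_kernel (1 - a) (r - q)) \<partial>lborel) =
    ennreal \<bar>1\<bar> * (\<integral>\<^sup>+r. ennreal (frac_kernel a (s - (q + 1 * r)) * frac_kernel (1 - a) (q + 1 * r - q)) \<partial>lborel)"
    by (intro nn_integral_real_affine) auto
  also have "\<dots> = (\<integral>\<^sup>+r. ennreal (frac_kernel a ((s - q) - r) * frac_kernel (1 - a) r) \<partial>lborel)"
    by (simp add: algebra_simps)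
  also have "\<dots> = indicator {0<..} (s - q)" by (rule nn_integral_frac_kernel_conv[OF a])
  finally show ?thesis by (simp add: indicator_def)
qed

lemma integral_frac_kernel_conv_shift:
  assumes a: "0 < a" "a < 1"
  shows "(\<integral>r. frac_kernel a (s - r) * frac_kernel (1 - a) (r - q) \<partial>lborel) = indicator {q<..} s"
proof -
  have "(\<integral>r. frac_kernel a (s - r) * frac_kernel (1 - a) (r - q) \<partial>lborel) =
     enn2real (\<integral>\<^sup>+r. ennreal (frac_kernel a (s - r) * frac_kernel (1 - a) (r - q)) \<partial>lborel)"
    using a by (intro integral_eq_nn_integral) (auto intro!: mult_nonneg_nonneg frac_kernel_nonneg)
  then show ?thesis unfolding nn_integral_frac_kernel_conv_shift[OF a] by (simp add: indicator_def)
qed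

text \<open>Orders \<open>a\<close> and \<open>1 - a\<close> compose to plain integration.
  Exchanging the integrals is legitimate because the two kernels convolve to an indicator, which is
  at most 1, so integrability of \<open>g\<close> dominates.\<close>

lemma frac_kernel_semigroup:
  assumes a: "0 < a" "a < 1" and g: "integrable lborel g"
  shows "(\<integral>r. frac_kernel a (s - r) * frac_conv (1 - a) g r \<partial>lborel)
      = (\<integral>q. indicator {..<s} q * g q \<partial>lborel)"
proof -
  have gm [measurable]: "g \<in> borel_measurable borel" using g by auto
  let ?f = "\<lambda>(r,q). frac_kernel a (s - r) * (frac_kernel (1 - a) (r - q) * g q)"
  have nn: "0 \<le> frac_kernel a x * frac_kernel (1 - a) y" for x y
    using a by (intro mult_nonneg_nonneg frac_kernel_nonneg) auto
  have "integrable (lborel \<Otimes>\<^sub>M lborel) ?f"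
  proof (rule integrableI_bounded)
    show "?f \<in> borel_measurable (lborel \<Otimes>\<^sub>M lborel)" by measurable
    have "(\<integral>\<^sup>+p. ennreal (norm (?f p)) \<partial>(lborel \<Otimes>\<^sub>M lborel)) = (\<integral>\<^sup>+q. \<integral>\<^sup>+r. ennreal (norm (?f (r,q))) \<partial>lborel \<partial>lborel)"
      by (subst lborel_pair.nn_integral_snd[symmetric]) auto
    also have "\<dots> = (\<integral>\<^sup>+q. ennreal \<bar>g q\<bar> * indicator {q<..} s \<partial>lborel)"
    proof (intro nn_integral_cong)
      fix q
      have "(\<integral>\<^sup>+r. ennreal (norm (?f (r,q))) \<partial>lborel) =
         (\<integral>\<^sup>+r. ennreal (frac_kernel a (s - r) * frac_kernel (1 - a) (r - q)) * ennreal \<bar>g q\<bar> \<partial>lborel)"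
        using a by (intro nn_integral_cong)
          (auto simp: abs_mult frac_kernel_nonneg nn ennreal_mult'' [symmetric] mult.assoc)
      also have "\<dots> = indicator {q<..} s * ennreal \<bar>g q\<bar>"
        by (subst nn_integral_multc) (auto simp: nn_integral_frac_kernel_conv_shift[OF a])
      finally show "(\<integral>\<^sup>+r. ennreal (norm (?f (r,q))) \<partial>lborel) = ennreal \<bar>g q\<bar> * indicator {q<..} s"
        by (simp add: mult.commute)
    qed
    also have "\<dots> \<le> (\<integral>\<^sup>+q. ennreal (norm (g q)) \<partial>lborel)"
      by (intro nn_integral_mono) (auto simp: indicator_def)
    also have "\<dots> < \<infinity>" using g by (simp add: integrable_iff_bounded)
    finally show "(\<integral>\<^sup>+p. ennreal (norm (?f p)) \<partial>(lborel \<Otimes>\<^sub>M lborel)) < \<infinity>" .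
  qed
  then have "(\<integral>r. (\<integral>q. ?f (r,q) \<partial>lborel) \<partial>lborel) = (\<integral>q. (\<integral>r. ?f (r,q) \<partial>lborel) \<partial>lborel)"
    by (intro lborel_pair.Fubini_integral[symmetric]) (simp add: case_prod_unfold)
  also have "\<dots> = (\<integral>q. indicator {..<s} q * g q \<partial>lborel)"
  proof (intro Bochner_Integration.integral_cong refl)
    fix q
    have "(\<integral>r. ?f (r,q) \<partial>lborel) = (\<integral>r. frac_kernel a (s - r) * frac_kernel (1 - a) (r - q) * g q \<partial>lborel)"
      by (simp add: mult.assoc)
    also have "\<dots> = indicator {q<..} s * g q"
      using integral_frac_kernel_conv_shift[OF a] by simp
    finally show "(\<integral>r. ?f (r,q) \<partial>lborel) = indicator {..<s} q * g q" by (simp add: indicator_def)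
  qed
  finally show ?thesis by simp
qed

section \<open>Null sets and Borel versions on the unit interval\<close>

lemma AE_unit_leb_iff: "(AE s in unit_leb. P s) \<longleftrightarrow> (AE s in lborel. s \<in> {0..1} \<longrightarrow> P s)"
  by (subst AE_restrict_space_iff) (auto simp: AE_completion_iff)

text \<open>This rests on completeness of Lebesgue measure: the preimages under \<open>f\<close> and
  \<open>g\<close> differ by a subset of a null set. It makes expressions with \<open>deriv\<close>
  measurable, about which nothing is known beforehand.\<close>

lemma lebesgue_measurable_cong_AE:
  fixes f g :: "real \<Rightarrow> real"
  assumes g: "g \<in> borel_measurable lebesgue" and ae: "AE x in lebesgue. f x = g x"
  shows "f \<in> borel_measurable lebesgue"
proof (rule measurableI)
  fix A :: "real set" assume A: "A \<in> sets borel"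
  show "f -` A \<inter> space lebesgue \<in> sets lebesgue"
    by (rule completion.in_sets_AE[where A = "g -` A \<inter> space lebesgue"])
      (use ae measurable_sets[OF g A] in \<open>auto elim!: eventually_mono\<close>)
qed auto

lemma integral_lebesgue_cong_AE:
  fixes f g :: "real \<Rightarrow> real"
  assumes g: "g \<in> borel_measurable borel" and ae: "AE x in lborel. f x = g x"
  shows "integral\<^sup>L lebesgue f = integral\<^sup>L lborel g"
proof -
  have ae': "AE x in lebesgue. f x = g x" using ae by (rule AE_completion)
  have g': "g \<in> borel_measurable lebesgue" using g by (simp add: measurable_completion)
  have "integral\<^sup>L lebesgue f = integral\<^sup>L lebesgue g"
    using lebesgue_measurable_cong_AE[OF g' ae'] g' ae' by (intro integral_cong_AE) auto
  also have "\<dots> = integral\<^sup>L lborel g" using g by (intro integral_completion) simp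
  finally show ?thesis .
qed

text \<open>Integration forgets null sets, so the identity holds at every \<open>s\<close> of the
  unit interval although \<open>f\<close> and \<open>F\<close> agree only almost everywhere. The
  pointwise form is what permits differentiation in \<open>s\<close> and nesting of the
  operators.\<close>

lemma frac_int_left_eq_kernel:
  assumes F: "F \<in> borel_measurable borel" "\<And>x. x \<notin> {0..1} \<Longrightarrow> F x = 0"
    and ae: "AE s in unit_leb. f s = F s" and s: "0 \<le> s" "s \<le> 1"
  shows "frac_int_left a f s = frac_conv a F s"
proof -
  note [measurable] = F(1)
  have ne: "AE r in lborel. r \<noteq> s" by (rule AE_lborel_singleton)
  have "set_lebesgue_integral lebesgue {0..s} (\<lambda>r. (s - r) powr (a - 1) * f r)
     = (\<integral>r. indicator {0..<s} r * ((s - r) powr (a - 1) * F r) \<partial>lborel)"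
    unfolding set_lebesgue_integral_def
  proof (rule integral_lebesgue_cong_AE)
    show "AE r in lborel. indicator {0..s} r *\<^sub>R ((s - r) powr (a - 1) * f r)
        = indicator {0..<s} r * ((s - r) powr (a - 1) * F r)"
      using ae[unfolded AE_unit_leb_iff] ne by eventually_elim (use s in \<open>auto simp: indicator_def\<close>)
  qed measurable
  then have "frac_int_left a f s = 1 / Gamma a * (\<integral>r. indicator {0..<s} r * ((s - r) powr (a - 1) * F r) \<partial>lborel)"
    by (simp add: frac_int_left_def)
  also have "\<dots> = (\<integral>r. 1 / Gamma a * (indicator {0..<s} r * ((s - r) powr (a - 1) * F r)) \<partial>lborel)"
    by simp
  also have "\<dots> = frac_conv a F s"
    using F(2) by (intro Bochner_Integration.integral_cong refl) (auto simp: frac_kernel_def indicator_def not_less)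
  finally show ?thesis .
qed

lemma frac_int_right_eq_kernel:
  assumes F: "F \<in> borel_measurable borel" "\<And>x. x \<notin> {0..1} \<Longrightarrow> F x = 0"
    and ae: "AE s in unit_leb. f s = F s" and s: "0 \<le> s" "s \<le> 1"
  shows "frac_int_right a f s = (\<integral>r. frac_kernel a (r - s) * F r \<partial>lborel)"
proof -
  note [measurable] = F(1)
  have ne: "AE r in lborel. r \<noteq> s" by (rule AE_lborel_singleton)
  have "set_lebesgue_integral lebesgue {s..1} (\<lambda>r. (r - s) powr (a - 1) * f r)
     = (\<integral>r. indicator {s<..1} r * ((r - s) powr (a - 1) * F r) \<partial>lborel)"
    unfolding set_lebesgue_integral_def
  proof (rule integral_lebesgue_cong_AE)
    show "AE r in lborel. indicator {s..1} r *\<^sub>R ((r - s) powr (a - 1) * f r)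
        = indicator {s<..1} r * ((r - s) powr (a - 1) * F r)"
      using ae[unfolded AE_unit_leb_iff] ne by eventually_elim (use s in \<open>auto simp: indicator_def\<close>)
  qed measurable
  then have "frac_int_right a f s = 1 / Gamma a * (\<integral>r. indicator {s<..1} r * ((r - s) powr (a - 1) * F r) \<partial>lborel)"
    by (simp add: frac_int_right_def)
  also have "\<dots> = (\<integral>r. 1 / Gamma a * (indicator {s<..1} r * ((r - s) powr (a - 1) * F r)) \<partial>lborel)"
    by simp
  also have "\<dots> = (\<integral>r. frac_kernel a (r - s) * F r \<partial>lborel)"
    using F(2) by (intro Bochner_Integration.integral_cong refl) (auto simp: frac_kernel_def indicator_def not_less)
  finally show ?thesis .
qed

text \<open>\<open>g\<close> is a Borel version of \<open>D\<^sup>\<beta> f\<close>, extended by 0: with Borel functions on the whole line, Fubini's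
  theorem applies on \<open>lborel\<close>.\<close>

definition liouville_rep :: "real \<Rightarrow> (real \<Rightarrow> real) \<Rightarrow> (real \<Rightarrow> real) \<Rightarrow> bool" where
  "liouville_rep \<beta> f g \<longleftrightarrow>
     g \<in> borel_measurable borel \<and> (\<forall>x. x \<notin> {0..1} \<longrightarrow> g x = 0) \<and> integrable lborel (\<lambda>x. (g x)\<^sup>2) \<and>
     (AE s in unit_leb. f s = frac_conv \<beta> g s)"

lemma liouville_repD:
  assumes "liouville_rep \<beta> f g"
  shows "g \<in> borel_measurable borel" "\<And>x. x \<notin> {0..1} \<Longrightarrow> g x = 0" "integrable lborel (\<lambda>x. (g x)\<^sup>2)"
    "AE s in unit_leb. f s = frac_conv \<beta> g s"
  using assms by (auto simp: liouville_rep_def)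

lemma liouville_rep_integrable:
  assumes "liouville_rep \<beta> f g"
  shows "integrable lborel g"
proof (rule Bochner_Integration.integrable_bound)
  note g = liouville_repD[OF assms]
  show "integrable lborel (\<lambda>x. indicator {0..1} x + (g x)\<^sup>2)"
    using g(3) by (intro Bochner_Integration.integrable_add) simp_all
  show "g \<in> borel_measurable lborel" using g(1) by simp
  have "\<bar>y\<bar> \<le> 1 + y\<^sup>2" for y :: real
    using zero_le_power2[of "\<bar>y\<bar> - 1/2"] by (simp add: power2_eq_square algebra_simps)
  then show "AE x in lborel. norm (g x) \<le> norm (indicator {0..1} x + (g x)\<^sup>2)"
    using g(2) by (intro AE_I2) (auto simp: indicator_def)
qed

lemma integrable_mult_of_squares:
  fixes g h :: "'a \<Rightarrow> real"
  assumes "integrable M (\<lambda>x. (g x)\<^sup>2)" "integrable M (\<lambda>x. (h x)\<^sup>2)"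
    "g \<in> borel_measurable M" "h \<in> borel_measurable M"
  shows "integrable M (\<lambda>x. g x * h x)"
proof (rule Bochner_Integration.integrable_bound)
  show "integrable M (\<lambda>x. (g x)\<^sup>2 + (h x)\<^sup>2)"
    using assms by (intro Bochner_Integration.integrable_add)
  show "(\<lambda>x. g x * h x) \<in> borel_measurable M" using assms by measurable
  have "\<bar>y * z\<bar> \<le> y\<^sup>2 + z\<^sup>2" for y z :: real
  proof -
    have "2 * \<bar>y * z\<bar> \<le> y\<^sup>2 + z\<^sup>2"
      using zero_le_power2[of "\<bar>y\<bar> - \<bar>z\<bar>"] by (simp add: power2_eq_square algebra_simps abs_mult)
    then show ?thesis using abs_ge_zero[of "y * z"] by linarith
  qed
  then show "AE x in M. norm (g x * h x) \<le> norm ((g x)\<^sup>2 + (h x)\<^sup>2)"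
    by (intro AE_I2) auto
qed

section \<open>Borel densities of the elements of the space\<close>

lemma L2_unit_ex_borel:
  assumes "g0 \<in> L2_unit"
  obtains g where "g \<in> borel_measurable borel" "\<And>x. x \<notin> {0..1} \<Longrightarrow> g x = 0"
    "integrable lborel (\<lambda>x. (g x)\<^sup>2)" "AE s in unit_leb. g0 s = g s"
proof -
  have m: "g0 \<in> borel_measurable unit_leb" and i: "integrable unit_leb (\<lambda>s. (g0 s)\<^sup>2)"
    using assms by (auto simp: L2_unit_def)
  have "(\<lambda>x. indicator {0..1} x *\<^sub>R g0 x) \<in> borel_measurable lebesgue"
    using m by (subst (asm) borel_measurable_restrict_space_iff) auto
  then obtain g' where g': "g' \<in> borel_measurable lborel" "AE x in lborel. indicator {0..1} x *\<^sub>R g0 x = g' x"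
    using completion_ex_borel_measurable_real by blast
  define g where "g x = indicator {0..1} x * g' x" for x
  have gm [measurable]: "g \<in> borel_measurable borel" using g'(1) unfolding g_def by auto
  have ae: "AE x in lborel. indicator {0..1} x * g0 x = g x"
    using g'(2)
  proof eventually_elim
    fix x assume "indicator {0..1} x *\<^sub>R g0 x = g' x"
    then show "indicator {0..1} x * g0 x = g x" by (cases "x \<in> {0..1}") (simp_all add: g_def)
  qed
  have i': "integrable lebesgue (\<lambda>x. indicator {0..1} x *\<^sub>R (g0 x)\<^sup>2)"
    using i by (subst (asm) integrable_restrict_space) auto
  have "integrable lebesgue (\<lambda>x. (g x)\<^sup>2)"
  proof (rule Bochner_Integration.integrable_bound[OF i'])
    show "(\<lambda>x. (g x)\<^sup>2) \<in> borel_measurable lebesgue" by (intro measurable_completion) measurable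
    show "AE x in lebesgue. norm ((g x)\<^sup>2) \<le> norm (indicator {0..1} x *\<^sub>R (g0 x)\<^sup>2)"
      using AE_completion[OF ae] by eventually_elim (auto simp: g_def indicator_def split: if_splits)
  qed
  then have "integrable lborel (\<lambda>x. (g x)\<^sup>2)" by (subst (asm) integrable_completion) auto
  moreover have "AE s in unit_leb. g0 s = g s"
    unfolding AE_unit_leb_iff using ae by eventually_elim auto
  moreover have "g x = 0" if "x \<notin> {0..1}" for x using that by (auto simp: g_def)
  ultimately show ?thesis using gm that by blast
qed

lemma besov_liouville_ex_rep:
  assumes "f \<in> besov_liouville \<beta>"
  obtains g where "liouville_rep \<beta> f g"
proof -
  obtain g0 where g0: "g0 \<in> L2_unit" "AE s in unit_leb. f s = frac_int_left \<beta> g0 s"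
    using assms by (auto simp: besov_liouville_def)
  obtain g where g: "g \<in> borel_measurable borel" "\<And>x. x \<notin> {0..1} \<Longrightarrow> g x = 0"
    "integrable lborel (\<lambda>x. (g x)\<^sup>2)" "AE s in unit_leb. g0 s = g s"
    using L2_unit_ex_borel[OF g0(1)] by blast
  have eq: "frac_int_left \<beta> g0 s = frac_conv \<beta> g s" if "s \<in> {0..1}" for s
    using that by (intro frac_int_left_eq_kernel g) auto
  have "AE s in unit_leb. f s = frac_conv \<beta> g s"
    using g0(2) unfolding AE_unit_leb_iff by eventually_elim (use eq in auto)
  then have "liouville_rep \<beta> f g" using g by (auto simp: liouville_rep_def)
  then show ?thesis by (rule that)
qed

lemma integrable_unit_leb_iff_lborel:
  fixes h :: "real \<Rightarrow> real"
  assumes "h \<in> borel_measurable borel" "\<And>x. x \<notin> {0..1} \<Longrightarrow> h x = 0"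
  shows "integrable unit_leb h \<longleftrightarrow> integrable lborel h"
proof -
  have "(\<lambda>x. indicator {0..1} x *\<^sub>R h x) = h"
  proof
    show "indicator {0..1} x *\<^sub>R h x = h x" for x
      by (cases "x \<in> {0..1}") (simp_all add: assms(2))
  qed
  then show ?thesis using assms(1)
    by (subst integrable_restrict_space) (auto simp: integrable_completion)
qed

lemma liouville_rep_in_besov_liouville:
  assumes "liouville_rep \<beta> f g"
  shows "f \<in> besov_liouville \<beta>"
proof -
  note g = liouville_repD[OF assms]
  note [measurable] = g(1)
  have "g \<in> borel_measurable unit_leb"
    using g(1) by (intro measurable_restrict_space1 measurable_completion) simp
  moreover have "integrable unit_leb (\<lambda>s. (g s)\<^sup>2)"
    using g by (subst integrable_unit_leb_iff_lborel) auto
  ultimately have "g \<in> L2_unit" by (simp add: L2_unit_def)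
  moreover have "frac_int_left \<beta> g s = frac_conv \<beta> g s" if "s \<in> {0..1}" for s
    using that by (intro frac_int_left_eq_kernel g) auto
  then have "AE s in unit_leb. f s = frac_int_left \<beta> g s"
    using g(4) unfolding AE_unit_leb_iff by (auto elim!: eventually_mono)
  ultimately show ?thesis by (auto simp: besov_liouville_def)
qed

lemma frac_kernel_conv_measurable:
  assumes [measurable]: "g \<in> borel_measurable borel"
  shows "(\<lambda>s. \<integral>r. frac_kernel a (s - r) * g r \<partial>lborel) \<in> borel_measurable borel"
  by measurable

text \<open>\<open>D\<^sup>\<beta> I\<^sup>\<beta> g = g\<close> almost everywhere: the kernels convolve to the indicator of the half line,
  so the function to be differentiated is the primitive of \<open>g\<close>.\<close>

lemma frac_deriv_left_rep:
  assumes \<beta>: "0 < \<beta>" "\<beta> < 1" and rep: "liouville_rep \<beta> f g"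
  shows "AE s in unit_leb. frac_deriv_left \<beta> f s = g s"
proof -
  note g = liouville_repD[OF rep]
  note [measurable] = g(1)
  have gi: "integrable lborel g" by (rule liouville_rep_integrable[OF rep])
  define F where "F s = indicator {0..1} s * frac_conv \<beta> g s" for s
  have [measurable]: "F \<in> borel_measurable borel"
    unfolding F_def using frac_kernel_conv_measurable[OF g(1)] by measurable
  have F: "AE s in unit_leb. f s = F s"
    using g(4) unfolding AE_unit_leb_iff by eventually_elim (auto simp: F_def)
  have hk: "g integrable_on {0..1}"
    using integrable_on_lborel[OF gi] integrable_on_subinterval by (metis UNIV_I integrable_on_subcbox cbox_interval subset_UNIV)
  define G where "G s = set_lebesgue_integral lebesgue {0..s} (\<lambda>r. (s - r) powr (- \<beta>) * f r)" for s
  have "Gamma (1 - \<beta>) > 0" by (rule Gamma_real_pos) (use \<beta> in simp)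
  then have G0: "Gamma (1 - \<beta>) \<noteq> 0" by simp
  have G: "G s = Gamma (1 - \<beta>) * integral {0..s} g" if s: "0 \<le> s" "s \<le> 1" for s
  proof -
    have "G s = Gamma (1 - \<beta>) * frac_int_left (1 - \<beta>) f s"
      using G0 by (simp add: G_def frac_int_left_def)
    also have "frac_int_left (1 - \<beta>) f s = frac_conv (1 - \<beta>) F s"
      using s by (intro frac_int_left_eq_kernel F) (auto simp: F_def)
    \<comment> \<open>Removing the cutoff in \<open>F\<close> changes nothing: for
      \<open>r < 0\<close> the convolution vanishes because \<open>g\<close> does, and beyond
      \<open>s\<close> the kernel vanishes. The order \<open>1 - (1 - \<beta>)\<close> is written so
      that the semigroup law applies with \<open>a = 1 - \<beta>\<close>.\<close>
    also have "\<dots> = (\<integral>r. frac_kernel (1 - \<beta>) (s - r) * frac_conv (1 - (1 - \<beta>)) g r \<partial>lborel)"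
    proof (intro Bochner_Integration.integral_cong refl)
      fix r
      show "frac_kernel (1 - \<beta>) (s - r) * F r = frac_kernel (1 - \<beta>) (s - r) * frac_conv (1 - (1 - \<beta>)) g r"
      proof (cases "r < 0")
        case True
        then have "frac_conv \<beta> g r = (\<integral>q. 0 \<partial>(lborel::real measure))"
          using g(2) by (intro Bochner_Integration.integral_cong refl) (auto simp: frac_kernel_def)
        then show ?thesis by (simp add: F_def)
      next
        case False
        then show ?thesis using s by (auto simp: F_def frac_kernel_def indicator_def)
      qed
    qed
    also have "\<dots> = (\<integral>q. indicator {..<s} q * g q \<partial>lborel)"
      using \<beta> by (intro frac_kernel_semigroup gi) auto
    also have "\<dots> = (\<integral>q. indicator {0..s} q *\<^sub>R g q \<partial>lborel)"
      using AE_lborel_singleton[of s] g(2)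
      by (intro integral_cong_AE) (auto elim!: eventually_mono simp: indicator_def)
    also have "\<dots> = integral {0..s} g"
      using set_borel_integral_eq_integral(2)[of "{0..s}" g] integrable_mult_indicator[OF _ gi, of "{0..s}"]
      by (simp add: set_lebesgue_integral_def set_integrable_def)
    finally show ?thesis .
  qed
  let ?N = "{x\<in>{0<..<1}. \<not> ((\<lambda>u. integral {0..u} g) has_real_derivative g x) (at x)}"
  have "negligible ?N" by (rule indefinite_integral_has_derivative_ae[OF hk])
  then have "AE x in lebesgue. x \<notin> ?N" by (intro AE_not_in) (simp add: negligible_iff_null_sets)
  then have N: "AE x in lborel. x \<notin> ?N" by (simp only: AE_completion_iff)
  have "AE x in lborel. x \<in> {0..1} \<longrightarrow> frac_deriv_left \<beta> f x = g x"
    using N AE_lborel_singleton[of 0] AE_lborel_singleton[of 1]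
  proof eventually_elim
    fix x :: real assume x: "x \<notin> ?N" "x \<noteq> 0" "x \<noteq> 1"
    show "x \<in> {0..1} \<longrightarrow> frac_deriv_left \<beta> f x = g x"
    proof
      assume "x \<in> {0..1}"
      then have x01: "x \<in> {0<..<1}" using x by auto
      have "((\<lambda>u. integral {0..u} g) has_real_derivative g x) (at x)" using x x01 by blast
      then have "((\<lambda>u. Gamma (1 - \<beta>) * integral {0..u} g) has_real_derivative Gamma (1 - \<beta>) * g x) (at x)"
        by (rule DERIV_cmult)
      \<comment> \<open>\<open>G\<close> is known only on the unit interval, hence the passage
        through the open interval and the exclusion of both end points.\<close>
      then have "(G has_real_derivative Gamma (1 - \<beta>) * g x) (at x)"
        by (rule has_field_derivative_transform_within_open[of _ _ _ "{0<..<1}"]) (use x01 G in auto)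
      then show "frac_deriv_left \<beta> f x = g x"
        using G0 by (simp add: frac_deriv_left_def G_def[abs_def] DERIV_imp_deriv)
    qed
  qed
  then show ?thesis by (simp only: AE_unit_leb_iff)
qed

text \<open>This makes the fractional integral an isometry from L2; after it, inner products are
  computed from densities alone.\<close>

lemma besov_liouville_inner_rep:
  assumes \<beta>: "0 < \<beta>" "\<beta> < 1" and rep: "liouville_rep \<beta> f g" "liouville_rep \<beta> f' g'"
  shows "besov_liouville_inner \<beta> f f' = (\<integral>s. g s * g' s \<partial>lborel)"
proof -
  note g = liouville_repD[OF rep(1)] and g' = liouville_repD[OF rep(2)]
  note [measurable] = g(1) g'(1)
  have "besov_liouville_inner \<beta> f f' = (\<integral>s. indicator {0..1} s *\<^sub>R (frac_deriv_left \<beta> f s * frac_deriv_left \<beta> f' s) \<partial>lebesgue)"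
    unfolding besov_liouville_inner_def by (subst integral_restrict_space) auto
  also have "\<dots> = (\<integral>s. g s * g' s \<partial>lborel)"
  proof (rule integral_lebesgue_cong_AE)
    show "AE s in lborel. indicator {0..1} s *\<^sub>R (frac_deriv_left \<beta> f s * frac_deriv_left \<beta> f' s) = g s * g' s"
      using frac_deriv_left_rep[OF \<beta> rep(1), unfolded AE_unit_leb_iff] frac_deriv_left_rep[OF \<beta> rep(2), unfolded AE_unit_leb_iff]
      by eventually_elim (use g(2) g'(2) in \<open>auto simp: indicator_def\<close>)
  qed measurable
  finally show ?thesis .
qed


subsection \<open>The jump elements\<close>

lemma has_bochner_integral_powr_shift:
  fixes a t d :: real
  assumes a: "-1 < a" and td: "t \<le> d"
  shows "has_bochner_integral lborel (\<lambda>s. indicator {t<..d} s * (s - t) powr a) ((d - t) powr (a + 1) / (a + 1))"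
proof (rule has_bochner_integral_nn_integral)
  show "0 \<le> (d - t) powr (a + 1) / (a + 1)" using a by simp
  have "(\<integral>\<^sup>+s. ennreal (indicator {t<..d} s * (s - t) powr a) \<partial>lborel)
     = ennreal \<bar>1\<bar> * (\<integral>\<^sup>+s. ennreal (indicator {t<..d} (t + 1 * s) * ((t + 1 * s) - t) powr a) \<partial>lborel)"
    by (intro nn_integral_real_affine) auto
  also have "\<dots> = (\<integral>\<^sup>+s. ennreal (indicator {0..d - t} s * s powr a) \<partial>lborel)"
    by (simp, intro nn_integral_cong) (auto simp: indicator_def)
  also have "\<dots> = ennreal ((d - t) powr (a + 1) / (a + 1))"
    using a td by (intro nn_integral_has_integral_lebesgue has_integral_powr_from_0) auto
  finally show "(\<integral>\<^sup>+s. ennreal (indicator {t<..d} s * (s - t) powr a) \<partial>lborel) = ennreal ((d - t) powr (a + 1) / (a + 1))" .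
qed auto

text \<open>The constant is the integral of \<open>frac_kernel a\<close> over the unit interval.
  Being uniform in \<open>s\<close>, it bounds fractional integrals of bounded functions and
  dominates in Fubini's theorem.\<close>

lemma nn_integral_frac_kernel_unit:
  assumes a: "0 < a" and s: "s \<le> 1"
  shows "(\<integral>\<^sup>+t. ennreal (frac_kernel a (s - t) * indicator {0..1} t) \<partial>lborel) \<le> ennreal (1 / (a * Gamma a))"
proof -
  have G: "Gamma a > 0" using a by (rule Gamma_real_pos)
  have "(\<integral>\<^sup>+t. ennreal (frac_kernel a (s - t) * indicator {0..1} t) \<partial>lborel)
     = ennreal \<bar>-1\<bar> * (\<integral>\<^sup>+t. ennreal (frac_kernel a (s - (s + (-1) * t)) * indicator {0..1} (s + (-1) * t)) \<partial>lborel)"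
    by (intro nn_integral_real_affine) auto
  also have "\<dots> \<le> (\<integral>\<^sup>+t. ennreal (1 / Gamma a) * ennreal (indicator {0<..1} t * (t - 0) powr (a - 1)) \<partial>lborel)"
  proof (simp, intro nn_integral_mono)
    fix t :: real
    have "frac_kernel a t * indicator {0..1} (s - t) \<le> 1 / Gamma a * (indicator {0<..1} t * t powr (a - 1))"
      using s G by (auto simp: frac_kernel_def indicator_def)
    then show "ennreal (frac_kernel a t * indicator {0..1} (s - t)) \<le> ennreal (1 / Gamma a) * ennreal (indicator {0<..1} t * t powr (a - 1))"
      using G by (subst ennreal_mult'[symmetric]) (auto intro: ennreal_leI)
  qed
  also have "\<dots> = ennreal (1 / Gamma a) * (\<integral>\<^sup>+t. ennreal (indicator {0<..1} t * (t - 0) powr (a - 1)) \<partial>lborel)"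
    by (intro nn_integral_cmult) auto
  also have "(\<integral>\<^sup>+t. ennreal (indicator {0<..1} t * (t - 0) powr (a - 1)) \<partial>lborel) = ennreal (1 / a)"
    using has_bochner_integral_powr_shift[of "a - 1" 0 1] a
    by (subst nn_integral_eq_integral) (auto simp: has_bochner_integral_iff)
  also have "ennreal (1 / Gamma a) * ennreal (1 / a) = ennreal (1 / (a * Gamma a))"
    using a G by (subst ennreal_mult'[symmetric]) (auto simp: field_simps)
  finally show ?thesis .
qed

section \<open>Riemann sums\<close>

text \<open>The right end of the cell from \<open>i / n\<close> to \<open>(i + 1) / n\<close>: in
  the discretization every jump is delayed to the end of its cell.\<close>

abbreviation grid :: "nat \<Rightarrow> nat \<Rightarrow> real" where
  "grid n i \<equiv> real (Suc i) / real n"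

lemma riemann_sum_error:
  fixes f :: "real \<Rightarrow> real"
  assumes n: "0 < n" and cont: "continuous_on {0..1} f"
    and mod: "\<And>s t. s \<in> {0..1} \<Longrightarrow> t \<in> {0..1} \<Longrightarrow> \<bar>s - t\<bar> \<le> 1 / real n \<Longrightarrow> \<bar>f s - f t\<bar> \<le> \<eta>"
  shows "\<bar>(\<integral>t. indicator {0..1} t * f t \<partial>lborel) - (\<Sum>i<n. f (grid n i)) / real n\<bar> \<le> \<eta>"
proof -
  have int: "f integrable_on {a..b}" if "0 \<le> a" "b \<le> 1" for a b
    using cont that by (intro integrable_continuous_interval continuous_on_subset[OF cont]) auto
  have step: "\<bar>integral {0..real m / real n} f - (\<Sum>i<m. f (grid n i)) / real n\<bar> \<le> real m * \<eta> / real n"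
    if "m \<le> n" for m
    using that
  proof (induction m)
    case (Suc m)
    let ?a = "real m / real n" and ?b = "real (Suc m) / real n"
    have ab: "0 \<le> ?a" "?a \<le> ?b" "?b \<le> 1" "?b - ?a = 1 / real n"
      using n Suc.prems by (auto simp: field_simps)
    have "integral {0..?a} f + integral {?a..?b} f = integral {0..?b} f"
      using ab by (intro Henstock_Kurzweil_Integration.integral_combine int) auto
    moreover have "\<bar>integral {?a..?b} f - f ?b / real n\<bar> \<le> \<eta> / real n"
    proof -
      have "integral {?a..?b} f - f ?b / real n = integral {?a..?b} (\<lambda>t. f t - f ?b)"
        using ab by (subst Henstock_Kurzweil_Integration.integral_diff) (auto intro!: int simp: measure_lborel_Icc)
      also have "norm \<dots> \<le> \<eta> * (?b - ?a)"
      proof (rule integral_bound)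
        show "continuous_on {?a..?b} (\<lambda>t. f t - f ?b)"
          using ab by (intro continuous_intros continuous_on_subset[OF cont]) auto
        show "norm (f t - f ?b) \<le> \<eta>" if "t \<in> {?a..?b}" for t
        proof -
          have "0 \<le> t" "t \<le> 1" "0 \<le> ?b" using ab that by (auto intro: order_trans[OF ab(1)] order_trans)
          moreover have "\<bar>t - ?b\<bar> \<le> 1 / real n" using ab(4) that by (auto simp: abs_if)
          ultimately show ?thesis using mod[of t ?b] ab(3) by simp
        qed
      qed (use ab in auto)
      finally show ?thesis using ab by simp
    qed
    moreover have "\<bar>integral {0..?a} f - (\<Sum>i<m. f (grid n i)) / real n\<bar> \<le> real m * \<eta> / real n"
      using Suc by simp
    moreover have "(\<Sum>i<Suc m. f (grid n i)) / real n = (\<Sum>i<m. f (grid n i)) / real n + f ?b / real n"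
      by (simp add: add_divide_distrib)
    moreover have "real (Suc m) * \<eta> / real n = real m * \<eta> / real n + \<eta> / real n"
      by (simp add: add_divide_distrib algebra_simps)
    ultimately show ?case by linarith
  qed simp
  have "(\<integral>t. indicator {0..1} t *\<^sub>R f t \<partial>lborel) = integral {0..1} f"
    using set_borel_integral_eq_integral(2)[OF borel_integrable_atLeastAtMost'[OF cont]]
    by (simp add: set_lebesgue_integral_def)
  then show ?thesis using step[of n] n by simp
qed

section \<open>The Hilbert space and its representing functions\<close>

locale besov_liouville_model =
  fixes \<beta> :: real
    and \<rho> :: "'k::{real_inner, banach, second_countable_topology} \<Rightarrow> real \<Rightarrow> real"
  assumes \<beta>_pos: "0 < \<beta>" and \<beta>_less: "\<beta> < 1 / 2"
    and space: "is_besov_liouville_space \<beta> \<rho>"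
begin

lemma \<beta>01: "0 < \<beta>" "\<beta> < 1" using \<beta>_pos \<beta>_less by auto

lemma \<rho>_lincomb: "AE s in unit_leb. \<rho> (a *\<^sub>R x + b *\<^sub>R y) s = a * \<rho> x s + b * \<rho> y s"
  using space unfolding is_besov_liouville_space_def by blast

lemma inner_eq_liouville_rep:
  assumes "liouville_rep \<beta> (\<rho> x) g" "liouville_rep \<beta> (\<rho> y) h"
  shows "x \<bullet> y = (\<integral>s. g s * h s \<partial>lborel)"
proof -
  have "x \<bullet> y = besov_liouville_inner \<beta> (\<rho> x) (\<rho> y)"
    using space unfolding is_besov_liouville_space_def by blast
  then show ?thesis using besov_liouville_inner_rep[OF \<beta>01 assms] by simp
qed

text \<open>If the representatives agree, the difference has density 0, hence norm 0.\<close>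

lemma \<rho>_inj:
  assumes "AE s in unit_leb. \<rho> x s = \<rho> y s"
  shows "x = y"
proof -
  have "AE s in unit_leb. \<rho> (1 *\<^sub>R x + (-1) *\<^sub>R y) s = (\<integral>r. frac_kernel \<beta> (s - r) * 0 \<partial>lborel)"
    using assms \<rho>_lincomb[of 1 x "-1" y] by eventually_elim simp
  then have "liouville_rep \<beta> (\<rho> (1 *\<^sub>R x + (-1) *\<^sub>R y)) (\<lambda>_. 0)"
    by (simp add: liouville_rep_def)
  from inner_eq_liouville_rep[OF this this] have "(x - y) \<bullet> (x - y) = 0" by simp
  then show ?thesis by simp
qed

lemma element_of_eqI:
  assumes "AE s in unit_leb. \<rho> x s = f s"
  shows "element_of \<rho> f = x"
  unfolding element_of_def
proof (rule the_equality)
  fix y assume "AE s in unit_leb. \<rho> y s = f s"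
  with assms have "AE s in unit_leb. \<rho> y s = \<rho> x s" by eventually_elim simp
  then show "y = x" by (rule \<rho>_inj)
qed fact

lemma element_of_rep:
  assumes "liouville_rep \<beta> f g"
  shows "AE s in unit_leb. \<rho> (element_of \<rho> f) s = f s" "liouville_rep \<beta> (\<rho> (element_of \<rho> f)) g"
proof -
  obtain x where x: "AE s in unit_leb. \<rho> x s = f s"
    using liouville_rep_in_besov_liouville[OF assms] space unfolding is_besov_liouville_space_def by blast
  show *: "AE s in unit_leb. \<rho> (element_of \<rho> f) s = f s"
    using x element_of_eqI[OF x] by simp
  show "liouville_rep \<beta> (\<rho> (element_of \<rho> f)) g"
    using assms * unfolding liouville_rep_def by (auto elim: eventually_elim2)
qed

text \<open>A chosen density of \<open>\<rho> x\<close>, that is, one fixed Borel version of its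
  fractional derivative.\<close>

definition preimage :: "'k \<Rightarrow> real \<Rightarrow> real" where
  "preimage x = (SOME g. liouville_rep \<beta> (\<rho> x) g)"

lemma preimage_rep: "liouville_rep \<beta> (\<rho> x) (preimage x)"
proof -
  have "\<rho> x \<in> besov_liouville \<beta>" using space unfolding is_besov_liouville_space_def by blast
  then show ?thesis using besov_liouville_ex_rep unfolding preimage_def by (metis someI_ex)
qed

lemma \<rho>_sum:
  assumes "finite I"
  shows "AE s in unit_leb. \<rho> (\<Sum>i\<in>I. x i) s = (\<Sum>i\<in>I. \<rho> (x i) s)"
  using assms
proof (induction I)
  case empty
  then show ?case using \<rho>_lincomb[of 0 0 0 0] by simp
next
  case (insert i I)
  have "AE s in unit_leb. \<rho> (1 *\<^sub>R x i + 1 *\<^sub>R (\<Sum>i\<in>I. x i)) s = 1 * \<rho> (x i) s + 1 * \<rho> (\<Sum>i\<in>I. x i) s"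
    by (rule \<rho>_lincomb)
  with insert.IH show ?case by eventually_elim (simp add: insert.hyps)
qed

section \<open>Step functions as elements of the space\<close>

text \<open>The fractional derivative of the step function at \<open>t\<close>: by the Beta integral
  the fractional integral of order \<beta> maps it to the indicator of the points beyond
  \<open>t\<close>. It behaves like the power -\<beta> near \<open>t\<close>, so \<beta> < 1/2 makes
  it square integrable.\<close>

definition jump_density :: "real \<Rightarrow> real \<Rightarrow> real" where
  "jump_density t s = indicator {0..1} s * frac_kernel (1 - \<beta>) (s - t)"

definition jump :: "real \<Rightarrow> 'k" where
  "jump t = element_of \<rho> (indicator {t..1})"

text \<open>The factor 2 stems from the Hoelder estimate \<open>norm_jump_diff_le\<close>. With it,
  one constant serves both for differences and for single elements.\<close>

definition hoelder_const :: real where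
  "hoelder_const = sqrt (2 / ((1 - 2 * \<beta>) * (Gamma (1 - \<beta>))\<^sup>2))"

lemma Gamma_pos': "Gamma (1 - \<beta>) > 0"
  by (rule Gamma_real_pos) (use \<beta>01 in simp)

lemma Gamma_nonzero': "Gamma (1 - \<beta>) \<noteq> 0"
  using Gamma_pos' by (rule less_imp_neq[symmetric])

lemma jump_density_measurable [measurable]: "jump_density t \<in> borel_measurable borel"
  unfolding jump_density_def by measurable

lemma jump_density_sq:
  assumes "0 \<le> t" "t \<le> 1"
  shows "(jump_density t s)\<^sup>2 = indicator {t<..1} s * (s - t) powr (- 2 * \<beta>) / (Gamma (1 - \<beta>))\<^sup>2"
proof (cases "t < s \<and> s \<le> 1")
  case True
  have "((s - t) powr (- \<beta>))\<^sup>2 = (s - t) powr (- 2 * \<beta>)"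
    by (simp add: power2_eq_square powr_add[symmetric])
  then show ?thesis using True assms by (simp add: jump_density_def frac_kernel_def power_divide)
next
  case False
  then show ?thesis using assms by (auto simp: jump_density_def frac_kernel_def)
qed

lemma jump_density_sq_integral:
  assumes "0 \<le> t" "t \<le> 1"
  shows "has_bochner_integral lborel (\<lambda>s. (jump_density t s)\<^sup>2) ((1 - t) powr (1 - 2 * \<beta>) / ((1 - 2 * \<beta>) * (Gamma (1 - \<beta>))\<^sup>2))"
proof -
  have "has_bochner_integral lborel (\<lambda>s. indicator {t<..1} s * (s - t) powr (- 2 * \<beta>) / (Gamma (1 - \<beta>))\<^sup>2)
     ((1 - t) powr (- 2 * \<beta> + 1) / (- 2 * \<beta> + 1) / (Gamma (1 - \<beta>))\<^sup>2)"
    using assms \<beta>_less by (intro has_bochner_integral_divide_zero has_bochner_integral_powr_shift) auto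
  then show ?thesis by (simp add: jump_density_sq[OF assms, abs_def])
qed

lemma jump_rep:
  assumes t: "0 \<le> t" "t \<le> 1"
  shows "liouville_rep \<beta> (indicator {t..1}) (jump_density t)"
  unfolding liouville_rep_def
proof (intro conjI allI impI)
  show "integrable lborel (\<lambda>s. (jump_density t s)\<^sup>2)"
    using jump_density_sq_integral[OF t] by (simp add: has_bochner_integral_iff)
  have eq: "(\<integral>r. frac_kernel \<beta> (s - r) * jump_density t r \<partial>lborel) = indicator {t<..} s" if s: "s \<in> {0..1}" for s
  proof -
    have "(\<integral>r. frac_kernel \<beta> (s - r) * jump_density t r \<partial>lborel) = (\<integral>r. frac_kernel \<beta> (s - r) * frac_kernel (1 - \<beta>) (r - t) \<partial>lborel)"
      using s t by (intro Bochner_Integration.integral_cong refl) (auto simp: jump_density_def frac_kernel_def indicator_def)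
    then show ?thesis using integral_frac_kernel_conv_shift[OF \<beta>01] by simp
  qed
  show "AE s in unit_leb. indicator {t..1} s = (\<integral>r. frac_kernel \<beta> (s - r) * jump_density t r \<partial>lborel)"
    unfolding AE_unit_leb_iff using AE_lborel_singleton[of t]
    by eventually_elim (use eq in \<open>auto simp: indicator_def\<close>)
qed (auto simp: jump_density_def)

lemmas \<rho>_jump = element_of_rep(1)[OF jump_rep, folded jump_def]
lemmas jump_rep' = element_of_rep(2)[OF jump_rep, folded jump_def]

text \<open>Read as a function of \<open>t\<close>, the right-hand side is the right fractional
  integral of order \<open>1 - \<beta>\<close> of the fractional derivative of \<open>u\<close>: the
  two innermost operators of \<open>brownian_covariance\<close>.\<close>

lemma inner_jump:
  assumes t: "0 \<le> t" "t \<le> 1"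
  shows "jump t \<bullet> u = (\<integral>s. frac_kernel (1 - \<beta>) (s - t) * preimage u s \<partial>lborel)"
proof -
  have "jump t \<bullet> u = (\<integral>s. jump_density t s * preimage u s \<partial>lborel)"
    by (rule inner_eq_liouville_rep[OF jump_rep'[OF t] preimage_rep])
  also have "\<dots> = (\<integral>s. frac_kernel (1 - \<beta>) (s - t) * preimage u s \<partial>lborel)"
    using liouville_repD(2)[OF preimage_rep, of _ u]
    by (intro Bochner_Integration.integral_cong refl) (auto simp: jump_density_def indicator_def)
  finally show ?thesis .
qed

lemma norm_jump_le:
  assumes t: "0 \<le> t" "t \<le> 1"
  shows "norm (jump t) \<le> hoelder_const"
proof -
  have G: "0 < (1 - 2 * \<beta>) * (Gamma (1 - \<beta>))\<^sup>2" using \<beta>_less Gamma_nonzero' by simp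
  have "(norm (jump t))\<^sup>2 = (\<integral>s. jump_density t s * jump_density t s \<partial>lborel)"
    unfolding power2_norm_eq_inner by (rule inner_eq_liouville_rep[OF jump_rep'[OF t] jump_rep'[OF t]])
  also have "\<dots> = (1 - t) powr (1 - 2 * \<beta>) / ((1 - 2 * \<beta>) * (Gamma (1 - \<beta>))\<^sup>2)"
    using jump_density_sq_integral[OF t] by (simp add: has_bochner_integral_iff power2_eq_square)
  also have "\<dots> \<le> 2 / ((1 - 2 * \<beta>) * (Gamma (1 - \<beta>))\<^sup>2)"
  proof (rule divide_right_mono)
    have "(1 - t) powr (1 - 2 * \<beta>) \<le> 1 powr (1 - 2 * \<beta>)"
      using t \<beta>_less by (intro powr_mono2) auto
    then show "(1 - t) powr (1 - 2 * \<beta>) \<le> 2" by simp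
  qed (use G in simp)
  finally show ?thesis unfolding hoelder_const_def by (rule real_le_rsqrt)
qed

text \<open>The bound rests on \<open>(a - b)\<^sup>2 \<le> \<bar>a\<^sup>2 - b\<^sup>2\<bar>\<close> for nonnegative \<open>a\<close>, \<open>b\<close>, which makes all integrals explicit.\<close>

lemma norm_jump_diff_le:
  assumes s: "0 \<le> s" "s \<le> 1" and t: "0 \<le> t" "t \<le> 1"
  shows "norm (jump s - jump t) \<le> hoelder_const * \<bar>s - t\<bar> powr (1 / 2 - \<beta>)"
proof -
  have main: "norm (jump s - jump t) \<le> hoelder_const * \<bar>s - t\<bar> powr (1 / 2 - \<beta>)"
    if s: "0 \<le> s" "s \<le> 1" and t: "0 \<le> t" "t \<le> 1" and ts: "t \<le> s" for s t
  proof -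
    let ?\<gamma> = "1 - 2 * \<beta>" and ?G = "(Gamma (1 - \<beta>))\<^sup>2"
    have G: "0 < ?G" "0 < ?\<gamma>" using \<beta>_less Gamma_nonzero' by simp_all
    let ?p = "jump_density t" and ?q = "jump_density s"
    have int: "integrable lborel (\<lambda>r. ?p r * ?p r)" "integrable lborel (\<lambda>r. ?q r * ?q r)"
      "integrable lborel (\<lambda>r. ?p r * ?q r)"
      using jump_density_sq_integral[OF s] jump_density_sq_integral[OF t]
      by (auto intro!: integrable_mult_of_squares simp: has_bochner_integral_iff)
    have "(norm (jump s - jump t))\<^sup>2 = jump s \<bullet> jump s - 2 * (jump t \<bullet> jump s) + jump t \<bullet> jump t"
      unfolding power2_norm_eq_inner by (simp add: inner_diff inner_commute algebra_simps)
    also have "\<dots> = (\<integral>r. ?q r * ?q r \<partial>lborel) - 2 * (\<integral>r. ?p r * ?q r \<partial>lborel) + (\<integral>r. ?p r * ?p r \<partial>lborel)"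
      by (simp add: inner_eq_liouville_rep[OF jump_rep'[OF s] jump_rep'[OF s]]
          inner_eq_liouville_rep[OF jump_rep'[OF t] jump_rep'[OF s]] inner_eq_liouville_rep[OF jump_rep'[OF t] jump_rep'[OF t]])
    also have "\<dots> = (\<integral>r. ?q r * ?q r - 2 * (?p r * ?q r) + ?p r * ?p r \<partial>lborel)"
      using int by simp
    \<comment> \<open>Up to \<open>s\<close> the density \<open>?q\<close> vanishes and the bound
      reads \<open>2 * p\<^sup>2 - p\<^sup>2\<close>; beyond \<open>s\<close> it reads
      \<open>q\<^sup>2 - p\<^sup>2\<close>. In this form each of the three terms is an explicit
      power integral.\<close>
    also have "\<dots> \<le> (\<integral>r. 2 * (indicator {t<..s} r * (r - t) powr (- 2 * \<beta>) / ?G)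
         + indicator {s<..1} r * (r - s) powr (- 2 * \<beta>) / ?G - indicator {t<..1} r * (r - t) powr (- 2 * \<beta>) / ?G \<partial>lborel)"
      (is "_ \<le> (\<integral>r. ?R r \<partial>lborel)")
    proof (rule integral_mono)
      show "integrable lborel (\<lambda>r. ?q r * ?q r - 2 * (?p r * ?q r) + ?p r * ?p r)" using int by simp
      have i: "integrable lborel (\<lambda>r. indicator {a<..d} r * (r - a) powr (- 2 * \<beta>))" if "a \<le> d" for a d
        using has_bochner_integral_powr_shift[of "- 2 * \<beta>" a d] \<beta>_less that by (auto simp: has_bochner_integral_iff)
      show "integrable lborel ?R"
        using s t ts by (intro Bochner_Integration.integrable_add Bochner_Integration.integrable_diff
          integrable_mult_right integrable_divide_zero i) auto
      fix r :: real
      have "?q r * ?q r - 2 * (?p r * ?q r) + ?p r * ?p r = (?p r - ?q r)\<^sup>2"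
        by (simp add: power2_eq_square algebra_simps)
      also have "\<dots> \<le> ?R r"
      proof (cases "r \<le> s")
        case True
        then have q0: "?q r = 0" by (simp add: jump_density_def frac_kernel_def)
        have "?R r = (?p r)\<^sup>2" using True s t
          unfolding jump_density_sq[OF t] by (auto simp: indicator_def)
        then show ?thesis using q0 by simp
      next
        case False
        show ?thesis
        proof (cases "r \<le> 1")
          case True
          \<comment> \<open>The power with exponent -\<beta> decreases, and \<open>r - s\<close> is
            at most \<open>r - t\<close>.\<close>
          have le: "?p r \<le> ?q r"
            unfolding jump_density_def frac_kernel_def using False True ts s t Gamma_pos' \<beta>_pos
            by (auto simp: divide_simps intro!: powr_mono2')
          have "0 \<le> ?p r" using \<beta>01 by (simp add: jump_density_def frac_kernel_nonneg)
          with le have "?p r * ?p r \<le> ?p r * ?q r" by (rule mult_left_mono)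
          then have "(?p r - ?q r)\<^sup>2 \<le> (?q r)\<^sup>2 - (?p r)\<^sup>2"
            by (simp add: power2_eq_square algebra_simps)
          also have "\<dots> = ?R r"
            using False True ts unfolding jump_density_sq[OF t] jump_density_sq[OF s] by simp
          finally show ?thesis .
        next
          case f: False
          then show ?thesis using s t by (simp add: jump_density_def)
        qed
      qed
      finally show "?q r * ?q r - 2 * (?p r * ?q r) + ?p r * ?p r \<le> ?R r" .
    qed
    also have "\<dots> = (2 * (s - t) powr ?\<gamma> + (1 - s) powr ?\<gamma> - (1 - t) powr ?\<gamma>) / (?\<gamma> * ?G)"
    proof -
      have hb: "has_bochner_integral lborel (\<lambda>r. indicator {a<..d} r * (r - a) powr (- 2 * \<beta>) / ?G) ((d - a) powr ?\<gamma> / (?\<gamma> * ?G))"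
        if "a \<le> d" for a d
      proof -
        have "has_bochner_integral lborel (\<lambda>r. indicator {a<..d} r * (r - a) powr (- 2 * \<beta>) / ?G)
          ((d - a) powr (- 2 * \<beta> + 1) / (- 2 * \<beta> + 1) / ?G)"
          using that \<beta>_less by (intro has_bochner_integral_divide_zero has_bochner_integral_powr_shift) auto
        then show ?thesis by simp
      qed
      have "has_bochner_integral lborel ?R (2 * ((s - t) powr ?\<gamma> / (?\<gamma> * ?G)) + (1 - s) powr ?\<gamma> / (?\<gamma> * ?G) - (1 - t) powr ?\<gamma> / (?\<gamma> * ?G))"
        using s t ts by (intro has_bochner_integral_add has_bochner_integral_diff has_bochner_integral_mult_right hb) auto
      then show ?thesis by (simp add: has_bochner_integral_iff add_divide_distrib diff_divide_distrib)
    qed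
    also have "\<dots> \<le> 2 * (s - t) powr ?\<gamma> / (?\<gamma> * ?G)"
    proof (rule divide_right_mono)
      have "(1 - s) powr ?\<gamma> \<le> (1 - t) powr ?\<gamma>" using s ts G by (intro powr_mono2) auto
      then show "2 * (s - t) powr ?\<gamma> + (1 - s) powr ?\<gamma> - (1 - t) powr ?\<gamma> \<le> 2 * (s - t) powr ?\<gamma>" by simp
    qed (use G in simp)
    also have "\<dots> = (hoelder_const * \<bar>s - t\<bar> powr (1 / 2 - \<beta>))\<^sup>2"
    proof -
      have "(\<bar>s - t\<bar> powr (1 / 2 - \<beta>))\<^sup>2 = (s - t) powr ?\<gamma>"
        using ts by (simp add: power2_eq_square powr_add[symmetric])
      moreover have "hoelder_const\<^sup>2 = 2 / (?\<gamma> * ?G)" using G by (simp add: hoelder_const_def)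
      ultimately show ?thesis by (simp add: power_mult_distrib)
    qed
    finally show ?thesis
      by (rule power2_le_imp_le) (use G in \<open>simp add: hoelder_const_def\<close>)
  qed
  show ?thesis
  proof (cases "t \<le> s")
    case True then show ?thesis using main s t by blast
  next
    case False
    then show ?thesis using main[of t s] s t by (simp add: norm_minus_commute abs_minus_commute)
  qed
qed

end

section \<open>Weak integrals along the path of step functions\<close>

context besov_liouville_model
begin

lemma continuous_on_jump: "continuous_on {0..1} jump"
  unfolding continuous_on_iff
proof (intro ballI allI impI)
  fix t e :: real assume t: "t \<in> {0..1}" and e: "0 < e"
  have "((\<lambda>s. hoelder_const * \<bar>s - t\<bar> powr (1 / 2 - \<beta>)) \<longlongrightarrow> hoelder_const * \<bar>t - t\<bar> powr (1 / 2 - \<beta>)) (at t)"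
    using \<beta>_less by (intro tendsto_intros tendsto_powr2) auto
  then have "((\<lambda>s. hoelder_const * \<bar>s - t\<bar> powr (1 / 2 - \<beta>)) \<longlongrightarrow> 0) (at t)" by simp
  then have "\<forall>\<^sub>F s in at t. hoelder_const * \<bar>s - t\<bar> powr (1 / 2 - \<beta>) < e"
    using e by (rule order_tendstoD)
  then obtain d where d: "d > 0" "\<And>s. s \<noteq> t \<Longrightarrow> dist s t < d \<Longrightarrow> hoelder_const * \<bar>s - t\<bar> powr (1 / 2 - \<beta>) < e"
    unfolding eventually_at by blast
  show "\<exists>d>0. \<forall>s\<in>{0..1}. dist s t < d \<longrightarrow> dist (jump s) (jump t) < e"
  proof (intro exI[of _ d] conjI ballI impI)
    fix s assume s: "s \<in> {0..1}" "dist s t < d"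
    show "dist (jump s) (jump t) < e"
    proof (cases "s = t")
      case False
      have "dist (jump s) (jump t) \<le> hoelder_const * \<bar>s - t\<bar> powr (1 / 2 - \<beta>)"
        unfolding dist_norm using s t by (intro norm_jump_diff_le) auto
      then show ?thesis using d(2)[OF False s(2)] by simp
    qed (use e in simp)
  qed fact
qed

definition modulus :: "nat \<Rightarrow> real" where
  "modulus n = hoelder_const * (1 / real n) powr (1 / 2 - \<beta>)"

lemma hoelder_const_nonneg: "0 \<le> hoelder_const"
  using \<beta>_less by (simp add: hoelder_const_def)

lemma modulus_tendsto_0: "modulus \<longlonglongrightarrow> 0"
proof -
  have "(\<lambda>n. hoelder_const * (1 / real n) powr (1 / 2 - \<beta>)) \<longlonglongrightarrow> hoelder_const * 0 powr (1 / 2 - \<beta>)"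
    using \<beta>_less by (intro tendsto_mult tendsto_const tendsto_powr2 lim_1_over_n) auto
  then show ?thesis by (simp add: modulus_def[abs_def])
qed

lemma norm_jump_diff_le_modulus:
  assumes "s \<in> {0..1}" "t \<in> {0..1}" "\<bar>s - t\<bar> \<le> 1 / real n"
  shows "norm (jump s - jump t) \<le> modulus n"
proof -
  have "norm (jump s - jump t) \<le> hoelder_const * \<bar>s - t\<bar> powr (1 / 2 - \<beta>)"
    using assms by (intro norm_jump_diff_le) auto
  also have "\<dots> \<le> modulus n"
    unfolding modulus_def using assms \<beta>_less hoelder_const_nonneg
    by (intro mult_left_mono powr_mono2) auto
  finally show ?thesis .
qed

lemma riemann_sum_jump_error:
  assumes n: "0 < n" and b: "continuous_on {0..1} b"
    and mod: "\<And>s t. s \<in> {0..1} \<Longrightarrow> t \<in> {0..1} \<Longrightarrow> \<bar>b s - b t\<bar> \<le> L * norm (jump s - jump t)" and L: "0 \<le> L"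
  shows "\<bar>(\<integral>t. indicator {0..1} t * b t \<partial>lborel) - (\<Sum>i<n. b (grid n i)) / real n\<bar> \<le> L * modulus n"
proof (rule riemann_sum_error[OF n b])
  fix s t :: real assume st: "s \<in> {0..1}" "t \<in> {0..1}" "\<bar>s - t\<bar> \<le> 1 / real n"
  show "\<bar>b s - b t\<bar> \<le> L * modulus n"
    using mod[OF st(1,2)] mult_left_mono[OF norm_jump_diff_le_modulus[OF st] L] by linarith
qed

text \<open>The semigroup law writes the primitive of \<open>b\<close> as a fractional integral of
  order \<beta> of the one of order 1 - \<beta>, so the latter is its density. By Fubini the kernel
  then moves onto the density of \<open>u\<close>, where it forms the inner product with
  \<open>jump t\<close>. Thus the primitive is the weak integral of \<open>b t\<close> times
  \<open>jump t\<close>; this is used for constant \<open>b\<close> (the drift) and for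
  \<open>b t = jump t \<bullet> u\<close> (the covariance).\<close>

lemma primitive_rep:
  assumes b: "b \<in> borel_measurable borel" "\<And>x. x \<notin> {0..1} \<Longrightarrow> b x = 0" "\<And>x. \<bar>b x\<bar> \<le> B"
  defines "w \<equiv> (\<lambda>s. indicator {0..1} s * frac_conv (1 - \<beta>) b s)"
  shows "liouville_rep \<beta> (\<lambda>s. \<integral>q. indicator {..<s} q * b q \<partial>lborel) w"
    and "liouville_rep \<beta> (\<rho> x) w \<Longrightarrow> x \<bullet> u = (\<integral>t. b t * (jump t \<bullet> u) \<partial>lborel)"
proof -
  note [measurable] = b(1)
  define Ck where "Ck = 1 / ((1 - \<beta>) * Gamma (1 - \<beta>))"
  have B0: "0 \<le> B" using abs_ge_zero[of "b 0"] b(3)[of 0] by linarith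
  have Ck0: "0 \<le> Ck" using \<beta>01 Gamma_pos' by (simp add: Ck_def)
  have k0: "0 \<le> frac_kernel (1 - \<beta>) y" for y using \<beta>01 by (intro frac_kernel_nonneg) auto
  have nn: "(\<integral>\<^sup>+t. ennreal \<bar>frac_kernel (1 - \<beta>) (s - t) * b t\<bar> \<partial>lborel) \<le> ennreal (B * Ck)" if "s \<le> 1" for s
  proof -
    have "(\<integral>\<^sup>+t. ennreal \<bar>frac_kernel (1 - \<beta>) (s - t) * b t\<bar> \<partial>lborel)
        \<le> (\<integral>\<^sup>+t. ennreal B * ennreal (frac_kernel (1 - \<beta>) (s - t) * indicator {0..1} t) \<partial>lborel)"
    proof (intro nn_integral_mono)
      fix t :: real
      have "\<bar>frac_kernel (1 - \<beta>) (s - t) * b t\<bar> \<le> B * (frac_kernel (1 - \<beta>) (s - t) * indicator {0..1} t)"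
      proof (cases "t \<in> {0..1}")
        case True
        then show ?thesis using mult_left_mono[OF b(3)[of t] k0[of "s - t"]] k0[of "s - t"]
          by (simp add: abs_mult mult.commute)
      qed (simp add: b(2))
      then show "ennreal \<bar>frac_kernel (1 - \<beta>) (s - t) * b t\<bar> \<le> ennreal B * ennreal (frac_kernel (1 - \<beta>) (s - t) * indicator {0..1} t)"
        using B0 by (subst ennreal_mult'[symmetric]) (auto intro: ennreal_leI)
    qed
    also have "\<dots> = ennreal B * (\<integral>\<^sup>+t. ennreal (frac_kernel (1 - \<beta>) (s - t) * indicator {0..1} t) \<partial>lborel)"
      by (intro nn_integral_cmult) auto
    also have "\<dots> \<le> ennreal B * ennreal Ck"
      unfolding Ck_def using \<beta>01 that by (intro mult_left_mono nn_integral_frac_kernel_unit) auto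
    also have "\<dots> = ennreal (B * Ck)" using B0 by (simp add: ennreal_mult')
    finally show ?thesis .
  qed
  have wm [measurable]: "w \<in> borel_measurable borel"
    unfolding w_def using frac_kernel_conv_measurable[OF b(1)] by measurable
  have w_bound: "\<bar>w s\<bar> \<le> indicator {0..1} s * (B * Ck)" for s
  proof (cases "s \<in> {0..1}")
    case True
    \<comment> \<open>Without integrability the integral is 0 by convention and the bound is
      trivial.\<close>
    have "ennreal \<bar>\<integral>t. frac_kernel (1 - \<beta>) (s - t) * b t \<partial>lborel\<bar> \<le> (\<integral>\<^sup>+t. ennreal \<bar>frac_kernel (1 - \<beta>) (s - t) * b t\<bar> \<partial>lborel)"
      using integral_norm_bound_ennreal[of lborel "\<lambda>t. frac_kernel (1 - \<beta>) (s - t) * b t"]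
      by (cases "integrable lborel (\<lambda>t. frac_kernel (1 - \<beta>) (s - t) * b t)") (auto simp: not_integrable_integral_eq)
    also have "\<dots> \<le> ennreal (B * Ck)" by (rule nn) (use True in simp)
    finally show ?thesis using True B0 Ck0 by (simp add: w_def)
  qed (simp add: w_def)
  have bi: "integrable lborel b"
  proof (rule Bochner_Integration.integrable_bound)
    show "integrable lborel (\<lambda>x. B * indicator {0..1::real} x)" by simp
    show "AE x in lborel. norm (b x) \<le> norm (B * indicator {0..1} x)"
    proof (intro AE_I2)
      fix x show "norm (b x) \<le> norm (B * indicator {0..1} x)"
        using b(3)[of x] B0 by (cases "x \<in> {0..1}") (simp_all add: b(2))
    qed
  qed simp
  show rep: "liouville_rep \<beta> (\<lambda>s. \<integral>q. indicator {..<s} q * b q \<partial>lborel) w"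
    unfolding liouville_rep_def
  proof (intro conjI allI impI wm)
    show "integrable lborel (\<lambda>x. (w x)\<^sup>2)"
    proof (rule Bochner_Integration.integrable_bound)
      show "integrable lborel (\<lambda>s. indicator {0..1::real} s * (B * Ck)\<^sup>2)" by simp
      show "AE x in lborel. norm ((w x)\<^sup>2) \<le> norm (indicator {0..1} x * (B * Ck)\<^sup>2)"
      proof (intro AE_I2)
        fix x show "norm ((w x)\<^sup>2) \<le> norm (indicator {0..1} x * (B * Ck)\<^sup>2)"
          using power_mono[OF w_bound[of x] abs_ge_zero, of 2] by (cases "x \<in> {0..1}") simp_all
      qed
    qed measurable
    have "(\<integral>q. indicator {..<s} q * b q \<partial>lborel) = frac_conv \<beta> w s" if s: "s \<in> {0..1}" for s
    proof -
      \<comment> \<open>The cutoff in \<open>w\<close> may be dropped: left of 0 the convolution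
        with \<open>b\<close> vanishes, right of \<open>s\<close> the kernel does.\<close>
      have "frac_conv \<beta> w s
        = (\<integral>r. frac_kernel \<beta> (s - r) * frac_conv (1 - \<beta>) b r \<partial>lborel)"
      proof (intro Bochner_Integration.integral_cong refl)
        fix r
        show "frac_kernel \<beta> (s - r) * w r = frac_kernel \<beta> (s - r) * frac_conv (1 - \<beta>) b r"
        proof (cases "r < 0")
          case True
          then have "frac_conv (1 - \<beta>) b r = (\<integral>q. 0 \<partial>(lborel::real measure))"
            using b(2) by (intro Bochner_Integration.integral_cong refl) (auto simp: frac_kernel_def)
          then show ?thesis using True by (simp add: w_def)
        next
          case False
          then show ?thesis using s by (auto simp: w_def frac_kernel_def indicator_def)
        qed
      qed
      also have "\<dots> = (\<integral>q. indicator {..<s} q * b q \<partial>lborel)"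
        using \<beta>01 bi by (intro frac_kernel_semigroup) auto
      finally show ?thesis by simp
    qed
    then show "AE s in unit_leb. (\<integral>q. indicator {..<s} q * b q \<partial>lborel) = frac_conv \<beta> w s"
      unfolding AE_unit_leb_iff by (intro AE_I2) blast
  qed (simp add: w_def)
  assume x: "liouville_rep \<beta> (\<rho> x) w"
  note g = liouville_repD[OF preimage_rep[of u]]
  note [measurable] = g(1)
  have gi: "integrable lborel (preimage u)" by (rule liouville_rep_integrable[OF preimage_rep])
  let ?f = "\<lambda>(s,t). frac_kernel (1 - \<beta>) (s - t) * b t * preimage u s"
  \<comment> \<open>The inner integral over \<open>t\<close> is bounded uniformly for
    \<open>s \<le> 1\<close>, and the density of \<open>u\<close> is integrable and supported in the
    unit interval.\<close>
  have fi: "integrable (lborel \<Otimes>\<^sub>M lborel) ?f"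
  proof (rule integrableI_bounded)
    show "?f \<in> borel_measurable (lborel \<Otimes>\<^sub>M lborel)" by measurable
    have "(\<integral>\<^sup>+p. ennreal (norm (?f p)) \<partial>(lborel \<Otimes>\<^sub>M lborel)) = (\<integral>\<^sup>+s. \<integral>\<^sup>+t. ennreal (norm (?f (s,t))) \<partial>lborel \<partial>lborel)"
      by (subst lborel.nn_integral_fst[symmetric]) auto
    also have "\<dots> \<le> (\<integral>\<^sup>+s. ennreal (B * Ck) * ennreal (norm (preimage u s)) \<partial>lborel)"
    proof (intro nn_integral_mono)
      fix s :: real
      show "(\<integral>\<^sup>+t. ennreal (norm (?f (s,t))) \<partial>lborel) \<le> ennreal (B * Ck) * ennreal (norm (preimage u s))"
      proof (cases "s \<in> {0..1}")
        case True
        have "(\<integral>\<^sup>+t. ennreal (norm (?f (s,t))) \<partial>lborel) = (\<integral>\<^sup>+t. ennreal \<bar>frac_kernel (1 - \<beta>) (s - t) * b t\<bar> * ennreal (norm (preimage u s)) \<partial>lborel)"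
          by (intro nn_integral_cong) (simp add: abs_mult ennreal_mult')
        also have "\<dots> = (\<integral>\<^sup>+t. ennreal \<bar>frac_kernel (1 - \<beta>) (s - t) * b t\<bar> \<partial>lborel) * ennreal (norm (preimage u s))"
          by (intro nn_integral_multc) measurable
        also have "\<dots> \<le> ennreal (B * Ck) * ennreal (norm (preimage u s))"
          by (intro mult_right_mono nn) (use True in auto)
        finally show ?thesis .
      qed (simp add: g(2))
    qed
    also have "\<dots> = ennreal (B * Ck) * (\<integral>\<^sup>+s. ennreal (norm (preimage u s)) \<partial>lborel)"
      by (intro nn_integral_cmult) auto
    also have "\<dots> < \<infinity>" using gi by (simp add: integrable_iff_bounded ennreal_mult_less_top)
    finally show "(\<integral>\<^sup>+p. ennreal (norm (?f p)) \<partial>(lborel \<Otimes>\<^sub>M lborel)) < \<infinity>" .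
  qed
  have "x \<bullet> u = (\<integral>s. w s * preimage u s \<partial>lborel)" by (rule inner_eq_liouville_rep[OF x preimage_rep])
  also have "\<dots> = (\<integral>s. (\<integral>t. ?f (s,t) \<partial>lborel) \<partial>lborel)"
  proof (intro Bochner_Integration.integral_cong refl)
    fix s show "w s * preimage u s = (\<integral>t. ?f (s,t) \<partial>lborel)"
      by (cases "s \<in> {0..1}") (simp_all add: w_def g(2))
  qed
  also have "\<dots> = (\<integral>t. (\<integral>s. ?f (s,t) \<partial>lborel) \<partial>lborel)"
    using fi by (intro lborel_pair.Fubini_integral[symmetric]) (simp add: case_prod_unfold)
  also have "\<dots> = (\<integral>t. b t * (jump t \<bullet> u) \<partial>lborel)"
  proof (intro Bochner_Integration.integral_cong refl)
    fix t show "(\<integral>s. ?f (s,t) \<partial>lborel) = b t * (jump t \<bullet> u)"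
    proof (cases "t \<in> {0..1}")
      case True
      have "(\<integral>s. ?f (s,t) \<partial>lborel) = (\<integral>s. b t * (frac_kernel (1 - \<beta>) (s - t) * preimage u s) \<partial>lborel)"
        by (simp add: mult_ac)
      also have "\<dots> = b t * (jump t \<bullet> u)"
        using True by (subst inner_jump) auto
      finally show ?thesis .
    qed (simp add: b(2))
  qed
  finally show "x \<bullet> u = (\<integral>t. b t * (jump t \<bullet> u) \<partial>lborel)" .
qed

definition drift :: 'k where "drift = element_of \<rho> (\<lambda>s. s)"

lemma drift_rep: "liouville_rep \<beta> (\<lambda>s. s) (\<lambda>s. indicator {0..1} s * (\<integral>t. frac_kernel (1 - \<beta>) (s - t) * indicator {0..1} t \<partial>lborel))"
proof -
  have rep: "liouville_rep \<beta> (\<lambda>s. \<integral>q. indicator {..<s} q * indicator {0..1} q \<partial>lborel) (\<lambda>s. indicator {0..1} s * (\<integral>t. frac_kernel (1 - \<beta>) (s - t) * indicator {0..1} t \<partial>lborel))"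
    by (rule primitive_rep(1)[where B = 1]) auto
  have "(\<integral>q. indicator {..<s} q * indicator {0..1} q \<partial>lborel) = s" if "s \<in> {0..1}" for s :: real
  proof -
    have "(\<lambda>q. indicator {..<s} q * indicator {0..1} q) = (indicator {0..<s} :: real \<Rightarrow> real)"
      using that by (auto simp: indicator_def)
    then show ?thesis using that by simp
  qed
  then show ?thesis using rep unfolding liouville_rep_def AE_unit_leb_iff
    by (auto elim!: eventually_mono)
qed

lemmas \<rho>_drift = element_of_rep(1)[OF drift_rep, folded drift_def]

lemma inner_drift: "drift \<bullet> u = (\<integral>t. indicator {0..1} t * (jump t \<bullet> u) \<partial>lborel)"
  by (rule primitive_rep(2)[where B = 1, OF _ _ _ element_of_rep(2)[OF drift_rep, folded drift_def]]) auto

text \<open>The error is tested against itself: its squared norm is a scalar Riemann error whose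
  integrand has modulus of continuity \<open>norm u * modulus n\<close>, and one factor
  \<open>norm u\<close> cancels. This avoids integrals with values in the space.\<close>

lemma drift_riemann:
  assumes n: "0 < n"
  shows "norm (drift - (\<Sum>i<n. jump (grid n i)) /\<^sub>R real n) \<le> modulus n"
proof -
  define u where "u = drift - (\<Sum>i<n. jump (grid n i)) /\<^sub>R real n"
  have "u \<bullet> u = (\<integral>t. indicator {0..1} t * (jump t \<bullet> u) \<partial>lborel) - (\<Sum>i<n. jump (grid n i) \<bullet> u) / real n"
    by (subst (1) u_def) (simp add: inner_diff_left inner_sum_left inner_drift divide_inverse mult.commute)
  also have "\<dots> \<le> norm u * modulus n"
  proof (rule order_trans[OF abs_ge_self riemann_sum_jump_error[OF n]])
    show "continuous_on {0..1} (\<lambda>t. jump t \<bullet> u)" by (intro continuous_intros continuous_on_jump)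
    show "\<bar>jump s \<bullet> u - jump t \<bullet> u\<bar> \<le> norm u * norm (jump s - jump t)" for s t
      using Cauchy_Schwarz_ineq2[of "jump s - jump t" u] by (simp add: inner_diff_left mult.commute)
  qed simp_all
  finally have "norm u * norm u \<le> norm u * modulus n" by (simp add: power2_norm_eq_inner[symmetric] power2_eq_square)
  moreover have "0 \<le> modulus n" using hoelder_const_nonneg by (simp add: modulus_def)
  ultimately have "norm u \<le> modulus n" by (cases "u = 0") auto
  then show ?thesis by (simp add: u_def)
qed

text \<open>The four operators are evaluated from the inside. The derivative yields the density of
  \<open>u\<close>, the right integral turns it into \<open>b t = jump t \<bullet> u\<close>, the
  left integral of order 1 - \<beta> into \<open>w\<close>, and the last one makes \<open>w\<close>
  a density. By \<open>primitive_rep\<close> the result is the weak integral of \<open>b t\<close>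
  times \<open>jump t\<close>.\<close>

lemma inner_brownian_covariance:
  assumes x: "AE s in unit_leb. \<rho> x s = brownian_covariance \<beta> (\<rho> u) s"
  shows "x \<bullet> v = (\<integral>t. indicator {0..1} t * ((jump t \<bullet> u) * (jump t \<bullet> v)) \<partial>lborel)"
proof -
  define b where "b t = indicator {0..1} t * (jump t \<bullet> u)" for t
  define w where "w = (\<lambda>s. indicator {0..1} s * frac_conv (1 - \<beta>) b s)"
  have bm: "b \<in> borel_measurable borel"
    using borel_measurable_continuous_on_indicator[of "{0..1}" "\<lambda>t. jump t \<bullet> u"]
      continuous_on_inner[OF continuous_on_jump continuous_on_const, of u] by (simp add: b_def[abs_def])
  have b0: "\<And>t. t \<notin> {0..1} \<Longrightarrow> b t = 0" by (simp add: b_def)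
  have bB: "\<bar>b t\<bar> \<le> hoelder_const * norm u" for t
  proof (cases "t \<in> {0..1}")
    case True
    then have "\<bar>b t\<bar> \<le> norm (jump t) * norm u" using Cauchy_Schwarz_ineq2 by (simp add: b_def)
    also have "\<dots> \<le> hoelder_const * norm u" using True by (intro mult_right_mono norm_jump_le) auto
    finally show ?thesis .
  qed (use hoelder_const_nonneg in \<open>simp add: b_def\<close>)
  have rep_w: "liouville_rep \<beta> (\<lambda>s. \<integral>q. indicator {..<s} q * b q \<partial>lborel) w"
    unfolding w_def by (intro primitive_rep(1)[where B = "hoelder_const * norm u"] bm b0 bB)
  note wm = liouville_repD(1)[OF rep_w] and w0 = liouville_repD(2)[OF rep_w] and wsq = liouville_repD(3)[OF rep_w]
  note g = liouville_repD[OF preimage_rep[of u]]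
  have 1: "frac_int_right (1 - \<beta>) (frac_deriv_left \<beta> (\<rho> u)) t = b t" if "t \<in> {0..1}" for t
    using that by (subst frac_int_right_eq_kernel[OF g(1,2) frac_deriv_left_rep[OF \<beta>01 preimage_rep]])
      (auto simp: b_def inner_jump)
  have 2: "frac_int_left (1 - \<beta>) (frac_int_right (1 - \<beta>) (frac_deriv_left \<beta> (\<rho> u))) t = w t" if "t \<in> {0..1}" for t
    using that 1 by (subst frac_int_left_eq_kernel[OF bm b0]) (auto simp: w_def AE_unit_leb_iff)
  have 3: "brownian_covariance \<beta> (\<rho> u) s = frac_conv \<beta> w s" if "s \<in> {0..1}" for s
    unfolding brownian_covariance_def using that 2
    by (intro frac_int_left_eq_kernel[OF wm w0]) (auto simp: AE_unit_leb_iff)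
  have "AE s in unit_leb. \<rho> x s = frac_conv \<beta> w s"
    using x 3 unfolding AE_unit_leb_iff by (auto elim!: eventually_mono)
  with wm w0 wsq have "liouville_rep \<beta> (\<rho> x) w"
    unfolding liouville_rep_def by blast
  then have "x \<bullet> v = (\<integral>t. b t * (jump t \<bullet> v) \<partial>lborel)"
    by (intro primitive_rep(2)[where B = "hoelder_const * norm u"] bm b0 bB) (auto simp only: w_def)
  then show ?thesis by (simp add: b_def mult.assoc)
qed

end


subsection \<open>Lindeberg replacement\<close>

lemma pmf_nat_integral_sums:
  fixes p :: "nat pmf" and f :: "nat \<Rightarrow> real"
  assumes f: "\<And>k. 0 \<le> f k" and s: "(\<lambda>k. pmf p k * f k) sums s"
  shows "has_bochner_integral (measure_pmf p) f s"
proof (rule has_bochner_integral_nn_integral)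
  show s0: "0 \<le> s" by (rule sums_le[OF _ sums_zero s]) (simp add: f)
  have "(\<integral>\<^sup>+k. ennreal (f k) \<partial>measure_pmf p) = (\<Sum>k. ennreal (pmf p k * f k))"
    by (simp add: nn_integral_measure_pmf nn_integral_count_space_nat ennreal_mult' f)
  also have "\<dots> = ennreal s"
    using s s0 f by (intro sums_unique[symmetric]) simp
  finally show "(\<integral>\<^sup>+k. ennreal (f k) \<partial>measure_pmf p) = ennreal s" .
qed (simp_all add: f)

text \<open>For the r-th falling factorial, shifting the summation index by \<open>r\<close> leaves
  \<open>\<mu> ^ r\<close> times the exponential series.\<close>

lemma poisson_factorial_moment:
  assumes \<mu>: "0 < \<mu>" and nn: "\<And>k. 0 \<le> f k" and zero: "\<And>k. k < r \<Longrightarrow> f k = 0"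
    and shift: "\<And>k. f (k + r) = fact (k + r) / fact k"
  shows "has_bochner_integral (measure_pmf (poisson_pmf \<mu>)) f (\<mu> ^ r)"
proof (rule pmf_nat_integral_sums[OF nn])
  have "(\<lambda>k. (\<mu> ^ r * exp (- \<mu>)) * (\<mu> ^ k /\<^sub>R fact k)) sums ((\<mu> ^ r * exp (- \<mu>)) * exp \<mu>)"
    by (intro sums_mult exp_converges)
  moreover have "(\<mu> ^ r * exp (- \<mu>)) * exp \<mu> = \<mu> ^ r" by (simp add: exp_minus)
  moreover have "(\<mu> ^ r * exp (- \<mu>)) * (\<mu> ^ k /\<^sub>R fact k) = pmf (poisson_pmf \<mu>) (k + r) * f (k + r)" for k
    using \<mu> by (simp add: shift power_add field_simps)
  ultimately have "(\<lambda>k. pmf (poisson_pmf \<mu>) (k + r) * f (k + r)) sums (\<mu> ^ r)" by simp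
  then show "(\<lambda>k. pmf (poisson_pmf \<mu>) k * f k) sums (\<mu> ^ r)"
    by (subst (asm) sums_zero_iff_shift) (simp_all add: zero)
qed

lemma poisson_moments:
  assumes \<mu>: "0 < \<mu>"
  defines "M \<equiv> measure_pmf (poisson_pmf \<mu>)"
  shows "has_bochner_integral M (\<lambda>k. real k) \<mu>"
    and "has_bochner_integral M (\<lambda>k. (real k)^2) (\<mu>^2 + \<mu>)"
    and "has_bochner_integral M (\<lambda>k. (real k)^3) (\<mu>^3 + 3 * \<mu>^2 + \<mu>)"
proof -
  have 1: "has_bochner_integral M (\<lambda>k. real k) (\<mu> ^ 1)"
    unfolding M_def by (rule poisson_factorial_moment[OF \<mu>]) (auto simp: field_simps)
  have 2: "has_bochner_integral M (\<lambda>k. real k * (real k - 1)) (\<mu> ^ 2)"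
    unfolding M_def
  proof (rule poisson_factorial_moment[OF \<mu>])
    show "0 \<le> real k * (real k - 1)" for k by (cases k) auto
    show "real k * (real k - 1) = 0" if "k < 2" for k
      using that by (cases k) (auto simp: less_Suc_eq numeral_2_eq_2)
    show "real (k + 2) * (real (k + 2) - 1) = fact (k + 2) / fact k" for k
      by (simp add: numeral_2_eq_2 field_simps)
  qed
  have 3: "has_bochner_integral M (\<lambda>k. real k * (real k - 1) * (real k - 2)) (\<mu> ^ 3)"
    unfolding M_def
  proof (rule poisson_factorial_moment[OF \<mu>])
    show "0 \<le> real k * (real k - 1) * (real k - 2)" for k
    proof (cases "k < 2")
      case True then show ?thesis by (cases k) (auto simp: less_Suc_eq numeral_2_eq_2)
    qed auto
    show "real k * (real k - 1) * (real k - 2) = 0" if "k < 3" for k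
      using that by (auto simp: less_Suc_eq numeral_3_eq_3)
    show "real (k + 3) * (real (k + 3) - 1) * (real (k + 3) - 2) = fact (k + 3) / fact k" for k
      by (simp add: numeral_3_eq_3 field_simps)
  qed
  show "has_bochner_integral M (\<lambda>k. real k) \<mu>" using 1 by simp
  have "has_bochner_integral M (\<lambda>k. real k * (real k - 1) + real k) (\<mu>^2 + \<mu> ^ 1)"
    by (intro has_bochner_integral_add 1 2)
  then show "has_bochner_integral M (\<lambda>k. (real k)^2) (\<mu>^2 + \<mu>)"
    by (simp add: algebra_simps power2_eq_square)
  have "has_bochner_integral M (\<lambda>k. real k * (real k - 1) * (real k - 2) + 3 * (real k * (real k - 1)) + real k) (\<mu>^3 + 3 * \<mu>^2 + \<mu> ^ 1)"
    by (intro has_bochner_integral_add has_bochner_integral_mult_right 1 2 3)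
  moreover have "real k * (real k - 1) * (real k - 2) + 3 * (real k * (real k - 1)) + real k = (real k)^3" for k
    by (simp add: algebra_simps power3_eq_cube)
  ultimately show "has_bochner_integral M (\<lambda>k. (real k)^3) (\<mu>^3 + 3 * \<mu>^2 + \<mu>)" by simp
qed

text \<open>The third absolute moment is dominated by the polynomial moment of
  \<open>(k - \<mu>)\<^sup>2 * (k + \<mu>)\<close>, equal to
  \<open>\<mu> + 2 * \<mu>\<^sup>2\<close>. With \<open>\<mu> = l / n\<close> and steps of size
  \<open>1 / sqrt l\<close>, its quadratic term is of order \<open>sqrt l / n\<^sup>2\<close> per
  cell and disappears in the limit.\<close>

lemma poisson_centred_moments:
  assumes \<mu>: "0 < \<mu>"
  defines "M \<equiv> measure_pmf (poisson_pmf \<mu>)"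
  shows "has_bochner_integral M (\<lambda>k. real k - \<mu>) 0"
    and "has_bochner_integral M (\<lambda>k. (real k - \<mu>)^2) \<mu>"
    and "integrable M (\<lambda>k. \<bar>real k - \<mu>\<bar>^3)"
    and "(\<integral>k. \<bar>real k - \<mu>\<bar>^3 \<partial>M) \<le> \<mu> + 2 * \<mu>^2"
proof -
  note m = poisson_moments[OF \<mu>, folded M_def]
  have c: "has_bochner_integral M (\<lambda>k. a) a" for a :: real
    unfolding M_def by (simp add: has_bochner_integral_iff)
  have "has_bochner_integral M (\<lambda>k. real k - \<mu>) (\<mu> - \<mu>)"
    by (intro has_bochner_integral_diff m c)
  then show "has_bochner_integral M (\<lambda>k. real k - \<mu>) 0" by simp
  have "has_bochner_integral M (\<lambda>k. (real k)^2 - 2 * \<mu> * real k + \<mu>^2) ((\<mu>^2 + \<mu>) - 2 * \<mu> * \<mu> + \<mu>^2)"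
    by (intro has_bochner_integral_diff has_bochner_integral_add has_bochner_integral_mult_right m c)
  moreover have "(real k)^2 - 2 * \<mu> * real k + \<mu>^2 = (real k - \<mu>)^2" for k by (simp add: power2_eq_square algebra_simps)
  moreover have "(\<mu>^2 + \<mu>) - 2 * \<mu> * \<mu> + \<mu>^2 = \<mu>" by (simp add: power2_eq_square)
  ultimately show "has_bochner_integral M (\<lambda>k. (real k - \<mu>)^2) \<mu>" by simp
  have "has_bochner_integral M (\<lambda>k. (real k)^3 - \<mu> * (real k)^2 - \<mu>^2 * real k + \<mu>^3)
     ((\<mu>^3 + 3 * \<mu>^2 + \<mu>) - \<mu> * (\<mu>^2 + \<mu>) - \<mu>^2 * \<mu> + \<mu>^3)"
    by (intro has_bochner_integral_diff has_bochner_integral_add has_bochner_integral_mult_right m c)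
  moreover have "(real k)^3 - \<mu> * (real k)^2 - \<mu>^2 * real k + \<mu>^3 = (real k - \<mu>)^2 * (real k + \<mu>)" for k
    by (simp add: power2_eq_square power3_eq_cube algebra_simps)
  moreover have "(\<mu>^3 + 3 * \<mu>^2 + \<mu>) - \<mu> * (\<mu>^2 + \<mu>) - \<mu>^2 * \<mu> + \<mu>^3 = \<mu> + 2 * \<mu>^2"
    by (simp add: power2_eq_square power3_eq_cube algebra_simps)
  ultimately have 3: "has_bochner_integral M (\<lambda>k. (real k - \<mu>)^2 * (real k + \<mu>)) (\<mu> + 2 * \<mu>^2)" by simp
  have le: "\<bar>real k - \<mu>\<bar>^3 \<le> (real k - \<mu>)^2 * (real k + \<mu>)" for k
  proof -
    have "\<bar>real k - \<mu>\<bar>^3 = (real k - \<mu>)^2 * \<bar>real k - \<mu>\<bar>"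
      by (simp add: power3_eq_cube power2_eq_square)
    also have "\<dots> \<le> (real k - \<mu>)^2 * (real k + \<mu>)"
      using \<mu> by (intro mult_left_mono) auto
    finally show ?thesis .
  qed
  show i: "integrable M (\<lambda>k. \<bar>real k - \<mu>\<bar>^3)"
  proof (rule Bochner_Integration.integrable_bound)
    show "integrable M (\<lambda>k. (real k - \<mu>)^2 * (real k + \<mu>))" using 3 by (simp add: has_bochner_integral_iff)
    show "AE k in M. norm (\<bar>real k - \<mu>\<bar>^3) \<le> norm ((real k - \<mu>)^2 * (real k + \<mu>))"
      using le \<mu> by (intro AE_I2) (simp add: abs_mult)
  qed (simp add: M_def)
  have "(\<integral>k. \<bar>real k - \<mu>\<bar>^3 \<partial>M) \<le> (\<integral>k. (real k - \<mu>)^2 * (real k + \<mu>) \<partial>M)"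
    using 3 i le by (intro integral_mono) (auto simp: has_bochner_integral_iff)
  also have "\<dots> = \<mu> + 2 * \<mu>^2" using 3 by (simp add: has_bochner_integral_iff)
  finally show "(\<integral>k. \<bar>real k - \<mu>\<bar>^3 \<partial>M) \<le> \<mu> + 2 * \<mu>^2" .
qed

section \<open>Averaging operators\<close>

definition poisson_step :: "real \<Rightarrow> 'k::real_inner \<Rightarrow> ('k \<Rightarrow> real) \<Rightarrow> 'k \<Rightarrow> real" where
  "poisson_step \<mu> v f x = (\<integral>k. f (x + (real k - \<mu>) *\<^sub>R v) \<partial>measure_pmf (poisson_pmf \<mu>))"

definition coin_step :: "'k::real_inner \<Rightarrow> ('k \<Rightarrow> real) \<Rightarrow> 'k \<Rightarrow> real" where
  "coin_step v f x = (f (x + v) + f (x - v)) / 2"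

text \<open>The expectation of \<open>f\<close> at \<open>x\<close> plus a sum of independent
  centred Poisson multiples of the \<open>v i\<close>, encoded as iterated averaging;
  \<open>coin_iter\<close> does the same for random signs. Exchanging a summand is exchanging one
  operator.\<close>

primrec poisson_iter :: "real \<Rightarrow> (nat \<Rightarrow> 'k::real_inner) \<Rightarrow> nat \<Rightarrow> ('k \<Rightarrow> real) \<Rightarrow> 'k \<Rightarrow> real" where
  "poisson_iter \<mu> v 0 f = f"
| "poisson_iter \<mu> v (Suc m) f = poisson_step \<mu> (v m) (poisson_iter \<mu> v m f)"

primrec coin_iter :: "(nat \<Rightarrow> 'k::real_inner) \<Rightarrow> nat \<Rightarrow> ('k \<Rightarrow> real) \<Rightarrow> 'k \<Rightarrow> real" where
  "coin_iter v 0 f = f"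
| "coin_iter v (Suc m) f = coin_step (v m) (coin_iter v m f)"

lemma lipschitz_abs_diff: "L-lipschitz_on UNIV f \<Longrightarrow> \<bar>f x - f y\<bar> \<le> L * norm (x - y)" for f :: "'k::real_inner \<Rightarrow> real"
  using lipschitz_on_normD[of L UNIV f x y] by simp

text \<open>A Lipschitz function grows at most linearly, so the first moment dominates.\<close>

lemma poisson_step_integrable:
  fixes f :: "'k::real_inner \<Rightarrow> real"
  assumes \<mu>: "0 < \<mu>" and f: "L-lipschitz_on UNIV f"
  shows "integrable (measure_pmf (poisson_pmf \<mu>)) (\<lambda>k. f (x + (real k - \<mu>) *\<^sub>R v))"
proof (rule Bochner_Integration.integrable_bound)
  show "integrable (measure_pmf (poisson_pmf \<mu>)) (\<lambda>k. \<bar>f x\<bar> + \<bar>real k - \<mu>\<bar> * (L * norm v))"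
    using poisson_centred_moments(1)[OF \<mu>] by (auto simp: has_bochner_integral_iff)
  have L: "0 \<le> L" using f by (rule lipschitz_on_nonneg)
  have "\<bar>f (x + (real k - \<mu>) *\<^sub>R v)\<bar> \<le> \<bar>f x\<bar> + \<bar>real k - \<mu>\<bar> * (L * norm v)" for k
  proof -
    have "\<bar>f (x + (real k - \<mu>) *\<^sub>R v) - f x\<bar> \<le> L * norm ((x + (real k - \<mu>) *\<^sub>R v) - x)"
      by (rule lipschitz_abs_diff[OF f])
    also have "\<dots> = \<bar>real k - \<mu>\<bar> * (L * norm v)" by simp
    finally show ?thesis by linarith
  qed
  then show "AE k in measure_pmf (poisson_pmf \<mu>). norm (f (x + (real k - \<mu>) *\<^sub>R v)) \<le> norm (\<bar>f x\<bar> + \<bar>real k - \<mu>\<bar> * (L * norm v))"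
    using L by (intro AE_I2) auto
qed simp

lemma poisson_step_abs_diff_le:
  fixes f g :: "'k::real_inner \<Rightarrow> real"
  assumes \<mu>: "0 < \<mu>" and f: "L-lipschitz_on UNIV f" "L'-lipschitz_on UNIV g"
    and D: "\<And>k. \<bar>f (x + (real k - \<mu>) *\<^sub>R v) - g (y + (real k - \<mu>) *\<^sub>R w)\<bar> \<le> D"
  shows "\<bar>poisson_step \<mu> v f x - poisson_step \<mu> w g y\<bar> \<le> D"
proof -
  let ?M = "measure_pmf (poisson_pmf \<mu>)"
  have "poisson_step \<mu> v f x - poisson_step \<mu> w g y = (\<integral>k. f (x + (real k - \<mu>) *\<^sub>R v) - g (y + (real k - \<mu>) *\<^sub>R w) \<partial>?M)"
    unfolding poisson_step_def using poisson_step_integrable[OF \<mu> f(1)] poisson_step_integrable[OF \<mu> f(2)]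
    by (subst Bochner_Integration.integral_diff) auto
  also have "\<bar>\<dots>\<bar> \<le> (\<integral>k. D \<partial>?M)"
    by (rule order_trans[OF integral_abs_bound integral_mono])
      (use D poisson_step_integrable[OF \<mu> f(1)] poisson_step_integrable[OF \<mu> f(2)] in auto)
  finally show ?thesis by simp
qed

lemma poisson_step_lipschitz:
  fixes f :: "'k::real_inner \<Rightarrow> real"
  assumes \<mu>: "0 < \<mu>" and f: "L-lipschitz_on UNIV f"
  shows "L-lipschitz_on UNIV (poisson_step \<mu> v f)"
proof (rule lipschitz_onI)
  fix x y :: 'k
  have "\<bar>poisson_step \<mu> v f x - poisson_step \<mu> v f y\<bar> \<le> L * norm (x - y)"
    by (rule poisson_step_abs_diff_le[OF \<mu> f f]) (use lipschitz_abs_diff[OF f] in \<open>metis add_diff_cancel_right\<close>)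
  then show "dist (poisson_step \<mu> v f x) (poisson_step \<mu> v f y) \<le> L * dist x y"
    by (simp add: dist_norm)
qed (rule lipschitz_on_nonneg[OF f])

lemma abs_average_le: "\<bar>a\<bar> \<le> D \<Longrightarrow> \<bar>b\<bar> \<le> D \<Longrightarrow> \<bar>(a + b) / 2\<bar> \<le> D" for a b D :: real
  using abs_triangle_ineq[of a b] by simp

lemma coin_step_lipschitz:
  fixes f :: "'k::real_inner \<Rightarrow> real"
  assumes f: "L-lipschitz_on UNIV f"
  shows "L-lipschitz_on UNIV (coin_step v f)"
proof (rule lipschitz_onI)
  fix x y :: 'k
  have "\<bar>f (x + v) - f (y + v)\<bar> \<le> L * norm (x - y)" "\<bar>f (x - v) - f (y - v)\<bar> \<le> L * norm (x - y)"
    using lipschitz_abs_diff[OF f, of "x + v" "y + v"] lipschitz_abs_diff[OF f, of "x - v" "y - v"] by simp_all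
  from abs_average_le[OF this] show "dist (coin_step v f x) (coin_step v f y) \<le> L * dist x y"
    by (simp add: dist_norm coin_step_def add_divide_distrib diff_divide_distrib algebra_simps)
qed (rule lipschitz_on_nonneg[OF f])

lemma coin_iter_lipschitz: "L-lipschitz_on UNIV f \<Longrightarrow> L-lipschitz_on UNIV (coin_iter v m f)"
  by (induction m) (simp_all add: coin_step_lipschitz)

lemma poisson_iter_lipschitz: "0 < \<mu> \<Longrightarrow> L-lipschitz_on UNIV f \<Longrightarrow> L-lipschitz_on UNIV (poisson_iter \<mu> v m f)"
  by (induction m) (simp_all add: poisson_step_lipschitz)

lemma coin_iter_abs_diff_le:
  assumes "\<And>x. \<bar>f x - g x\<bar> \<le> D"
  shows "\<bar>coin_iter v m f x - coin_iter v m g x\<bar> \<le> D"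
proof (induction m arbitrary: x)
  case (Suc m)
  have "(coin_iter v m f (x + v m) + coin_iter v m f (x - v m)) / 2 - (coin_iter v m g (x + v m) + coin_iter v m g (x - v m)) / 2
    = ((coin_iter v m f (x + v m) - coin_iter v m g (x + v m)) + (coin_iter v m f (x - v m) - coin_iter v m g (x - v m))) / 2"
    by (simp add: add_divide_distrib diff_divide_distrib)
  then show ?case using abs_average_le[OF Suc[of "x + v m"] Suc[of "x - v m"]]
    by (simp only: coin_iter.simps coin_step_def)
qed (simp add: assms)

lemma coin_step_commute: "coin_step v (coin_step w f) = coin_step w (coin_step v f)"
  by (rule ext) (simp add: coin_step_def algebra_simps add_divide_distrib)

lemma coin_iter_coin_step_commute: "coin_iter v m (coin_step w f) = coin_step w (coin_iter v m f)"
  by (induction m) (simp_all add: coin_step_commute)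

lemma poisson_step_coin_step_commute:
  fixes f :: "'k::real_inner \<Rightarrow> real"
  assumes \<mu>: "0 < \<mu>" and f: "L-lipschitz_on UNIV f"
  shows "poisson_step \<mu> w (coin_step v f) = coin_step v (poisson_step \<mu> w f)"
proof
  fix x
  have "poisson_step \<mu> w (coin_step v f) x = (\<integral>k. (f ((x + v) + (real k - \<mu>) *\<^sub>R w) + f ((x - v) + (real k - \<mu>) *\<^sub>R w)) / 2 \<partial>measure_pmf (poisson_pmf \<mu>))"
    unfolding poisson_step_def coin_step_def by (simp add: algebra_simps)
  also have "\<dots> = coin_step v (poisson_step \<mu> w f) x"
    unfolding coin_step_def poisson_step_def
    using poisson_step_integrable[OF \<mu> f] by simp
  finally show "poisson_step \<mu> w (coin_step v f) x = coin_step v (poisson_step \<mu> w f) x" .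
qed

lemma poisson_step_coin_iter_commute:
  fixes f :: "'k::real_inner \<Rightarrow> real"
  assumes \<mu>: "0 < \<mu>" and f: "L-lipschitz_on UNIV f"
  shows "poisson_step \<mu> w (coin_iter v m f) = coin_iter v m (poisson_step \<mu> w f)"
  by (induction m) (simp_all add: poisson_step_coin_step_commute[OF \<mu> coin_iter_lipschitz[OF f]])

text \<open>Lindeberg's replacement argument. Since the averaging operators commute, every replacement may be
  carried out next to \<open>f\<close> itself, so that no smoothness of the intermediate functions is needed.\<close>

lemma lindeberg_replacement:
  fixes f :: "'k::real_inner \<Rightarrow> real"
  assumes \<mu>: "0 < \<mu>" and f: "L-lipschitz_on UNIV f"
    and D: "\<And>i x. i < m \<Longrightarrow> \<bar>poisson_step \<mu> (v i) f x - coin_step (w i) f x\<bar> \<le> D"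
  shows "\<bar>poisson_iter \<mu> v m f x - coin_iter w m f x\<bar> \<le> real m * D"
  using D
proof (induction m arbitrary: x)
  case (Suc m)
  let ?A = "poisson_iter \<mu> v m f" and ?B = "coin_iter w m f"
  have "\<bar>poisson_step \<mu> (v m) ?A x - poisson_step \<mu> (v m) ?B x\<bar> \<le> real m * D"
    using Suc by (intro poisson_step_abs_diff_le[OF \<mu> poisson_iter_lipschitz[OF \<mu> f] coin_iter_lipschitz[OF f]]) auto
  \<comment> \<open>After commuting, the last Poisson step acts on \<open>f\<close> itself, and the
    coin averages preserve the uniform bound for a single exchange.\<close>
  moreover have "\<bar>coin_iter w m (poisson_step \<mu> (v m) f) x - coin_iter w m (coin_step (w m) f) x\<bar> \<le> D"
    using Suc.prems by (intro coin_iter_abs_diff_le) auto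
  ultimately show ?case
    by (simp add: poisson_step_coin_iter_commute[OF \<mu> f] coin_iter_coin_step_commute algebra_simps)
qed simp

section \<open>Taylor expansion and a single exchange\<close>

text \<open>The form suits moment matching: by linearity of \<open>d1\<close> centred steps
  contribute nothing, and by homogeneity of \<open>d2\<close> the second order term is a multiple of
  the variance. The factor 1/6 corresponds to a third derivative bounded by 1.\<close>

definition has_taylor2 :: "('k::real_inner \<Rightarrow> real) \<Rightarrow> bool" where
  "has_taylor2 f \<longleftrightarrow> (\<forall>x. \<exists>d1 d2. linear d1 \<and> (\<forall>c w. d2 (c *\<^sub>R w) = c\<^sup>2 * d2 w) \<and>
     (\<forall>w. \<bar>f (x + w) - f x - d1 w - d2 w / 2\<bar> \<le> norm w ^ 3 / 6))"

lemma fderiv_works: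
  fixes g :: "'k::real_normed_vector \<Rightarrow> 'v::real_normed_vector"
  assumes "g differentiable at y"
  shows "(g has_derivative blinfun_apply (fderiv g y)) (at y)"
proof -
  have "(g has_derivative frechet_derivative g (at y)) (at y)" using assms by (rule iffD1[OF frechet_derivative_works])
  then show ?thesis unfolding fderiv_def by (subst bounded_linear_Blinfun_apply) (auto dest: has_derivative_bounded_linear)
qed

text \<open>On the line from \<open>x\<close> in direction \<open>w\<close>, Maclaurin's formula
  with Lagrange remainder asks only for existence of the third derivative, not for its
  continuity.\<close>

lemma thrice_differentiable_taylor2:
  fixes f :: "'k::real_inner \<Rightarrow> real"
  assumes diff: "thrice_differentiable f"
    and bound: "\<And>x w. \<bar>blinfun_apply (blinfun_apply (blinfun_apply (fderiv (fderiv (fderiv f)) x) w) w) w\<bar> \<le> norm w ^ 3"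
  shows "has_taylor2 f"
  unfolding has_taylor2_def
proof (intro allI)
  fix x :: 'k
  have D1: "(f has_derivative blinfun_apply (fderiv f y)) (at y)"
    and D2: "(fderiv f has_derivative blinfun_apply (fderiv (fderiv f) y)) (at y)"
    and D3: "(fderiv (fderiv f) has_derivative blinfun_apply (fderiv (fderiv (fderiv f)) y)) (at y)" for y
    using diff fderiv_works unfolding thrice_differentiable_def by blast+
  define d1 where "d1 = blinfun_apply (fderiv f x)"
  define d2 where "d2 w = blinfun_apply (blinfun_apply (fderiv (fderiv f) x) w) w" for w
  have "\<bar>f (x + w) - f x - d1 w - d2 w / 2\<bar> \<le> norm w ^ 3 / 6" for w
  proof -
    \<comment> \<open>\<open>g m\<close> is the m-th derivative along the line for m up to
      3.\<close>
    define g :: "nat \<Rightarrow> real \<Rightarrow> real" where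
      "g = (\<lambda>m t. if m = 0 then f (x + t *\<^sub>R w) else if m = 1 then blinfun_apply (fderiv f (x + t *\<^sub>R w)) w
        else if m = 2 then blinfun_apply (blinfun_apply (fderiv (fderiv f) (x + t *\<^sub>R w)) w) w
        else blinfun_apply (blinfun_apply (blinfun_apply (fderiv (fderiv (fderiv f)) (x + t *\<^sub>R w)) w) w) w)"
    have line: "((\<lambda>t. x + t *\<^sub>R w) has_derivative (\<lambda>h. h *\<^sub>R w)) (at t)" for t :: real
      by (auto intro!: derivative_eq_intros)
    have c1: "((\<lambda>t. f (x + t *\<^sub>R w)) has_derivative (\<lambda>h. blinfun_apply (fderiv f (x + t *\<^sub>R w)) (h *\<^sub>R w))) (at t)" for t
      using has_derivative_compose[OF line D1] .
    have c2: "((\<lambda>t. fderiv f (x + t *\<^sub>R w)) has_derivative (\<lambda>h. blinfun_apply (fderiv (fderiv f) (x + t *\<^sub>R w)) (h *\<^sub>R w))) (at t)" for t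
      using has_derivative_compose[OF line D2] .
    have c3: "((\<lambda>t. fderiv (fderiv f) (x + t *\<^sub>R w)) has_derivative (\<lambda>h. blinfun_apply (fderiv (fderiv (fderiv f)) (x + t *\<^sub>R w)) (h *\<^sub>R w))) (at t)" for t
      using has_derivative_compose[OF line D3] .
    have e2: "((\<lambda>t. blinfun_apply (fderiv f (x + t *\<^sub>R w)) w) has_derivative (\<lambda>h. blinfun_apply (blinfun_apply (fderiv (fderiv f) (x + t *\<^sub>R w)) (h *\<^sub>R w)) w)) (at t)" for t
      by (rule bounded_linear.has_derivative[OF blinfun.bounded_linear_left c2])
    have e3: "((\<lambda>t. blinfun_apply (blinfun_apply (fderiv (fderiv f) (x + t *\<^sub>R w)) w) w) has_derivative
       (\<lambda>h. blinfun_apply (blinfun_apply (blinfun_apply (fderiv (fderiv (fderiv f)) (x + t *\<^sub>R w)) (h *\<^sub>R w)) w) w)) (at t)" for t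
      by (rule bounded_linear.has_derivative[OF blinfun.bounded_linear_left bounded_linear.has_derivative[OF blinfun.bounded_linear_left c3]])
    have "(g m has_real_derivative g (Suc m) t) (at t)" if "m < 3" for m t
    proof -
      from that consider "m = 0" | "m = 1" | "m = 2" by linarith
      then show ?thesis
      proof cases
        case 1
        then show ?thesis using c1[of t] by (simp add: g_def has_field_derivative_def blinfun.scaleR_right mult_commute_abs)
      next
        case 2
        then show ?thesis using e2[of t] by (simp add: g_def has_field_derivative_def blinfun.scaleR_right blinfun.scaleR_left mult_commute_abs)
      next
        case 3
        then show ?thesis using e3[of t] by (simp add: g_def has_field_derivative_def blinfun.scaleR_right blinfun.scaleR_left mult_commute_abs)
      qed
    qed
    then have "\<exists>t>0. t < 1 \<and> g 0 1 = (\<Sum>m<3. g m 0 / fact m * 1 ^ m) + g 3 t / fact 3 * 1 ^ 3"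
      by (intro Maclaurin) auto
    then obtain t where "g 0 1 = (\<Sum>m<3. g m 0 / fact m * 1 ^ m) + g 3 t / fact 3 * 1 ^ 3" by blast
    moreover have "(\<Sum>m<3. g m 0 / fact m * 1 ^ m) = f x + d1 w + d2 w / 2"
      by (simp add: g_def d1_def d2_def numeral_3_eq_3 numeral_2_eq_2)
    moreover have "fact 3 = (6::real)" by (simp add: fact_numeral)
    moreover have "\<bar>g 3 t\<bar> \<le> norm w ^ 3" using bound by (simp add: g_def)
    moreover have "g 0 1 = f (x + w)" by (simp add: g_def)
    ultimately show ?thesis by simp
  qed
  moreover have "linear d1" by (simp add: d1_def blinfun.bounded_linear_right bounded_linear.linear)
  moreover have "d2 (c *\<^sub>R w) = c\<^sup>2 * d2 w" for c w
    by (simp add: d2_def blinfun.scaleR_right blinfun.scaleR_left power2_eq_square)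
  ultimately show "\<exists>d1 d2. linear d1 \<and> (\<forall>c w. d2 (c *\<^sub>R w) = c\<^sup>2 * d2 w) \<and>
     (\<forall>w. \<bar>f (x + w) - f x - d1 w - d2 w / 2\<bar> \<le> norm w ^ 3 / 6)" by blast
qed

text \<open>Both averages agree up to second order, since both steps have mean 0 and the same
  variance. The first two summands of the bound come from the linear and the quadratic part of the
  Poisson third moment, the last one from the sign of size \<open>1 / sqrt n\<close>.\<close>

lemma poisson_step_coin_step_diff:
  fixes f :: "'k::real_inner \<Rightarrow> real"
  assumes l: "0 < l" and n: "0 < n" and lip: "L-lipschitz_on UNIV f" and f: "has_taylor2 f"
    and e: "norm e \<le> c"
  shows "\<bar>poisson_step (l / real n) (e /\<^sub>R sqrt l) f x - coin_step (e /\<^sub>R sqrt (real n)) f x\<bar>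
    \<le> c ^ 3 / 6 * (1 / sqrt l + 2 * sqrt l / real n + 1 / sqrt (real n)) / real n"
proof -
  define \<mu> where "\<mu> = l / real n"
  have \<mu>: "0 < \<mu>" using l n by (simp add: \<mu>_def)
  let ?M = "measure_pmf (poisson_pmf \<mu>)" and ?v = "e /\<^sub>R sqrt l" and ?w = "e /\<^sub>R sqrt (real n)"
  obtain d1 d2 where d1: "linear d1" and d2: "\<And>c w. d2 (c *\<^sub>R w) = c\<^sup>2 * d2 w"
    and T: "\<And>w. \<bar>f (x + w) - f x - d1 w - d2 w / 2\<bar> \<le> norm w ^ 3 / 6"
    using f unfolding has_taylor2_def by blast
  note pm = poisson_centred_moments[OF \<mu>]
  have iF: "integrable ?M (\<lambda>k. f (x + (real k - \<mu>) *\<^sub>R ?v))" by (rule poisson_step_integrable[OF \<mu> lip])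
  have hq: "has_bochner_integral ?M (\<lambda>k. f x + (real k - \<mu>) * d1 ?v + (real k - \<mu>)\<^sup>2 * (d2 ?v / 2)) (f x + 0 * d1 ?v + \<mu> * (d2 ?v / 2))"
    by (intro has_bochner_integral_add has_bochner_integral_mult_left pm(1,2)) (simp add: has_bochner_integral_iff)
  have "\<bar>poisson_step \<mu> ?v f x - (f x + \<mu> * (d2 ?v / 2))\<bar>
      = \<bar>\<integral>k. f (x + (real k - \<mu>) *\<^sub>R ?v) - (f x + (real k - \<mu>) * d1 ?v + (real k - \<mu>)\<^sup>2 * (d2 ?v / 2)) \<partial>?M\<bar>"
    unfolding poisson_step_def using hq iF by (subst Bochner_Integration.integral_diff) (simp_all add: has_bochner_integral_iff)
  also have "\<dots> \<le> (\<integral>k. \<bar>real k - \<mu>\<bar>^3 * (norm ?v ^ 3 / 6) \<partial>?M)"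
  proof (rule order_trans[OF integral_abs_bound integral_mono])
    show "integrable ?M (\<lambda>k. \<bar>f (x + (real k - \<mu>) *\<^sub>R ?v) - (f x + (real k - \<mu>) * d1 ?v + (real k - \<mu>)\<^sup>2 * (d2 ?v / 2))\<bar>)"
      using hq iF by (intro integrable_abs Bochner_Integration.integrable_diff) (simp_all add: has_bochner_integral_iff)
    show "integrable ?M (\<lambda>k. \<bar>real k - \<mu>\<bar>^3 * (norm ?v ^ 3 / 6))" using pm(3) by simp
    fix k :: nat
    have "\<bar>f (x + (real k - \<mu>) *\<^sub>R ?v) - f x - d1 ((real k - \<mu>) *\<^sub>R ?v) - d2 ((real k - \<mu>) *\<^sub>R ?v) / 2\<bar> \<le> norm ((real k - \<mu>) *\<^sub>R ?v) ^ 3 / 6"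
      by (rule T)
    also have "norm ((real k - \<mu>) *\<^sub>R ?v) ^ 3 / 6 = \<bar>real k - \<mu>\<bar>^3 * (norm ?v ^ 3 / 6)"
      unfolding norm_scaleR power_mult_distrib by simp
    finally show "\<bar>f (x + (real k - \<mu>) *\<^sub>R ?v) - (f x + (real k - \<mu>) * d1 ?v + (real k - \<mu>)\<^sup>2 * (d2 ?v / 2))\<bar> \<le> \<bar>real k - \<mu>\<bar>^3 * (norm ?v ^ 3 / 6)"
      unfolding linear_scale[OF d1] d2[of "real k - \<mu>"] by (simp add: algebra_simps)
  qed
  also have "\<dots> = (\<integral>k. \<bar>real k - \<mu>\<bar>^3 \<partial>?M) * (norm ?v ^ 3 / 6)" by simp
  also have "\<dots> \<le> (\<mu> + 2 * \<mu>\<^sup>2) * (norm ?v ^ 3 / 6)"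
    by (intro mult_right_mono pm(4)) simp
  finally have P: "\<bar>poisson_step \<mu> ?v f x - (f x + \<mu> * (d2 ?v / 2))\<bar> \<le> (\<mu> + 2 * \<mu>\<^sup>2) * (norm ?v ^ 3 / 6)" .
  have Q: "\<bar>coin_step ?w f x - (f x + d2 ?w / 2)\<bar> \<le> norm ?w ^ 3 / 6"
  proof -
    \<comment> \<open>The two signs cancel the linear term and share the quadratic one.\<close>
    have "d1 (- ?w) = - d1 ?w" using linear_neg[OF d1] by simp
    moreover have "d2 (- ?w) = d2 ?w" using d2[of "-1" ?w] by simp
    ultimately have "\<bar>f (x - ?w) - f x + d1 ?w - d2 ?w / 2\<bar> \<le> norm ?w ^ 3 / 6" using T[of "- ?w"] by simp
    from abs_average_le[OF this T[of ?w]] show ?thesis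
      by (simp add: coin_step_def add_divide_distrib diff_divide_distrib algebra_simps)
  qed
  \<comment> \<open>Variances match because \<open>\<mu> / l = 1 / n\<close>.\<close>
  have same: "\<mu> * (d2 ?v / 2) = d2 ?w / 2"
  proof -
    have "d2 ?v = d2 e / l" using d2[of "inverse (sqrt l)" e] l by (simp add: power_inverse field_simps)
    moreover have "d2 ?w = d2 e / real n" using d2[of "inverse (sqrt (real n))" e] n by (simp add: power_inverse field_simps)
    ultimately show ?thesis using l n by (simp add: \<mu>_def)
  qed
  have nv: "norm ?v ^ 3 = norm e ^ 3 / (l * sqrt l)" using l by (simp add: power_mult_distrib power_inverse power3_eq_cube field_simps)
  have nw: "norm ?w ^ 3 = norm e ^ 3 / (real n * sqrt (real n))" using n by (simp add: power_mult_distrib power_inverse power3_eq_cube field_simps)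
  have "\<bar>poisson_step \<mu> ?v f x - coin_step ?w f x\<bar> \<le> (\<mu> + 2 * \<mu>\<^sup>2) * (norm ?v ^ 3 / 6) + norm ?w ^ 3 / 6"
    using P Q same by linarith
  also have "\<dots> = norm e ^ 3 / 6 * ((\<mu> + 2 * \<mu>\<^sup>2) / (l * sqrt l) + 1 / (real n * sqrt (real n)))"
    unfolding nv nw by (simp add: algebra_simps)
  also have "(\<mu> + 2 * \<mu>\<^sup>2) / (l * sqrt l) + 1 / (real n * sqrt (real n)) = (1 / sqrt l + 2 * sqrt l / real n + 1 / sqrt (real n)) / real n"
  proof -
    have "\<mu> / (l * sqrt l) = 1 / sqrt l / real n" using l by (simp add: \<mu>_def field_simps)
    moreover have "\<mu>\<^sup>2 / (l * sqrt l) = sqrt l / real n / real n"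
    proof -
      define r where "r = sqrt l"
      have "0 < r" "l = r * r" using l by (simp_all add: r_def)
      then show ?thesis by (simp add: \<mu>_def power2_eq_square field_simps)
    qed
    moreover have "(\<mu> + 2 * \<mu>\<^sup>2) / (l * sqrt l) = \<mu> / (l * sqrt l) + 2 * (\<mu>\<^sup>2 / (l * sqrt l))"
      by (simp add: add_divide_distrib)
    ultimately show ?thesis by (simp only:) (simp add: add_divide_distrib mult.commute)
  qed
  also have "norm e ^ 3 / 6 * ((1 / sqrt l + 2 * sqrt l / real n + 1 / sqrt (real n)) / real n)
      \<le> c ^ 3 / 6 * ((1 / sqrt l + 2 * sqrt l / real n + 1 / sqrt (real n)) / real n)"
    using e l by (intro mult_right_mono divide_right_mono power_mono) auto
  finally show ?thesis by (simp add: \<mu>_def)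
qed


subsection \<open>Poisson processes\<close>

lemma integrable_PiM_component:
  fixes h :: "nat \<Rightarrow> real"
  assumes I: "finite I" "i \<in> I" and h: "integrable (measure_pmf p) h"
  shows "integrable (PiM I (\<lambda>_. measure_pmf p)) (\<lambda>x. h (x i))"
proof -
  interpret P: product_prob_space "\<lambda>_. measure_pmf p" I ..
  have d: "distr (PiM I (\<lambda>_. measure_pmf p)) (measure_pmf p) (\<lambda>x. x i) = measure_pmf p"
    by (rule P.PiM_component) (rule I)
  have m: "(\<lambda>x. x i) \<in> measurable (PiM I (\<lambda>_. measure_pmf p)) (measure_pmf p)"
    by (rule measurable_component_singleton) (rule I)
  show ?thesis
    using h by (subst integrable_distr_eq[OF m, of h, symmetric]) (simp_all add: d)
qed

text \<open>Coordinates are integrated out one at a time. In the intermediate statement those below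
  \<open>j\<close> are already absorbed into \<open>poisson_iter\<close>, and the induction descends
  from \<open>j = n\<close>, where no coordinate is left, to \<open>j = 0\<close>.\<close>

lemma poisson_iter_eq_PiM_integral:
  fixes f :: "'k::{real_inner, second_countable_topology} \<Rightarrow> real"
  assumes \<mu>: "0 < \<mu>" and f: "L-lipschitz_on UNIV f"
  shows "(\<integral>x. f (y + (\<Sum>i<n. (real (x i) - \<mu>) *\<^sub>R v i)) \<partial>PiM {..<n} (\<lambda>_. measure_pmf (poisson_pmf \<mu>))) = poisson_iter \<mu> v n f y"
proof -
  let ?p = "measure_pmf (poisson_pmf \<mu>)"
  have "(\<integral>x. poisson_iter \<mu> v j f (y + (\<Sum>i\<in>{j..<n}. (real (x i) - \<mu>) *\<^sub>R v i)) \<partial>PiM {j..<n} (\<lambda>_. ?p)) = poisson_iter \<mu> v n f y"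
    if "j \<le> n" for j
    using that
  proof (induction rule: inc_induct)
    case base
    interpret product_prob_space "\<lambda>_. ?p" "{}::nat set" ..
    show ?case by (simp add: PiM_empty)
  next
    case (step j)
    interpret P: product_sigma_finite "\<lambda>_::nat. ?p" ..
    let ?g = "poisson_iter \<mu> v j f" and ?I = "{Suc j..<n}"
    have g: "L-lipschitz_on UNIV ?g" by (rule poisson_iter_lipschitz[OF \<mu> f])
    have gm [measurable]: "?g \<in> borel_measurable borel"
      using lipschitz_on_continuous_on[OF g] by (rule borel_measurable_continuous_onI)
    have ins: "{j..<n} = insert j ?I" using step.hyps by auto
    have L: "0 \<le> L" using g by (rule lipschitz_on_nonneg)
    have int: "integrable (PiM {j..<n} (\<lambda>_. ?p)) (\<lambda>x. ?g (y + (\<Sum>i\<in>{j..<n}. (real (x i) - \<mu>) *\<^sub>R v i)))"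
    proof (rule Bochner_Integration.integrable_bound)
      interpret Q: product_prob_space "\<lambda>_. ?p" "{j..<n}" ..
      have "integrable (PiM {j..<n} (\<lambda>_. ?p)) (\<lambda>x. \<bar>real (x i) - \<mu>\<bar>)" if "i \<in> {j..<n}" for i
        using that poisson_centred_moments(1)[OF \<mu>]
        by (intro integrable_PiM_component[where h = "\<lambda>k. \<bar>real k - \<mu>\<bar>"]) (auto simp: has_bochner_integral_iff)
      then show "integrable (PiM {j..<n} (\<lambda>_. ?p)) (\<lambda>x. \<bar>?g y\<bar> + L * (\<Sum>i\<in>{j..<n}. \<bar>real (x i) - \<mu>\<bar> * norm (v i)))"
        by (intro Bochner_Integration.integrable_add integrable_mult_right Bochner_Integration.integrable_sum integrable_mult_left) auto
      have comp: "(\<lambda>x. real (x i)) \<in> borel_measurable (PiM {j..<n} (\<lambda>_. ?p))" if "i \<in> {j..<n}" for i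
        by (rule measurable_compose[OF measurable_component_singleton[OF that]]) simp
      show "(\<lambda>x. ?g (y + (\<Sum>i\<in>{j..<n}. (real (x i) - \<mu>) *\<^sub>R v i))) \<in> borel_measurable (PiM {j..<n} (\<lambda>_. ?p))"
        by (rule measurable_compose[OF _ gm])
          (intro borel_measurable_add borel_measurable_sum borel_measurable_scaleR borel_measurable_diff comp borel_measurable_const)
      have "\<bar>?g (y + (\<Sum>i\<in>{j..<n}. (real (x i) - \<mu>) *\<^sub>R v i))\<bar> \<le> \<bar>?g y\<bar> + L * (\<Sum>i\<in>{j..<n}. \<bar>real (x i) - \<mu>\<bar> * norm (v i))" for x
      proof -
        have "\<bar>?g (y + (\<Sum>i\<in>{j..<n}. (real (x i) - \<mu>) *\<^sub>R v i)) - ?g y\<bar> \<le> L * norm (\<Sum>i\<in>{j..<n}. (real (x i) - \<mu>) *\<^sub>R v i)"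
          using lipschitz_abs_diff[OF g, of "y + (\<Sum>i\<in>{j..<n}. (real (x i) - \<mu>) *\<^sub>R v i)" y] by simp
        also have "\<dots> \<le> L * (\<Sum>i\<in>{j..<n}. \<bar>real (x i) - \<mu>\<bar> * norm (v i))"
          by (intro mult_left_mono[OF _ L] sum_norm_le) simp
        finally show ?thesis by linarith
      qed
      then show "AE x in PiM {j..<n} (\<lambda>_. ?p). norm (?g (y + (\<Sum>i\<in>{j..<n}. (real (x i) - \<mu>) *\<^sub>R v i)))
          \<le> norm (\<bar>?g y\<bar> + L * (\<Sum>i\<in>{j..<n}. \<bar>real (x i) - \<mu>\<bar> * norm (v i)))"
        using L by (intro AE_I2) (auto intro!: order_trans[OF _ abs_ge_self])
    qed
    have "(\<integral>x. ?g (y + (\<Sum>i\<in>{j..<n}. (real (x i) - \<mu>) *\<^sub>R v i)) \<partial>PiM {j..<n} (\<lambda>_. ?p))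
      = (\<integral>x. (\<integral>k. ?g (y + (\<Sum>i\<in>{j..<n}. (real ((x(j := k)) i) - \<mu>) *\<^sub>R v i)) \<partial>?p) \<partial>PiM ?I (\<lambda>_. ?p))"
      using int unfolding ins by (intro P.product_integral_insert) auto
    also have "\<dots> = (\<integral>x. poisson_iter \<mu> v (Suc j) f (y + (\<Sum>i\<in>?I. (real (x i) - \<mu>) *\<^sub>R v i)) \<partial>PiM ?I (\<lambda>_. ?p))"
    proof (intro Bochner_Integration.integral_cong refl)
      fix x :: "nat \<Rightarrow> nat"
      have "(\<Sum>i\<in>{j..<n}. (real ((x(j := k)) i) - \<mu>) *\<^sub>R v i) = (real k - \<mu>) *\<^sub>R v j + (\<Sum>i\<in>?I. (real (x i) - \<mu>) *\<^sub>R v i)" for k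
        unfolding ins by (subst sum.insert) (auto intro!: sum.cong)
      then show "(\<integral>k. ?g (y + (\<Sum>i\<in>{j..<n}. (real ((x(j := k)) i) - \<mu>) *\<^sub>R v i)) \<partial>?p)
         = poisson_iter \<mu> v (Suc j) f (y + (\<Sum>i\<in>?I. (real (x i) - \<mu>) *\<^sub>R v i))"
        by (simp add: poisson_step_def add.assoc add.left_commute add.commute)
    qed
    also have "\<dots> = poisson_iter \<mu> v n f y" by (rule step.IH)
    finally show ?case .
  qed
  from this[of 0] show ?thesis by (simp add: atLeast0LessThan)
qed

section \<open>Jump times of a counting path\<close>

text \<open>\<open>\<tau> j\<close> is the infimum of the times at which the count exceeds
  \<open>j\<close>; right continuity makes it attained. A jump of size greater than 1 produces
  repeated times.\<close>

lemma counting_path_jump_times: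
  fixes F :: "real \<Rightarrow> nat"
  assumes F0: "F 0 = 0" and mono: "mono_on {0..} F"
    and right: "\<And>t. 0 \<le> t \<Longrightarrow> continuous (at_right t) (\<lambda>s. real (F s))"
  obtains \<tau> :: "nat \<Rightarrow> real" where "\<And>j. j < F 1 \<Longrightarrow> 0 < \<tau> j \<and> \<tau> j \<le> 1"
    and "\<And>j t. j < F 1 \<Longrightarrow> t \<in> {0..1} \<Longrightarrow> j < F t \<longleftrightarrow> \<tau> j \<le> t"
proof -
  define S where "S j = {t\<in>{0..1}. j < F t}" for j
  define \<tau> where "\<tau> j = Inf (S j)" for j
  have bdd: "bdd_below (S j)" for j by (rule bdd_belowI[of _ 0]) (auto simp: S_def)
  have iff: "j < F t \<longleftrightarrow> \<tau> j \<le> t" if j: "j < F 1" and t: "t \<in> {0..1}" for j t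
  proof
    assume "j < F t"
    then show "\<tau> j \<le> t" unfolding \<tau>_def using t bdd by (intro cInf_lower) (auto simp: S_def)
  next
    assume le: "\<tau> j \<le> t"
    have ne: "S j \<noteq> {}" using j by (auto simp: S_def)
    have \<tau>0: "0 \<le> \<tau> j" unfolding \<tau>_def using ne by (intro cInf_greatest) (auto simp: S_def)
    have "j < F (\<tau> j)"
    proof (rule ccontr)
      assume n: "\<not> j < F (\<tau> j)"
      have "((\<lambda>s. real (F s)) \<longlongrightarrow> real (F (\<tau> j))) (at_right (\<tau> j))"
        using right[OF \<tau>0] by (simp add: continuous_within)
      then have "\<forall>\<^sub>F s in at_right (\<tau> j). real (F s) < real (F (\<tau> j)) + 1"
        by (rule order_tendstoD) simp
      \<comment> \<open>Counts are integers: just to the right of \<open>\<tau> j\<close> they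
        cannot exceed \<open>F (\<tau> j)\<close>, so under the assumption no point of
        \<open>S j\<close> lies there, against the infimum.\<close>
      then obtain b where b: "b > \<tau> j" "\<And>s. \<tau> j < s \<Longrightarrow> s < b \<Longrightarrow> real (F s) < real (F (\<tau> j)) + 1"
        unfolding eventually_at_right_field by blast
      obtain s where s: "s \<in> S j" "s < b"
        using b(1) cInf_lessD[OF ne] unfolding \<tau>_def by blast
      have "\<tau> j \<le> s" unfolding \<tau>_def using s bdd by (intro cInf_lower)
      moreover have "s \<noteq> \<tau> j" using s n by (auto simp: S_def)
      ultimately have "real (F s) < real (F (\<tau> j)) + 1" using b(2) s by simp
      then show False using s n by (auto simp: S_def)
    qed
    also have "F (\<tau> j) \<le> F t" using \<tau>0 le by (intro mono_onD[OF mono]) auto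
    finally show "j < F t" .
  qed
  moreover have "0 < \<tau> j \<and> \<tau> j \<le> 1" if j: "j < F 1" for j
    using iff[OF j, of 0] iff[OF j, of 1] j F0 by auto
  ultimately show ?thesis using that by blast
qed

section \<open>Discretization of the Poisson path\<close>

context besov_liouville_model
begin

text \<open>The argument is pathwise. \<open>Y\<close> is the sum of \<open>jump\<close> over the
  jump times; delaying each to the right end of its cell costs at most \<open>modulus n\<close>, and
  there are \<open>F 1\<close> of them.\<close>

lemma path_element:
  fixes F :: "real \<Rightarrow> nat"
  assumes F0: "F 0 = 0" and mono: "mono_on {0..} F"
    and right: "\<And>t. 0 \<le> t \<Longrightarrow> continuous (at_right t) (\<lambda>s. real (F s))"
    and l: "0 < l"
  shows "\<exists>Y. element_of \<rho> (\<lambda>t. (real (F t) - l * t) / sqrt l) = (Y - l *\<^sub>R drift) /\<^sub>R sqrt l \<and>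
    norm Y \<le> real (F 1) * hoelder_const \<and>
    (\<forall>n>0. norm (Y - (\<Sum>i<n. real (F (grid n i) - F (real i / real n)) *\<^sub>R jump (grid n i)))
       \<le> real (F 1) * modulus n)"
proof -
  obtain \<tau> where \<tau>: "\<And>j. j < F 1 \<Longrightarrow> 0 < \<tau> j \<and> \<tau> j \<le> 1"
    and iff: "\<And>j t. j < F 1 \<Longrightarrow> t \<in> {0..1} \<Longrightarrow> j < F t \<longleftrightarrow> \<tau> j \<le> t"
    using counting_path_jump_times[OF F0 mono right] by blast
  define Y where "Y = (\<Sum>j<F 1. jump (\<tau> j))"
  have Fsum: "real (F t) = (\<Sum>j<F 1. of_bool (\<tau> j \<le> t))" if t: "t \<in> {0..1}" for t
  proof -
    have "F t \<le> F 1" using t by (intro mono_onD[OF mono]) auto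
    then have "{..<F 1} \<inter> {j. \<tau> j \<le> t} = {..<F t}" by (auto simp: iff[OF _ t, symmetric])
    then show ?thesis by simp
  qed
  have Y: "AE s in unit_leb. \<rho> Y s = (\<Sum>j<F 1. \<rho> (jump (\<tau> j)) s)" unfolding Y_def by (rule \<rho>_sum) simp
  have all: "AE s in unit_leb. \<forall>j\<in>{..<F 1}. \<rho> (jump (\<tau> j)) s = indicator {\<tau> j..1} s"
  proof (rule AE_finite_allI)
    fix j assume "j \<in> {..<F 1}"
    then show "AE s in unit_leb. \<rho> (jump (\<tau> j)) s = indicator {\<tau> j..1} s"
      using \<tau>[of j] by (intro \<rho>_jump) auto
  qed simp
  have Y1: "AE s in unit_leb. \<rho> Y s = real (F s)"
    using Y all unfolding AE_unit_leb_iff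
  proof eventually_elim
    fix s :: real assume *: "s \<in> {0..1} \<longrightarrow> \<rho> Y s = (\<Sum>j<F 1. \<rho> (jump (\<tau> j)) s)"
      "s \<in> {0..1} \<longrightarrow> (\<forall>j\<in>{..<F 1}. \<rho> (jump (\<tau> j)) s = indicator {\<tau> j..1} s)"
    show "s \<in> {0..1} \<longrightarrow> \<rho> Y s = real (F s)"
    proof
      assume s: "s \<in> {0..1}"
      then have "\<rho> Y s = (\<Sum>j<F 1. indicator {\<tau> j..1} s)" using * by simp
      also have "\<dots> = (\<Sum>j<F 1. of_bool (\<tau> j \<le> s))" using s by (intro sum.cong) (auto simp: indicator_def)
      finally show "\<rho> Y s = real (F s)" using Fsum[OF s] by simp
    qed
  qed
  have X: "AE s in unit_leb. \<rho> ((1 / sqrt l) *\<^sub>R Y + (- l / sqrt l) *\<^sub>R drift) s = (real (F s) - l * s) / sqrt l"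
    using \<rho>_lincomb[of "1 / sqrt l" Y "- l / sqrt l" drift] Y1 \<rho>_drift
    by eventually_elim (simp add: diff_divide_distrib)
  have "element_of \<rho> (\<lambda>t. (real (F t) - l * t) / sqrt l) = (1 / sqrt l) *\<^sub>R Y + (- l / sqrt l) *\<^sub>R drift"
    by (rule element_of_eqI[OF X])
  also have "\<dots> = (Y - l *\<^sub>R drift) /\<^sub>R sqrt l"
    by (simp add: scaleR_diff_right divide_inverse mult.commute)
  finally have 1: "element_of \<rho> (\<lambda>t. (real (F t) - l * t) / sqrt l) = (Y - l *\<^sub>R drift) /\<^sub>R sqrt l" .
  have "norm Y \<le> (\<Sum>j<F 1. hoelder_const)"
    unfolding Y_def using \<tau> by (intro sum_norm_le norm_jump_le) (auto intro: less_imp_le)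
  then have 2: "norm Y \<le> real (F 1) * hoelder_const" by simp
  have 3: "norm (Y - (\<Sum>i<n. real (F (grid n i) - F (real i / real n)) *\<^sub>R jump (grid n i)))
       \<le> real (F 1) * modulus n" if n: "0 < n" for n
  proof -
    let ?t = "\<lambda>i. real i / real n"
    have t01: "?t i \<in> {0..1}" if "i \<le> n" for i using that n by simp
    \<comment> \<open>\<open>c i j\<close> is 1 if the j-th jump falls into the i-th half-open cell
      and 0 otherwise. Its sum over cells telescopes to 1, and its sum over jumps is the increment
      of \<open>F\<close>.\<close>
    define c where "c i j = (of_bool (\<tau> j \<le> ?t (Suc i)) - of_bool (\<tau> j \<le> ?t i) :: real)" for i j
    have tmono: "?t i \<le> ?t (Suc i)" for i by (simp add: divide_right_mono)
    have c0: "0 \<le> c i j" for i j using tmono[of i] unfolding c_def by auto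
    have csum: "(\<Sum>i<n. c i j) = 1" if "j < F 1" for j
      unfolding c_def using \<tau>[OF that] n by (subst sum_lessThan_telescope) simp
    have dF: "real (F (?t (Suc i)) - F (?t i)) = (\<Sum>j<F 1. c i j)" if "i < n" for i
    proof -
      have "F (?t i) \<le> F (?t (Suc i))" by (intro mono_onD[OF mono] tmono) simp_all
      then have "real (F (?t (Suc i)) - F (?t i)) = real (F (?t (Suc i))) - real (F (?t i))" by (rule of_nat_diff)
      also have "\<dots> = (\<Sum>j<F 1. c i j)"
        using Fsum[OF t01[of "Suc i"]] Fsum[OF t01[of i]] that unfolding c_def sum_subtractf by simp
      finally show ?thesis .
    qed
    have "Y = (\<Sum>j<F 1. \<Sum>i<n. c i j *\<^sub>R jump (\<tau> j))"
      unfolding Y_def by (intro sum.cong refl) (simp add: scaleR_sum_left[symmetric] csum)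
    moreover have "(\<Sum>i<n. real (F (?t (Suc i)) - F (?t i)) *\<^sub>R jump (?t (Suc i))) = (\<Sum>j<F 1. \<Sum>i<n. c i j *\<^sub>R jump (?t (Suc i)))"
      by (subst sum.swap) (intro sum.cong refl, simp only: lessThan_iff dF scaleR_sum_left)
    ultimately have "Y - (\<Sum>i<n. real (F (?t (Suc i)) - F (?t i)) *\<^sub>R jump (?t (Suc i)))
       = (\<Sum>j<F 1. \<Sum>i<n. c i j *\<^sub>R (jump (\<tau> j) - jump (?t (Suc i))))"
      by (simp add: sum_subtractf scaleR_diff_right)
    also have "norm \<dots> \<le> (\<Sum>j<F 1. \<Sum>i<n. c i j * modulus n)"
    proof (intro sum_norm_le)
      fix j i assume ji: "j \<in> {..<F 1}" "i \<in> {..<n}"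
      show "norm (c i j *\<^sub>R (jump (\<tau> j) - jump (?t (Suc i)))) \<le> c i j * modulus n"
      proof (cases "c i j = 0")
        case False
        then have "\<not> (\<tau> j \<le> ?t (Suc i) \<longleftrightarrow> \<tau> j \<le> ?t i)" unfolding c_def by fastforce
        then have cc: "\<tau> j \<le> ?t (Suc i)" "?t i < \<tau> j" using order_trans[OF _ tmono[of i], of "\<tau> j"] by (metis not_le)+
        have "?t (Suc i) - ?t i = 1 / real n" by (simp add: diff_divide_distrib[symmetric])
        then have "\<bar>\<tau> j - ?t (Suc i)\<bar> \<le> 1 / real n" using cc by (simp add: abs_if)
        then have "norm (jump (\<tau> j) - jump (?t (Suc i))) \<le> modulus n"
          using \<tau>[of j] ji t01[of "Suc i"] by (intro norm_jump_diff_le_modulus) auto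
        then show ?thesis using c0[of i j] by (simp add: mult_left_mono)
      qed simp
    qed
    also have "\<dots> = real (F 1) * modulus n" by (simp add: sum_distrib_right[symmetric] csum)
    finally show ?thesis .
  qed
  show ?thesis using 1 2 3 by blast
qed

text \<open>The pathwise error is \<open>(N 1 + l) / sqrt l * modulus n\<close>. As
  \<open>N 1\<close> has mean \<open>l\<close>, its expectation is
  \<open>2 * sqrt l * modulus n\<close>, which vanishes as n grows with \<open>l\<close>
  fixed.\<close>

lemma normalized_poisson_approx:
  fixes f :: "'k \<Rightarrow> real"
  assumes pp: "poisson_process M l N" and l: "0 < l" and f: "L-lipschitz_on UNIV f" and n: "0 < n"
  shows "\<bar>(\<integral>\<omega>. f (normalized_poisson \<rho> l N \<omega>) \<partial>M) -
      poisson_iter (l / real n) (\<lambda>i. jump (grid n i) /\<^sub>R sqrt l) n f 0\<bar> \<le> 2 * L * sqrt l * modulus n"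
proof -
  interpret prob_space M using pp by (simp add: poisson_process_def)
  let ?X = "normalized_poisson \<rho> l N"
  have Nm: "N t \<in> measurable M (count_space UNIV)" if "0 \<le> t" for t using pp that by (simp add: poisson_process_def)
  have L: "0 \<le> L" using f by (rule lipschitz_on_nonneg)
  have sl: "0 < sqrt l" using l by simp
  define D where "D n i \<omega> = N (grid n i) \<omega> - N (real i / real n) \<omega>" for n i \<omega>
  define Xn where "Xn n \<omega> = (\<Sum>i<n. (real (D n i \<omega>) - l / real n) *\<^sub>R (jump (grid n i) /\<^sub>R sqrt l))" for n \<omega>
  \<comment> \<open>The subtraction is one of natural numbers; countability of the values gives
    measurability.\<close>
  have Dm: "(\<lambda>\<omega>. D n i \<omega>) \<in> measurable M (count_space UNIV)" for n i
    unfolding D_def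
  proof (rule measurable_compose_countable[where g = "N (real i / real n)"])
    show "(\<lambda>\<omega>. N (grid n i) \<omega> - k) \<in> measurable M (count_space UNIV)" for k
    proof (rule measurable_compose[where g = "\<lambda>x. x - k"])
      show "N (grid n i) \<in> measurable M (count_space UNIV)" by (rule Nm) simp
    qed simp
    show "N (real i / real n) \<in> measurable M (count_space UNIV)" by (rule Nm) simp
  qed
  have Xnm: "Xn n \<in> borel_measurable M" for n
    unfolding Xn_def
    by (intro borel_measurable_sum borel_measurable_scaleR borel_measurable_diff borel_measurable_const measurable_compose[OF Dm]) simp
  have dist_le: "norm (?X \<omega> - Xn n \<omega>) \<le> (real (N 1 \<omega>) + l) / sqrt l * modulus n"
    and norm_le: "norm (?X \<omega>) \<le> (real (N 1 \<omega>) * hoelder_const + l * norm drift) / sqrt l"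
    if \<omega>: "\<omega> \<in> space M" and n: "0 < n" for n \<omega>
  proof -
    have p: "N 0 \<omega> = 0" "mono_on {0..} (\<lambda>t. N t \<omega>)" "\<And>t. 0 \<le> t \<Longrightarrow> continuous (at_right t) (\<lambda>s. real (N s \<omega>))"
      using pp \<omega> by (auto simp: poisson_process_def)
    obtain Y where Y1: "element_of \<rho> (\<lambda>t. (real (N t \<omega>) - l * t) / sqrt l) = (Y - l *\<^sub>R drift) /\<^sub>R sqrt l"
      and Y2: "norm Y \<le> real (N 1 \<omega>) * hoelder_const"
      and Y3: "\<forall>n>0. norm (Y - (\<Sum>i<n. real (N (grid n i) \<omega> - N (real i / real n) \<omega>) *\<^sub>R jump (grid n i)))
       \<le> real (N 1 \<omega>) * modulus n"
      using path_element[OF p l] by blast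
    have Y: "?X \<omega> = (Y - l *\<^sub>R drift) /\<^sub>R sqrt l" "norm Y \<le> real (N 1 \<omega>) * hoelder_const"
      "norm (Y - (\<Sum>i<n. real (D n i \<omega>) *\<^sub>R jump (grid n i))) \<le> real (N 1 \<omega>) * modulus n"
      using Y1 Y2 Y3[rule_format, OF n] by (simp_all only: normalized_poisson_def D_def)
    let ?S = "\<Sum>i<n. real (D n i \<omega>) *\<^sub>R jump (grid n i)" and ?J = "(\<Sum>i<n. jump (grid n i)) /\<^sub>R real n"
    have "Xn n \<omega> = (?S - l *\<^sub>R ?J) /\<^sub>R sqrt l"
    proof -
      have "Xn n \<omega> = (\<Sum>i<n. (real (D n i \<omega>) - l / real n) *\<^sub>R jump (grid n i)) /\<^sub>R sqrt l"
        unfolding Xn_def scaleR_sum_right by (intro sum.cong refl) (simp only: scaleR_scaleR mult.commute)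
      also have "(\<Sum>i<n. (real (D n i \<omega>) - l / real n) *\<^sub>R jump (grid n i)) = ?S - l *\<^sub>R ?J"
        unfolding scaleR_sum_right sum_subtractf[symmetric]
        by (intro sum.cong refl) (simp only: scaleR_diff_left scaleR_scaleR divide_inverse)
      finally show ?thesis .
    qed
    then have "?X \<omega> - Xn n \<omega> = ((Y - ?S) - l *\<^sub>R (drift - ?J)) /\<^sub>R sqrt l"
      unfolding Y(1) by (simp add: scaleR_diff_right[symmetric] algebra_simps)
    then have "norm (?X \<omega> - Xn n \<omega>) = norm ((Y - ?S) - l *\<^sub>R (drift - ?J)) / sqrt l"
      using l by (simp add: divide_inverse mult.commute)
    also have "\<dots> \<le> (real (N 1 \<omega>) * modulus n + l * modulus n) / sqrt l"
    proof (rule divide_right_mono)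
      have "norm ((Y - ?S) - l *\<^sub>R (drift - ?J)) \<le> norm (Y - ?S) + norm (l *\<^sub>R (drift - ?J))" by (rule norm_triangle_ineq4)
      also have "\<dots> = norm (Y - ?S) + l * norm (drift - ?J)" using l by simp
      also have "\<dots> \<le> real (N 1 \<omega>) * modulus n + l * modulus n"
        using l n by (intro add_mono Y(3) mult_left_mono drift_riemann) auto
      finally show "norm ((Y - ?S) - l *\<^sub>R (drift - ?J)) \<le> real (N 1 \<omega>) * modulus n + l * modulus n" .
    qed (use l in simp)
    finally show "norm (?X \<omega> - Xn n \<omega>) \<le> (real (N 1 \<omega>) + l) / sqrt l * modulus n" by (simp add: algebra_simps)
    have "norm (?X \<omega>) = norm (Y - l *\<^sub>R drift) / sqrt l" unfolding Y(1) using l by (simp add: divide_inverse mult.commute)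
    also have "\<dots> \<le> (norm Y + l * norm drift) / sqrt l"
      using l norm_triangle_ineq4[of Y "l *\<^sub>R drift"] by (intro divide_right_mono) auto
    also have "\<dots> \<le> (real (N 1 \<omega>) * hoelder_const + l * norm drift) / sqrt l"
      using l Y(2) by (intro divide_right_mono) auto
    finally show "norm (?X \<omega>) \<le> (real (N 1 \<omega>) * hoelder_const + l * norm drift) / sqrt l" .
  qed
  \<comment> \<open>\<open>element_of\<close> is a definite description and carries no
    measurability, so the normalized process is obtained as a pointwise limit of its
    discretizations.\<close>
  have Xm: "?X \<in> borel_measurable M"
  proof (rule borel_measurable_LIMSEQ_metric[OF Xnm])
    fix \<omega> assume \<omega>: "\<omega> \<in> space M"
    have "(\<lambda>n. (real (N 1 \<omega>) + l) / sqrt l * modulus n) \<longlonglongrightarrow> (real (N 1 \<omega>) + l) / sqrt l * 0"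
      by (intro tendsto_intros modulus_tendsto_0)
    then have "(\<lambda>n. (real (N 1 \<omega>) + l) / sqrt l * modulus n) \<longlonglongrightarrow> 0" by simp
    moreover have "\<forall>\<^sub>F n in sequentially. norm (Xn n \<omega> - ?X \<omega>) \<le> (real (N 1 \<omega>) + l) / sqrt l * modulus n"
      using eventually_gt_at_top[of 0] by eventually_elim (use dist_le[OF \<omega>] in \<open>simp add: norm_minus_commute\<close>)
    ultimately have "(\<lambda>n. Xn n \<omega> - ?X \<omega>) \<longlonglongrightarrow> 0" by (rule Lim_null_comparison[rotated])
    then show "(\<lambda>n. Xn n \<omega>) \<longlonglongrightarrow> ?X \<omega>" by (simp add: LIM_zero_iff)
  qed
  have fm: "f \<in> borel_measurable borel"
    using lipschitz_on_continuous_on[OF f] by (rule borel_measurable_continuous_onI)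
  have distr_D: "distr M (count_space UNIV) (D n i) = measure_pmf (poisson_pmf (l / real n))" if n: "0 < n" for n i
  proof -
    have "distr M (count_space UNIV) (\<lambda>\<omega>. N (grid n i) \<omega> - N (real i / real n) \<omega>)
      = measure_pmf (poisson_pmf (l * (grid n i - real i / real n)))"
      using pp n by (auto simp: poisson_process_def divide_strict_right_mono)
    then show ?thesis by (simp add: D_def[abs_def] diff_divide_distrib[symmetric])
  qed
  \<comment> \<open>\<open>N 1\<close> is the increment over the single cell of the grid with n =
    1.\<close>
  have N1: "has_bochner_integral M (\<lambda>\<omega>. real (N 1 \<omega>)) l"
  proof -
    have "has_bochner_integral (measure_pmf (poisson_pmf l)) real l" by (rule poisson_moments(1)[OF l])
    then have "has_bochner_integral (distr M (count_space UNIV) (D 1 0)) real l" by (simp add: distr_D)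
    then have "has_bochner_integral M (\<lambda>\<omega>. real (D 1 0 \<omega>)) l"
      using integrable_distr_eq[OF Dm, of real 1 0] integral_distr[OF Dm, of real 1 0]
      by (simp add: has_bochner_integral_iff)
    moreover have "D 1 0 \<omega> = N 1 \<omega>" if "\<omega> \<in> space M" for \<omega> using pp that by (simp add: D_def poisson_process_def)
    ultimately show ?thesis by (subst has_bochner_integral_cong[OF refl _ refl]) auto
  qed
  have fX: "integrable M (\<lambda>\<omega>. f (?X \<omega>))"
  proof (rule Bochner_Integration.integrable_bound)
    show "integrable M (\<lambda>\<omega>. \<bar>f 0\<bar> + L * ((real (N 1 \<omega>) * hoelder_const + l * norm drift) / sqrt l))"
      using N1 by (auto simp: has_bochner_integral_iff)
    show "(\<lambda>\<omega>. f (?X \<omega>)) \<in> borel_measurable M" by (rule measurable_compose[OF Xm fm])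
    show "AE \<omega> in M. norm (f (?X \<omega>)) \<le> norm (\<bar>f 0\<bar> + L * ((real (N 1 \<omega>) * hoelder_const + l * norm drift) / sqrt l))"
    proof (rule AE_I2)
      fix \<omega> assume \<omega>: "\<omega> \<in> space M"
      have "\<bar>f (?X \<omega>) - f 0\<bar> \<le> L * norm (?X \<omega>)" using lipschitz_abs_diff[OF f, of "?X \<omega>" 0] by simp
      also have "\<dots> \<le> L * ((real (N 1 \<omega>) * hoelder_const + l * norm drift) / sqrt l)"
        using norm_le[OF \<omega> n] L by (intro mult_left_mono)
      finally show "norm (f (?X \<omega>)) \<le> norm (\<bar>f 0\<bar> + L * ((real (N 1 \<omega>) * hoelder_const + l * norm drift) / sqrt l))"
        unfolding real_norm_def by linarith
    qed
  qed
  have bnd: "integrable M (\<lambda>\<omega>. L * ((real (N 1 \<omega>) + l) / sqrt l * modulus n))"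
    using N1 by (auto simp: has_bochner_integral_iff)
  have diff: "\<bar>f (?X \<omega>) - f (Xn n \<omega>)\<bar> \<le> L * ((real (N 1 \<omega>) + l) / sqrt l * modulus n)" if "\<omega> \<in> space M" for \<omega>
    by (rule order_trans[OF lipschitz_abs_diff[OF f] mult_left_mono[OF dist_le[OF that n] L]])
  \<comment> \<open>The difference is dominated by a multiple of \<open>N 1 + l\<close>;
    integrability of \<open>f (Xn n \<omega>)\<close> then follows by subtraction.\<close>
  have fXd: "integrable M (\<lambda>\<omega>. f (?X \<omega>) - f (Xn n \<omega>))"
  proof (rule Bochner_Integration.integrable_bound[OF bnd])
    show "(\<lambda>\<omega>. f (?X \<omega>) - f (Xn n \<omega>)) \<in> borel_measurable M"
      by (intro borel_measurable_diff measurable_compose[OF Xm fm] measurable_compose[OF Xnm fm])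
    show "AE \<omega> in M. norm (f (?X \<omega>) - f (Xn n \<omega>)) \<le> norm (L * ((real (N 1 \<omega>) + l) / sqrt l * modulus n))"
    proof (rule AE_I2)
      fix \<omega> assume "\<omega> \<in> space M"
      from order_trans[OF diff[OF this] abs_ge_self]
      show "norm (f (?X \<omega>) - f (Xn n \<omega>)) \<le> norm (L * ((real (N 1 \<omega>) + l) / sqrt l * modulus n))"
        by (simp only: real_norm_def)
    qed
  qed
  have fXn: "integrable M (\<lambda>\<omega>. f (Xn n \<omega>))"
    using Bochner_Integration.integrable_diff[OF fX fXd] by simp
  have "(\<integral>\<omega>. f (?X \<omega>) \<partial>M) - (\<integral>\<omega>. f (Xn n \<omega>) \<partial>M) = (\<integral>\<omega>. f (?X \<omega>) - f (Xn n \<omega>) \<partial>M)"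
    using fX fXn by simp
  also have "\<bar>\<dots>\<bar> \<le> (\<integral>\<omega>. L * ((real (N 1 \<omega>) + l) / sqrt l * modulus n) \<partial>M)"
    by (rule order_trans[OF integral_abs_bound integral_mono]) (use fXd bnd diff in auto)
  also have "\<dots> = L * ((l + l) / sqrt l * modulus n)"
    using N1 by (simp add: has_bochner_integral_iff prob_space)
  also have "\<dots> = 2 * L * (l / sqrt l) * modulus n" by simp
  also have "l / sqrt l = sqrt l" using l by (simp add: real_div_sqrt)
  finally have A: "\<bar>(\<integral>\<omega>. f (?X \<omega>) \<partial>M) - (\<integral>\<omega>. f (Xn n \<omega>) \<partial>M)\<bar> \<le> 2 * L * sqrt l * modulus n" .
  have "(\<integral>\<omega>. f (Xn n \<omega>) \<partial>M) = poisson_iter (l / real n) (\<lambda>i. jump (grid n i) /\<^sub>R sqrt l) n f 0"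
  proof -
    let ?h = "\<lambda>x. f (0 + (\<Sum>i<n. (real (x i) - l / real n) *\<^sub>R (jump (grid n i) /\<^sub>R sqrt l)))"
    have "indep_vars (\<lambda>_. count_space UNIV) (\<lambda>i \<omega>. N (grid n i) \<omega> - N (real i / real n) \<omega>) {..<n}"
    proof -
      have "mono (\<lambda>i. real i / real n)" by (intro monoI divide_right_mono) auto
      then show ?thesis using pp unfolding poisson_process_def by (elim conjE) (drule spec[of _ n], drule spec[of _ "\<lambda>i. real i / real n"], simp)
    qed
    then have "indep_vars (\<lambda>_. count_space UNIV) (D n) {..<n}" by (simp add: D_def[abs_def])
    then have d: "distr M (PiM {..<n} (\<lambda>_. count_space UNIV)) (\<lambda>\<omega>. \<lambda>i\<in>{..<n}. D n i \<omega>) = PiM {..<n} (\<lambda>i. distr M (count_space UNIV) (D n i))"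
      using n Dm by (subst (asm) indep_vars_iff_distr_eq_PiM') auto
    have comp: "(\<lambda>x. real (x i)) \<in> borel_measurable (PiM {..<n} (\<lambda>_. count_space UNIV))" if "i \<in> {..<n}" for i
      by (rule measurable_compose[OF measurable_component_singleton[OF that]]) simp
    have hm: "?h \<in> borel_measurable (PiM {..<n} (\<lambda>_. count_space UNIV))"
      by (rule measurable_compose[OF _ fm])
        (intro borel_measurable_add borel_measurable_sum borel_measurable_scaleR borel_measurable_diff comp borel_measurable_const)
    have "(\<integral>\<omega>. f (Xn n \<omega>) \<partial>M) = (\<integral>\<omega>. ?h (\<lambda>i\<in>{..<n}. D n i \<omega>) \<partial>M)"
      unfolding Xn_def by simp
    also have "\<dots> = (\<integral>x. ?h x \<partial>distr M (PiM {..<n} (\<lambda>_. count_space UNIV)) (\<lambda>\<omega>. \<lambda>i\<in>{..<n}. D n i \<omega>))"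
      by (intro integral_distr[symmetric] measurable_restrict Dm hm)
    also have "\<dots> = (\<integral>x. ?h x \<partial>PiM {..<n} (\<lambda>_. measure_pmf (poisson_pmf (l / real n))))"
      unfolding d distr_D[OF n] ..
    also have "\<dots> = poisson_iter (l / real n) (\<lambda>i. jump (grid n i) /\<^sub>R sqrt l) n f 0"
      using l n f by (intro poisson_iter_eq_PiM_integral) auto
    finally show ?thesis .
  qed
  with A show ?thesis by simp
qed

end


subsection \<open>Convergence of Rademacher sums\<close>

text \<open>The phase \<open>\<theta>\<close> makes real cosines suffice: sines are shifted cosines,
  constants have \<open>u = 0\<close>, and products reduce to sums by the product formula.\<close>

inductive trig_poly :: "('k::real_inner \<Rightarrow> real) \<Rightarrow> bool" where
  cosine: "trig_poly (\<lambda>x. c * cos (u \<bullet> x + \<theta>))"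
| add: "trig_poly f \<Longrightarrow> trig_poly g \<Longrightarrow> trig_poly (\<lambda>x. f x + g x)"

lemma trig_poly_const: "trig_poly (\<lambda>x. c)"
  using trig_poly.cosine[of c 0 0] by simp

lemma trig_poly_mult:
  assumes "trig_poly f" "trig_poly g"
  shows "trig_poly (\<lambda>x. f x * g x)"
  using assms(1)
proof (induction rule: trig_poly.induct)
  case (cosine c u \<theta>)
  from assms(2) show ?case
  proof (induction rule: trig_poly.induct)
    case (cosine d w \<eta>)
    have "(\<lambda>x. (c * cos (u \<bullet> x + \<theta>)) * (d * cos (w \<bullet> x + \<eta>)))
      = (\<lambda>x. (c * d / 2) * cos ((u - w) \<bullet> x + (\<theta> - \<eta>)) + (c * d / 2) * cos ((u + w) \<bullet> x + (\<theta> + \<eta>)))"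
    proof
      fix x
      have e: "(u - w) \<bullet> x + (\<theta> - \<eta>) = (u \<bullet> x + \<theta>) - (w \<bullet> x + \<eta>)" "(u + w) \<bullet> x + (\<theta> + \<eta>) = (u \<bullet> x + \<theta>) + (w \<bullet> x + \<eta>)"
        by (simp_all add: inner_diff_left inner_add_left)
      show "(c * cos (u \<bullet> x + \<theta>)) * (d * cos (w \<bullet> x + \<eta>)) =
          (c * d / 2) * cos ((u - w) \<bullet> x + (\<theta> - \<eta>)) + (c * d / 2) * cos ((u + w) \<bullet> x + (\<theta> + \<eta>))"
        unfolding e cos_add cos_diff by (simp add: field_simps)
    qed
    then show ?case by (simp only:) (intro trig_poly.intros)
  next
    case (add g h)
    from trig_poly.add[OF add.IH] show ?case by (simp add: distrib_left)
  qed
next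
  case (add f h)
  from trig_poly.add[OF add.IH] show ?case by (simp add: distrib_right)
qed

lemma trig_poly_bounded:
  assumes "trig_poly f" obtains B where "\<And>x. \<bar>f x\<bar> \<le> B"
proof -
  have "\<exists>B. \<forall>x. \<bar>f x\<bar> \<le> B" using assms
  proof induction
    case (cosine c u \<theta>)
    have "\<bar>c * cos (u \<bullet> x + \<theta>)\<bar> \<le> \<bar>c\<bar>" for x
      using mult_left_mono[OF abs_cos_le_one[of "u \<bullet> x + \<theta>"], of "\<bar>c\<bar>"] by (simp add: abs_mult)
    then show ?case by blast
  next
    case (add f g)
    then obtain A B where "\<And>x. \<bar>f x\<bar> \<le> A" "\<And>x. \<bar>g x\<bar> \<le> B" by blast
    then have "\<bar>f x + g x\<bar> \<le> A + B" for x using abs_triangle_ineq[of "f x" "g x"] add_mono by (meson order_trans)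
    then show ?case by blast
  qed
  then show ?thesis using that by blast
qed

lemma trig_poly_continuous: "trig_poly f \<Longrightarrow> continuous_on S f"
  by (induction rule: trig_poly.induct) (auto intro!: continuous_intros)

lemma trig_poly_compose_polynomial:
  fixes p :: "real \<Rightarrow> real"
  assumes p: "real_polynomial_function p" and g: "trig_poly g"
  shows "trig_poly (\<lambda>x. p (g x))"
  using p
proof (induction rule: real_polynomial_function.induct)
  case (linear f)
  have "f y = f 1 * y" for y
    using linear_scale[OF bounded_linear.linear[OF linear], of y 1] by simp
  then have eq: "(\<lambda>x. f (g x)) = (\<lambda>x. f 1 * g x)" by (intro ext)
  show ?case unfolding eq by (rule trig_poly_mult[OF trig_poly_const g])
qed (auto intro: trig_poly_const trig_poly.add trig_poly_mult)

text \<open>Stone-Weierstrass gives approximation on a compact set only. Composing with a polynomial that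
  approximates truncation keeps the approximant bounded off that set.\<close>

lemma trig_poly_approximation:
  fixes h :: "'k::real_inner \<Rightarrow> real"
  assumes S: "compact S" and h: "continuous_on S h" and A: "\<And>x. x \<in> S \<Longrightarrow> \<bar>h x\<bar> \<le> A" "0 \<le> A" and \<epsilon>: "0 < \<epsilon>"
  obtains G where "trig_poly G" "\<And>x. x \<in> S \<Longrightarrow> \<bar>h x - G x\<bar> \<le> \<epsilon>" "\<And>x. \<bar>G x\<bar> \<le> A + 1"
proof -
  \<comment> \<open>Two approximations are made, each costing \<open>e\<close>;
    \<open>2 * e \<le> \<epsilon>\<close> controls the error on \<open>S\<close>, and
    \<open>e \<le> 1\<close> the global bound \<open>A + 1\<close>.\<close>
  define e where "e = min \<epsilon> 1 / 2"
  have e: "0 < e" "2 * e \<le> \<epsilon>" "e \<le> 1" using \<epsilon> by (auto simp: e_def)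
  have sep: "\<exists>f. trig_poly f \<and> f x \<noteq> f y" if "x \<in> S \<and> y \<in> S \<and> x \<noteq> y" for x y
  proof -
    \<comment> \<open>The scaling makes the phases at \<open>x\<close> and \<open>y\<close> differ
      by exactly pi, so the cosines there are -1 and 1.\<close>
    define u where "u = (pi / (norm (x - y))\<^sup>2) *\<^sub>R (x - y)"
    have "u \<bullet> (x - y) = pi" using that by (simp add: u_def power2_norm_eq_inner)
    then have "1 * cos (u \<bullet> x + (- (u \<bullet> y))) \<noteq> 1 * cos (u \<bullet> y + (- (u \<bullet> y)))"
      by (simp add: inner_diff_right)
    then show ?thesis using trig_poly.cosine[of 1 u "- (u \<bullet> y)"] by blast
  qed
  have "\<exists>g. trig_poly g \<and> (\<forall>x\<in>S. \<bar>h x - g x\<bar> < e)"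
  proof (rule Stone_Weierstrass_HOL[where P = trig_poly and S = S and f = h and e = e])
    show "trig_poly (\<lambda>x. c)" for c by (rule trig_poly_const)
    show "continuous_on S f" if "trig_poly f" for f using that by (rule trig_poly_continuous)
    show "trig_poly (\<lambda>x. f x + g x)" if "trig_poly f \<and> trig_poly g" for f g using that by (intro trig_poly.add) simp_all
    show "trig_poly (\<lambda>x. f x * g x)" if "trig_poly f \<and> trig_poly g" for f g using that by (intro trig_poly_mult) simp_all
    show "\<exists>f. trig_poly f \<and> f x \<noteq> f y" if "x \<in> S \<and> y \<in> S \<and> x \<noteq> y" for x y using that by (rule sep)
  qed (fact S h e(1))+
  then obtain g where g: "trig_poly g" "\<And>x. x \<in> S \<Longrightarrow> \<bar>h x - g x\<bar> < e" by blast
  obtain B where B: "\<And>x. \<bar>g x\<bar> \<le> B" using trig_poly_bounded[OF g(1)] by blast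
  define clip where "clip t = max (- A) (min A t)" for t :: real
  have cc: "continuous_on {- B..B} clip" unfolding clip_def by (intro continuous_intros)
  obtain p where p: "real_polynomial_function p" "\<And>t. t \<in> {- B..B} \<Longrightarrow> \<bar>clip t - p t\<bar> < e"
    using Stone_Weierstrass_real_polynomial_function[OF compact_Icc cc e(1)] by blast
  have pg: "\<bar>clip (g x) - p (g x)\<bar> < e" for x using p(2)[of "g x"] B[of x] by (auto simp: abs_le_iff)
  have cl: "\<bar>clip t\<bar> \<le> A" for t using A(2) by (auto simp: clip_def)
  show ?thesis
  proof (rule that[of "\<lambda>x. p (g x)"])
    show "trig_poly (\<lambda>x. p (g x))" by (rule trig_poly_compose_polynomial[OF p(1) g(1)])
    show "\<bar>p (g x)\<bar> \<le> A + 1" for x using pg[of x] cl[of "g x"] e(3) by linarith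
    show "\<bar>h x - p (g x)\<bar> \<le> \<epsilon>" if x: "x \<in> S" for x
    proof -
      \<comment> \<open>Truncation to the range of \<open>h\<close> can only bring
        \<open>g x\<close> closer to \<open>h x\<close>.\<close>
      have "\<bar>h x - clip (g x)\<bar> \<le> \<bar>h x - g x\<bar>" using A(1)[OF x] by (auto simp: clip_def)
      then show ?thesis using pg[of x] g(2)[OF x] e(2) by linarith
    qed
  qed
qed

section \<open>Orthogonal projections on finite-dimensional subspaces\<close>

definition proj :: "'k::real_inner set \<Rightarrow> 'k \<Rightarrow> 'k" where
  "proj E x = (\<Sum>e\<in>E. (e \<bullet> x) *\<^sub>R e)"

lemma inner_proj_commute: "u \<bullet> proj E x = proj E u \<bullet> x"
  unfolding proj_def by (simp add: inner_sum_left inner_sum_right inner_commute mult.commute)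

lemma linear_proj: "linear (proj E)"
  unfolding proj_def by (rule linearI)
    (simp_all add: inner_add_right scaleR_add_left sum.distrib scaleR_sum_right)

lemma continuous_on_proj: "continuous_on S (proj E)"
  unfolding proj_def by (intro continuous_intros)

lemma proj_in_span: "proj E x \<in> span E"
  unfolding proj_def by (intro span_sum span_scale span_base)

lemma inner_orthonormal_proj:
  assumes E: "finite_orthonormal E" and e: "e \<in> E"
  shows "e \<bullet> proj E x = e \<bullet> x"
proof -
  have "e \<bullet> proj E x = (\<Sum>d\<in>E. if d = e then e \<bullet> x else 0)"
    unfolding proj_def inner_sum_right
  proof (intro sum.cong refl)
    fix d assume d: "d \<in> E"
    show "e \<bullet> ((d \<bullet> x) *\<^sub>R d) = (if d = e then e \<bullet> x else 0)"
    proof (cases "d = e")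
      case True
      have "e \<bullet> e = 1" using E e by (simp add: finite_orthonormal_def dot_square_norm)
      then show ?thesis using True by simp
    next
      case False
      then have "orthogonal e d" using E e d by (auto simp: finite_orthonormal_def pairwise_def)
      then show ?thesis using False by (simp add: orthogonal_def)
    qed
  qed
  also have "\<dots> = e \<bullet> x" using E e by (simp add: finite_orthonormal_def)
  finally show ?thesis .
qed

lemma proj_residual_orthogonal:
  assumes E: "finite_orthonormal E" and y: "y \<in> span E"
  shows "y \<bullet> (x - proj E x) = 0"
  using y
proof (induction rule: span_induct_alt)
  case (step c e y)
  then show ?case using inner_orthonormal_proj[OF E step(1), of x]
    by (simp add: inner_add_left inner_diff_right)
qed simp

text \<open>Pythagoras: the residual is orthogonal to the span, so the projection is the best
  approximation from it.\<close>

lemma norm_proj_residual_le: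
  assumes E: "finite_orthonormal E" and y: "y \<in> span E"
  shows "norm (x - proj E x) \<le> norm (x - y)"
proof -
  have "proj E x - y \<in> span E" by (intro span_diff proj_in_span y)
  then have "orthogonal (x - proj E x) (proj E x - y)"
    using proj_residual_orthogonal[OF E, of "proj E x - y" x] by (simp add: orthogonal_def inner_commute)
  from norm_add_Pythagorean[OF this] have "(norm (x - y))\<^sup>2 = (norm (x - proj E x))\<^sup>2 + (norm (proj E x - y))\<^sup>2" by simp
  then have "(norm (x - proj E x))\<^sup>2 \<le> (norm (x - y))\<^sup>2" by simp
  then show ?thesis by (rule power2_le_imp_le) simp
qed

lemma norm_proj_le:
  assumes E: "finite_orthonormal E"
  shows "norm (proj E x) \<le> norm x"
proof -
  have "orthogonal (proj E x) (x - proj E x)"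
    using proj_residual_orthogonal[OF E proj_in_span] by (simp add: orthogonal_def)
  from norm_add_Pythagorean[OF this] have "(norm x)\<^sup>2 = (norm (proj E x))\<^sup>2 + (norm (x - proj E x))\<^sup>2" by simp
  then have "(norm (proj E x))\<^sup>2 \<le> (norm x)\<^sup>2" by simp
  then show ?thesis by (rule power2_le_imp_le) simp
qed

lemma gram_schmidt:
  assumes "finite D"
  obtains E :: "'k::real_inner set" where "finite_orthonormal E" "D \<subseteq> span E"
proof -
  have "\<exists>E. finite_orthonormal E \<and> D \<subseteq> span E"
    using assms
  proof (induction D)
    case empty
    have "finite_orthonormal {}" by (simp add: finite_orthonormal_def)
    then show ?case by blast
  next
    case (insert d D)
    then obtain E where E: "finite_orthonormal E" "D \<subseteq> span E" by blast
    define r where "r = d - proj E d"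
    show ?case
    proof (cases "r = 0")
      case True
      then have "d \<in> span E" using proj_in_span[of E d] by (simp add: r_def)
      then show ?thesis using E by blast
    next
      case False
      define E' where "E' = insert (r /\<^sub>R norm r) E"
      have orth: "e \<bullet> r = 0" if "e \<in> E" for e
        unfolding r_def using that by (intro proj_residual_orthogonal E span_base)
      have "finite_orthonormal E'"
        using E(1) False orth unfolding finite_orthonormal_def E'_def
        by (auto simp: pairwise_insert orthogonal_def inner_commute)
      moreover have sub: "span E \<subseteq> span E'" unfolding E'_def by (intro span_mono) auto
      moreover have "d \<in> span E'"
      proof -
        have "norm r *\<^sub>R (r /\<^sub>R norm r) \<in> span E'"
          by (intro span_scale span_base) (simp add: E'_def)
        moreover have "proj E d \<in> span E'" using sub proj_in_span[of E d] by blast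
        ultimately have "norm r *\<^sub>R (r /\<^sub>R norm r) + proj E d \<in> span E'" by (rule span_add)
        then show ?thesis using False by (simp add: r_def)
      qed
      ultimately show ?thesis using E(2) by blast
    qed
  qed
  then show ?thesis using that by blast
qed

text \<open>Balls of the whole space need not be compact, so compactness is built up by adding one
  segment at a time.\<close>

lemma compact_finite_span_ball:
  fixes E :: "'k::real_inner set"
  assumes "finite E"
  shows "compact {\<Sum>e\<in>E. c e *\<^sub>R e | c. \<forall>e\<in>E. \<bar>c e\<bar> \<le> (R::real)}"
  using assms
proof (induction E)
  case empty
  then show ?case by simp
next
  case (insert d E)
  let ?S = "{\<Sum>e\<in>E. c e *\<^sub>R e | c. \<forall>e\<in>E. \<bar>c e\<bar> \<le> R}" and ?T = "(\<lambda>t. t *\<^sub>R d) ` {- R..R}"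
  have "{\<Sum>e\<in>insert d E. c e *\<^sub>R e | c. \<forall>e\<in>insert d E. \<bar>c e\<bar> \<le> R} = {y + x | y x. y \<in> ?T \<and> x \<in> ?S}" (is "?L = ?M")
  proof
    show "?L \<subseteq> ?M"
    proof
      fix z assume "z \<in> ?L"
      then obtain c where c: "z = (\<Sum>e\<in>insert d E. c e *\<^sub>R e)" "\<forall>e\<in>insert d E. \<bar>c e\<bar> \<le> R" by blast
      then have "z = c d *\<^sub>R d + (\<Sum>e\<in>E. c e *\<^sub>R e)" using insert.hyps by simp
      moreover have "c d *\<^sub>R d \<in> ?T" using c(2) by (auto simp: abs_le_iff)
      moreover have "(\<Sum>e\<in>E. c e *\<^sub>R e) \<in> ?S" using c(2) by blast
      ultimately show "z \<in> ?M" by blast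
    qed
    show "?M \<subseteq> ?L"
    proof
      fix z assume "z \<in> ?M"
      then obtain t c where t: "t \<in> {- R..R}" and c: "\<forall>e\<in>E. \<bar>c e\<bar> \<le> R" and z: "z = t *\<^sub>R d + (\<Sum>e\<in>E. c e *\<^sub>R e)" by blast
      define c' where "c' = c(d := t)"
      have "z = (\<Sum>e\<in>insert d E. c' e *\<^sub>R e)"
        unfolding z using insert.hyps by (simp add: c'_def) (intro sum.cong, auto)
      moreover have "\<forall>e\<in>insert d E. \<bar>c' e\<bar> \<le> R" using t c by (auto simp: c'_def abs_le_iff)
      ultimately show "z \<in> ?L" by blast
    qed
  qed
  moreover have "compact ?T" by (intro compact_continuous_image continuous_intros) auto
  ultimately show ?case using compact_sums[OF _ insert.IH] by simp
qed

section \<open>Computations with coin averages\<close>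

lemma coin_iter_add: "coin_iter v m (\<lambda>x. f x + g x) x = coin_iter v m f x + coin_iter v m g x"
  by (induction m arbitrary: x) (simp_all add: coin_step_def add_divide_distrib)

lemma coin_iter_cmult: "coin_iter v m (\<lambda>x. c * f x) x = c * coin_iter v m f x"
  by (induction m arbitrary: x) (simp_all add: coin_step_def distrib_left)

lemma coin_iter_const: "coin_iter v m (\<lambda>x. c) x = c"
  by (induction m arbitrary: x) (simp_all add: coin_step_def)

text \<open>The bound may vary with the point, so quadratic bounds can be inserted and then
  evaluated by \<open>coin_iter_norm_sq\<close>.\<close>

lemma coin_iter_abs_le:
  assumes "\<And>x. \<bar>f x - g x\<bar> \<le> b x"
  shows "\<bar>coin_iter v m f x - coin_iter v m g x\<bar> \<le> coin_iter v m b x"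
proof (induction m arbitrary: x)
  case (Suc m)
  have eq: "coin_iter v (Suc m) f x - coin_iter v (Suc m) g x = ((coin_iter v m f (x + v m) - coin_iter v m g (x + v m)) + (coin_iter v m f (x - v m) - coin_iter v m g (x - v m))) / 2"
    by (simp add: coin_step_def add_divide_distrib diff_divide_distrib)
  have "\<bar>coin_iter v (Suc m) f x - coin_iter v (Suc m) g x\<bar> \<le> (\<bar>coin_iter v m f (x + v m) - coin_iter v m g (x + v m)\<bar> + \<bar>coin_iter v m f (x - v m) - coin_iter v m g (x - v m)\<bar>) / 2"
    unfolding eq by simp
  also have "\<dots> \<le> coin_iter v (Suc m) b x"
    using add_mono[OF Suc[of "x + v m"] Suc[of "x - v m"]] by (simp add: coin_step_def divide_right_mono)
  finally show ?case .
qed (simp add: assms)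

text \<open>The parallelogram law removes the cross terms at each step.\<close>

lemma coin_iter_norm_sq:
  fixes T :: "'k::real_inner \<Rightarrow> 'l::real_inner"
  assumes T: "linear T"
  shows "coin_iter v m (\<lambda>x. (norm (T x))\<^sup>2) x = (norm (T x))\<^sup>2 + (\<Sum>i<m. (norm (T (v i)))\<^sup>2)"
proof (induction m arbitrary: x)
  case (Suc m)
  have "((norm (T (x + v m)))\<^sup>2 + (norm (T (x - v m)))\<^sup>2) / 2 = (norm (T x))\<^sup>2 + (norm (T (v m)))\<^sup>2"
    unfolding linear_add[OF T] linear_diff[OF T] power2_norm_eq_inner
      inner_add_left inner_add_right inner_diff_left inner_diff_right
    by (simp add: inner_commute[of "T (v m)" "T x"])
  then show ?case by (simp add: coin_step_def Suc add_divide_distrib)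
qed simp

text \<open>Averaging over the sign of \<open>v\<close> multiplies a cosine wave by the factor
  \<open>cos (u \<bullet> v)\<close>, by the addition theorem.\<close>

lemma coin_iter_cos: "coin_iter v m (\<lambda>x. cos (u \<bullet> x + \<theta>)) x = (\<Prod>i<m. cos (u \<bullet> v i)) * cos (u \<bullet> x + \<theta>)"
proof (induction m arbitrary: x)
  case (Suc m)
  have "(cos (u \<bullet> (x + v m) + \<theta>) + cos (u \<bullet> (x - v m) + \<theta>)) / 2 = cos (u \<bullet> v m) * cos (u \<bullet> x + \<theta>)"
  proof -
    have "u \<bullet> (x + v m) + \<theta> = (u \<bullet> x + \<theta>) + u \<bullet> v m" "u \<bullet> (x - v m) + \<theta> = (u \<bullet> x + \<theta>) - u \<bullet> v m"
      by (simp_all add: inner_add_right inner_diff_right)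
    then show ?thesis by (simp only: cos_add cos_diff) (simp add: field_simps)
  qed
  then have "(\<Prod>i<m. cos (u \<bullet> v i)) * ((cos (u \<bullet> (x + v m) + \<theta>) + cos (u \<bullet> (x - v m) + \<theta>)) / 2) = (\<Prod>i<Suc m. cos (u \<bullet> v i)) * cos (u \<bullet> x + \<theta>)"
    by (simp add: mult.commute mult.left_commute)
  then show ?case by (simp add: coin_step_def Suc distrib_left add_divide_distrib)
qed simp

lemma (in finite_measure) integrable_of_square_norm:
  fixes X :: "'a \<Rightarrow> 'b::{real_inner, banach, second_countable_topology}"
  assumes [measurable]: "X \<in> borel_measurable M" and sq: "integrable M (\<lambda>\<omega>. (norm (X \<omega>))\<^sup>2)"
  shows "integrable M X"
proof (rule Bochner_Integration.integrable_bound)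
  show "integrable M (\<lambda>\<omega>. 1 + (norm (X \<omega>))\<^sup>2)" using sq by simp
  have "norm x \<le> 1 + (norm x)\<^sup>2" for x :: 'b
    using zero_le_power2[of "norm x - 1/2"] by (simp add: power2_eq_square algebra_simps)
  then show "AE \<omega> in M. norm (X \<omega>) \<le> norm (1 + (norm (X \<omega>))\<^sup>2)" by (intro AE_I2) auto
qed measurable

text \<open>By \<open>tight\<close>, \<open>f\<close> may be replaced by its composition with a
  finite-dimensional projection on both sides. There a trigonometric polynomial \<open>G\<close>
  approximates it on a compact set, the bounded second moments control the rest, and
  \<open>char\<close> settles the convergence for \<open>G\<close>.\<close>

lemma coin_iter_tendsto:
  fixes v :: "nat \<Rightarrow> nat \<Rightarrow> 'k::{real_inner, banach, second_countable_topology}"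
  assumes P: "prob_space P" and Zm: "Z \<in> borel_measurable P" and Z2: "integrable P (\<lambda>\<omega>. (norm (Z \<omega>))\<^sup>2)"
    and char: "\<And>u \<theta>. (\<lambda>n. coin_iter (v n) n (\<lambda>x. cos (u \<bullet> x + \<theta>)) 0) \<longlonglongrightarrow> (\<integral>\<omega>. cos (u \<bullet> Z \<omega> + \<theta>) \<partial>P)"
    and sq: "\<And>n. coin_iter (v n) n (\<lambda>x. (norm x)\<^sup>2) 0 \<le> c"
    and tight: "\<And>\<epsilon>. 0 < \<epsilon> \<Longrightarrow> \<exists>E. finite_orthonormal E \<and>
       (\<forall>n. coin_iter (v n) n (\<lambda>x. (norm (x - proj E x))\<^sup>2) 0 \<le> \<epsilon>\<^sup>2) \<and> (\<integral>\<omega>. norm (Z \<omega> - proj E (Z \<omega>)) \<partial>P) \<le> \<epsilon>"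
    and f: "1-lipschitz_on UNIV f"
  shows "(\<lambda>n. coin_iter (v n) n f 0) \<longlonglongrightarrow> (\<integral>\<omega>. f (Z \<omega>) \<partial>P)"
proof (rule LIMSEQ_I)
  interpret prob_space P by fact
  note [measurable] = Zm
  have lip: "\<bar>f x - f y\<bar> \<le> norm (x - y)" for x y using lipschitz_abs_diff[OF f, of x y] by simp
  have fc: "continuous_on S f" for S using lipschitz_on_continuous_on[OF f] continuous_on_subset by blast
  have fm [measurable]: "f \<in> borel_measurable borel" using fc by (rule borel_measurable_continuous_onI)
  have Z1: "integrable P (\<lambda>\<omega>. norm (Z \<omega>))"
    by (rule integrable_norm[OF integrable_of_square_norm[OF Zm Z2]])
  define m2 where "m2 = (\<integral>\<omega>. (norm (Z \<omega>))\<^sup>2 \<partial>P)"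
  fix r :: real assume r: "0 < r"
  \<comment> \<open>Projection costs \<open>\<epsilon>\<close> and the exchange of \<open>f\<close>
    for \<open>G\<close> costs \<open>2 * \<epsilon>\<close>, on each side; with
    \<open>\<epsilon>\<close> for the limit this makes 7, hence the divisor 8.\<close>
  define \<epsilon> where "\<epsilon> = r / 8"
  have \<epsilon>: "0 < \<epsilon>" using r by (simp add: \<epsilon>_def)
  obtain E where E: "finite_orthonormal E" and E1: "\<And>n. coin_iter (v n) n (\<lambda>x. (norm (x - proj E x))\<^sup>2) 0 \<le> \<epsilon>\<^sup>2"
    and E2: "(\<integral>\<omega>. norm (Z \<omega> - proj E (Z \<omega>)) \<partial>P) \<le> \<epsilon>" using tight[OF \<epsilon>] by blast
  have projm [measurable]: "proj E \<in> borel_measurable borel"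
    by (rule borel_measurable_continuous_onI[OF continuous_on_proj])
  \<comment> \<open>For \<open>norm y > R \<ge> 1\<close> the sum of \<open>\<bar>f y\<bar>\<close>
    and \<open>\<bar>G y\<bar>\<close> is at most
    \<open>norm y + 2 * \<bar>f 0\<bar> + R + 1\<close>, hence at most
    \<open>C * norm y\<close>.\<close>
  define C where "C = 2 * \<bar>f 0\<bar> + 3"
  have C: "0 < C" by (simp add: C_def)
  \<comment> \<open>The radius makes \<open>C / R\<close> times the second moment at most
    \<open>\<epsilon>\<close>, for the coin sums and for \<open>Z\<close> alike; the summand 1
    ensures \<open>R \<ge> 1\<close>.\<close>
  define R where "R = 1 + C * (\<bar>c\<bar> + m2) / \<epsilon>"
  have m20: "0 \<le> m2" by (simp add: m2_def)
  have R1: "1 \<le> R" using C \<epsilon> m20 by (simp add: R_def)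
  have Rb: "C * a / R \<le> \<epsilon>" if "a \<le> \<bar>c\<bar> + m2" for a
  proof -
    have "C * a \<le> C * (\<bar>c\<bar> + m2)" using C that by (intro mult_left_mono) auto
    also have "\<dots> \<le> \<epsilon> * R" using \<epsilon> by (simp add: R_def field_simps)
    finally show ?thesis using R1 by (simp add: pos_divide_le_eq mult.commute)
  qed
  \<comment> \<open>The coefficient box provides compactness, the ball the bound on \<open>f\<close>
    that enters the bound on \<open>G\<close>.\<close>
  define S where "S = {\<Sum>e\<in>E. c e *\<^sub>R e | c. \<forall>e\<in>E. \<bar>c e\<bar> \<le> R} \<inter> cball 0 R"
  have S: "compact S" unfolding S_def using E by (intro compact_Int_closed compact_finite_span_ball) (auto simp: finite_orthonormal_def)
  have SA: "\<bar>f x\<bar> \<le> \<bar>f 0\<bar> + R" if "x \<in> S" for x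
    using lip[of x 0] that by (auto simp: S_def)
  obtain G where G: "trig_poly G" "\<And>x. x \<in> S \<Longrightarrow> \<bar>f x - G x\<bar> \<le> \<epsilon>" "\<And>x. \<bar>G x\<bar> \<le> (\<bar>f 0\<bar> + R) + 1"
    using trig_poly_approximation[OF S fc SA _ \<epsilon>] R1 by auto
  have Gm [measurable]: "G \<in> borel_measurable borel"
    using trig_poly_continuous[OF G(1)] by (rule borel_measurable_continuous_onI)
  \<comment> \<open>Outside the ball of radius \<open>R\<close>, linear growth is absorbed into a
    quadratic term with the small factor \<open>C / R\<close>, whose average is known.\<close>
  have fG: "\<bar>f (proj E x) - G (proj E x)\<bar> \<le> \<epsilon> + C / R * (norm x)\<^sup>2" for x
  proof (cases "norm (proj E x) \<le> R")
    case True
    have "\<bar>e \<bullet> x\<bar> \<le> R" if "e \<in> E" for e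
    proof -
      have "\<bar>e \<bullet> x\<bar> = \<bar>e \<bullet> proj E x\<bar>" using inner_orthonormal_proj[OF E that] by simp
      also have "\<dots> \<le> norm e * norm (proj E x)" by (rule Cauchy_Schwarz_ineq2)
      also have "\<dots> \<le> R" using E that True by (simp add: finite_orthonormal_def)
      finally show ?thesis .
    qed
    then have "proj E x \<in> S" using True unfolding S_def proj_def by auto
    from G(2)[OF this] show ?thesis using C R1 by (intro order_trans[OF _ add_increasing2]) auto
  next
    case False
    let ?y = "proj E x"
    have y: "R < norm ?y" using False by simp
    have "\<bar>f ?y - G ?y\<bar> \<le> \<bar>f ?y - f 0\<bar> + \<bar>f 0\<bar> + \<bar>G ?y\<bar>" by linarith
    also have "\<dots> \<le> norm ?y + \<bar>f 0\<bar> + (\<bar>f 0\<bar> + R + 1)" using lip[of ?y 0] G(3)[of ?y] by simp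
    also have "\<dots> \<le> C * norm ?y"
    proof -
      have "\<bar>f 0\<bar> \<le> \<bar>f 0\<bar> * norm ?y" using y R1 mult_left_mono[of 1 "norm ?y" "\<bar>f 0\<bar>"] by simp
      then show ?thesis using y R1 unfolding C_def by (simp add: algebra_simps)
    qed
    also have "\<dots> \<le> C / R * (norm ?y)\<^sup>2"
    proof -
      have "R * norm ?y \<le> norm ?y * norm ?y" using y by (intro mult_right_mono) auto
      then have "C * (R * norm ?y) \<le> C * (norm ?y * norm ?y)" using C by (intro mult_left_mono) auto
      then show ?thesis using R1 by (simp add: pos_le_divide_eq power2_eq_square mult_ac)
    qed
    also have "\<dots> \<le> C / R * (norm x)\<^sup>2"
      using C R1 norm_proj_le[OF E] by (intro mult_left_mono power_mono) auto
    finally show ?thesis using \<epsilon> by simp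
  qed
  \<comment> \<open>The projection is self-adjoint, so a wave composed with it is again a wave, with
    frequency \<open>proj E u\<close>.\<close>
  have tp: "(\<lambda>n. coin_iter (v n) n (\<lambda>x. g (proj E x)) 0) \<longlonglongrightarrow> (\<integral>\<omega>. g (proj E (Z \<omega>)) \<partial>P) \<and> integrable P (\<lambda>\<omega>. g (proj E (Z \<omega>)))"
    if "trig_poly g" for g using that
  proof (induction rule: trig_poly.induct)
    case (cosine a u \<theta>)
    have "integrable P (\<lambda>\<omega>. a * cos (proj E u \<bullet> Z \<omega> + \<theta>))"
      by (intro integrable_mult_right integrable_const_bound[where B = 1]) auto
    then show ?case
      using tendsto_mult_left[OF char[of "proj E u" \<theta>], of a]
      by (simp add: inner_proj_commute coin_iter_cmult)
  next
    case (add g h)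
    then show ?case by (auto simp: coin_iter_add intro!: tendsto_add)
  qed
  then have "(\<lambda>n. coin_iter (v n) n (\<lambda>x. G (proj E x)) 0) \<longlonglongrightarrow> (\<integral>\<omega>. G (proj E (Z \<omega>)) \<partial>P)" and Gi: "integrable P (\<lambda>\<omega>. G (proj E (Z \<omega>)))"
    using G(1) by blast+
  then obtain n0 where n0: "\<And>n. n \<ge> n0 \<Longrightarrow> norm (coin_iter (v n) n (\<lambda>x. G (proj E x)) 0 - (\<integral>\<omega>. G (proj E (Z \<omega>)) \<partial>P)) < \<epsilon>"
    using LIMSEQ_D \<epsilon> by blast
  have B1: "\<bar>coin_iter (v n) n f 0 - coin_iter (v n) n (\<lambda>x. f (proj E x)) 0\<bar> \<le> \<epsilon>" for n
  proof -
    \<comment> \<open>The arithmetic-geometric inequality trades the distance for its square, whose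
      coin average is bounded by \<open>E1\<close>.\<close>
    have "\<bar>f x - f (proj E x)\<bar> \<le> \<epsilon> / 2 + 1 / (2 * \<epsilon>) * (norm (x - proj E x))\<^sup>2" for x
    proof -
      let ?d = "norm (x - proj E x)"
      have "0 \<le> (?d - \<epsilon>)\<^sup>2" by simp
      then have "2 * \<epsilon> * ?d \<le> \<epsilon>\<^sup>2 + ?d\<^sup>2" by (simp add: power2_eq_square algebra_simps)
      then have "?d \<le> \<epsilon> / 2 + 1 / (2 * \<epsilon>) * ?d\<^sup>2" using \<epsilon> by (simp add: field_simps power2_eq_square)
      then show ?thesis using lip[of x "proj E x"] by linarith
    qed
    from coin_iter_abs_le[where v = "v n" and m = n and x = 0, OF this]
    have "\<bar>coin_iter (v n) n f 0 - coin_iter (v n) n (\<lambda>x. f (proj E x)) 0\<bar> \<le> \<epsilon> / 2 + 1 / (2 * \<epsilon>) * coin_iter (v n) n (\<lambda>x. (norm (x - proj E x))\<^sup>2) 0"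
      by (simp only: coin_iter_add coin_iter_cmult coin_iter_const)
    also have "\<dots> \<le> \<epsilon> / 2 + 1 / (2 * \<epsilon>) * \<epsilon>\<^sup>2" using E1[of n] \<epsilon> by (intro add_left_mono mult_left_mono) auto
    also have "\<dots> = \<epsilon>" using \<epsilon> by (simp add: power2_eq_square)
    finally show ?thesis .
  qed
  have B2: "\<bar>coin_iter (v n) n (\<lambda>x. f (proj E x)) 0 - coin_iter (v n) n (\<lambda>x. G (proj E x)) 0\<bar> \<le> 2 * \<epsilon>" for n
  proof -
    from coin_iter_abs_le[where v = "v n" and m = n and x = 0, OF fG]
    have "\<bar>coin_iter (v n) n (\<lambda>x. f (proj E x)) 0 - coin_iter (v n) n (\<lambda>x. G (proj E x)) 0\<bar> \<le> \<epsilon> + C / R * coin_iter (v n) n (\<lambda>x. (norm x)\<^sup>2) 0"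
      by (simp only: coin_iter_add coin_iter_cmult coin_iter_const)
    also have "C / R * coin_iter (v n) n (\<lambda>x. (norm x)\<^sup>2) 0 \<le> \<epsilon>"
      using Rb[of "coin_iter (v n) n (\<lambda>x. (norm x)\<^sup>2) 0"] sq[of n] m20 by simp
    finally show ?thesis by simp
  qed
  have fb: "\<bar>f x\<bar> \<le> \<bar>f 0\<bar> + norm x" for x using lip[of x 0] by simp
  have fi: "integrable P (\<lambda>\<omega>. f (Z \<omega>))"
    by (rule Bochner_Integration.integrable_bound[where f = "\<lambda>\<omega>. \<bar>f 0\<bar> + norm (Z \<omega>)"]) (use Z1 fb in \<open>auto intro!: AE_I2\<close>)
  have fpi: "integrable P (\<lambda>\<omega>. f (proj E (Z \<omega>)))"
    by (rule Bochner_Integration.integrable_bound[where f = "\<lambda>\<omega>. \<bar>f 0\<bar> + norm (Z \<omega>)"])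
      (use Z1 order_trans[OF fb add_left_mono[OF norm_proj_le[OF E]]] in \<open>auto intro!: AE_I2\<close>)
  have pzi: "integrable P (\<lambda>\<omega>. norm (Z \<omega> - proj E (Z \<omega>)))"
    by (rule Bochner_Integration.integrable_bound[where f = "\<lambda>\<omega>. norm (Z \<omega>)"])
      (use Z1 norm_proj_residual_le[OF E span_zero] in \<open>auto intro!: AE_I2\<close>)
  have I1: "\<bar>(\<integral>\<omega>. f (Z \<omega>) \<partial>P) - (\<integral>\<omega>. f (proj E (Z \<omega>)) \<partial>P)\<bar> \<le> \<epsilon>"
  proof -
    have "(\<integral>\<omega>. f (Z \<omega>) \<partial>P) - (\<integral>\<omega>. f (proj E (Z \<omega>)) \<partial>P) = (\<integral>\<omega>. f (Z \<omega>) - f (proj E (Z \<omega>)) \<partial>P)" using fi fpi by simp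
    also have "\<bar>\<dots>\<bar> \<le> (\<integral>\<omega>. norm (Z \<omega> - proj E (Z \<omega>)) \<partial>P)"
      by (rule order_trans[OF integral_abs_bound integral_mono]) (use fi fpi pzi lip in auto)
    finally show ?thesis using E2 by linarith
  qed
  have I2: "\<bar>(\<integral>\<omega>. f (proj E (Z \<omega>)) \<partial>P) - (\<integral>\<omega>. G (proj E (Z \<omega>)) \<partial>P)\<bar> \<le> 2 * \<epsilon>"
  proof -
    have "(\<integral>\<omega>. f (proj E (Z \<omega>)) \<partial>P) - (\<integral>\<omega>. G (proj E (Z \<omega>)) \<partial>P) = (\<integral>\<omega>. f (proj E (Z \<omega>)) - G (proj E (Z \<omega>)) \<partial>P)" using Gi fpi by simp
    also have "\<bar>\<dots>\<bar> \<le> (\<integral>\<omega>. \<epsilon> + C / R * (norm (Z \<omega>))\<^sup>2 \<partial>P)"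
      by (rule order_trans[OF integral_abs_bound integral_mono]) (use Gi fpi Z2 fG in auto)
    also have "\<dots> = \<epsilon> + C / R * m2" using Z2 by (simp add: m2_def prob_space)
    also have "C / R * m2 \<le> \<epsilon>" using Rb[of m2] by simp
    finally show ?thesis by simp
  qed
  show "\<exists>no. \<forall>n\<ge>no. norm (coin_iter (v n) n f 0 - (\<integral>\<omega>. f (Z \<omega>) \<partial>P)) < r"
  proof (intro exI[of _ n0] allI impI)
    fix n assume "n0 \<le> n"
    from n0[OF this] have "\<bar>coin_iter (v n) n (\<lambda>x. G (proj E x)) 0 - (\<integral>\<omega>. G (proj E (Z \<omega>)) \<partial>P)\<bar> < \<epsilon>" by simp
    then have "\<bar>coin_iter (v n) n f 0 - (\<integral>\<omega>. f (Z \<omega>) \<partial>P)\<bar> < 8 * \<epsilon>"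
      using B1[of n] B2[of n] I1 I2 \<epsilon> by linarith
    then show "norm (coin_iter (v n) n f 0 - (\<integral>\<omega>. f (Z \<omega>) \<partial>P)) < r" by (simp add: \<epsilon>_def)
  qed
qed

section \<open>Gaussian characteristic functions and cosine products\<close>

text \<open>In the degenerate case mean 0 forces a point mass at 0 and \<open>s = 0\<close>.
  Otherwise the law is rescaled to the standard normal one, whose characteristic function has the
  needed cosine and sine integrals as real and imaginary parts.\<close>

lemma gaussian_law_cos:
  assumes g: "gaussian_law \<mu>" and m1: "(\<integral>x. x \<partial>\<mu>) = 0" and m2: "(\<integral>x. x\<^sup>2 \<partial>\<mu>) = s"
  shows "(\<integral>x. cos (x + \<theta>) \<partial>\<mu>) = exp (- s / 2) * cos \<theta>"
  using g unfolding gaussian_law_def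
proof (elim disjE exE conjE)
  fix m assume \<mu>: "\<mu> = return borel m"
  have "m = 0" using m1 unfolding \<mu> by (subst (asm) integral_return) auto
  moreover have "s = m\<^sup>2" using m2 unfolding \<mu> by (subst (asm) integral_return) auto
  ultimately show ?thesis unfolding \<mu> by (subst integral_return) auto
next
  fix m \<sigma> :: real assume \<sigma>: "0 < \<sigma>" and \<mu>: "\<mu> = density lborel (\<lambda>x. ennreal (normal_density m \<sigma> x))"
  have dens: "(\<integral>x. h x \<partial>\<mu>) = (\<integral>x. normal_density m \<sigma> x * h x \<partial>lborel)" if "h \<in> borel_measurable borel" for h :: "real \<Rightarrow> real"
    unfolding \<mu> using that by (subst integral_density) auto
  have m0: "m = 0" using m1 integral_normal_moment_nz_1[OF \<sigma>, of m] by (simp add: dens)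
  have s: "s = \<sigma>\<^sup>2"
    using m2 integral_normal_moment_even[OF \<sigma>, of 0 1] by (simp add: dens m0)
  interpret N: real_distribution std_normal_distribution by (rule real_dist_normal_dist)
  have ci: "integrable std_normal_distribution (\<lambda>x. iexp (\<sigma> * x))" by (rule N.integrable_iexp) auto
  have ch: "(\<integral>x. iexp (\<sigma> * x) \<partial>std_normal_distribution) = complex_of_real (exp (- (\<sigma>\<^sup>2) / 2))"
    using char_std_normal_distribution unfolding char_def by metis
  have c: "(\<integral>x. cos (\<sigma> * x) \<partial>std_normal_distribution) = exp (- (\<sigma>\<^sup>2) / 2)"
    using integral_Re[OF ci] unfolding ch by (simp add: Re_exp)
  have si: "(\<integral>x. sin (\<sigma> * x) \<partial>std_normal_distribution) = 0"
    using integral_Im[OF ci] unfolding ch by (simp add: Im_exp)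
  have i: "integrable std_normal_distribution (\<lambda>x. cos (\<sigma> * x))" "integrable std_normal_distribution (\<lambda>x. sin (\<sigma> * x))"
    by (rule N.integrable_const_bound[where B = 1]; simp)+
  have "(\<integral>x. cos (x + \<theta>) \<partial>\<mu>) = (\<integral>x. normal_density 0 \<sigma> x * cos (x + \<theta>) \<partial>lborel)"
    by (subst dens) (simp_all add: m0)
  also have "\<dots> = \<bar>\<sigma>\<bar> *\<^sub>R (\<integral>x. normal_density 0 \<sigma> (0 + \<sigma> * x) * cos (0 + \<sigma> * x + \<theta>) \<partial>lborel)"
    using \<sigma> by (intro lborel_integral_real_affine) simp
  also have "\<dots> = (\<integral>x. \<bar>\<sigma>\<bar> * (normal_density 0 \<sigma> (0 + \<sigma> * x) * cos (0 + \<sigma> * x + \<theta>)) \<partial>lborel)" by simp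
  also have "\<dots> = (\<integral>x. std_normal_density x * cos (\<sigma> * x + \<theta>) \<partial>lborel)"
  proof (intro Bochner_Integration.integral_cong refl)
    fix x
    have "\<sigma> * normal_density 0 \<sigma> (\<sigma> * x) = std_normal_density x"
      using \<sigma> by (simp add: normal_density_def power_mult_distrib real_sqrt_mult)
    then show "\<bar>\<sigma>\<bar> * (normal_density 0 \<sigma> (0 + \<sigma> * x) * cos (0 + \<sigma> * x + \<theta>)) = std_normal_density x * cos (\<sigma> * x + \<theta>)"
      using \<sigma> by (simp add: mult.assoc[symmetric])
  qed
  also have "\<dots> = (\<integral>x. cos (\<sigma> * x + \<theta>) \<partial>std_normal_distribution)"
    by (subst integral_density) auto
  also have "\<dots> = (\<integral>x. cos (\<sigma> * x) * cos \<theta> - sin (\<sigma> * x) * sin \<theta> \<partial>std_normal_distribution)"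
    by (simp only: cos_add)
  also have "\<dots> = exp (- (\<sigma>\<^sup>2) / 2) * cos \<theta>"
    using i by (simp add: c si)
  finally show ?thesis by (simp add: s)
qed

text \<open>Both functions equal \<open>1 - y\<^sup>2 / 2\<close> up to errors
  \<open>y ^ 4 / 24\<close> and \<open>y ^ 4 / 8\<close>.\<close>

lemma cos_exp_diff_le: "\<bar>cos y - exp (- y\<^sup>2 / 2)\<bar> \<le> y ^ 4" for y :: real
proof -
  obtain t where "cos y = (\<Sum>m<4. cos_coeff m * y ^ m) + (cos (t + 1/2 * real 4 * pi) / fact 4) * y ^ 4"
    using Maclaurin_cos_expansion[of y 4] by auto
  moreover have "(\<Sum>m<4. cos_coeff m * y ^ m) = 1 - y\<^sup>2 / 2"
  proof -
    have "{..<4::nat} = {0, 1, 2, 3}" by auto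
    then show ?thesis by (simp add: cos_coeff_def)
  qed
  moreover have "\<bar>(cos (t + 1/2 * real 4 * pi) / fact 4) * y ^ 4\<bar> \<le> 1 / 24 * y ^ 4"
  proof -
    have "\<bar>cos (t + 1/2 * real 4 * pi)\<bar> * y ^ 4 \<le> 1 * y ^ 4" by (intro mult_right_mono) auto
    then show ?thesis by (simp add: abs_mult fact_numeral)
  qed
  ultimately have 1: "\<bar>cos y - (1 - y\<^sup>2 / 2)\<bar> \<le> 1 / 24 * y ^ 4" by simp
  have 2: "\<bar>exp (- a) - (1 - a)\<bar> \<le> a\<^sup>2 / 2" if "0 \<le> a" for a :: real
  proof (cases "a = 0")
    case False
    then have "- a < 0" using that by simp
    then obtain t where t: "t < 0" "exp (- a) = (\<Sum>m<2. exp 0 / fact m * (- a) ^ m) + exp t / fact 2 * (- a) ^ 2"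
      using Maclaurin_minus[of "- a" 2 "\<lambda>_. exp" exp] by (auto intro!: derivative_eq_intros)
    have "exp t * a\<^sup>2 \<le> 1 * a\<^sup>2" using t(1) by (intro mult_right_mono) auto
    then show ?thesis unfolding t(2) by (simp add: numeral_2_eq_2 abs_mult)
  qed simp
  have "\<bar>exp (- (y\<^sup>2 / 2)) - (1 - y\<^sup>2 / 2)\<bar> \<le> (y\<^sup>2 / 2)\<^sup>2 / 2" by (rule 2) simp
  also have "\<dots> = 1 / 8 * y ^ 4" by (simp add: power_divide power_mult[symmetric])
  finally have "\<bar>cos y - exp (- (y\<^sup>2 / 2))\<bar> \<le> 1 / 24 * y ^ 4 + 1 / 8 * y ^ 4" using 1 by linarith
  moreover have "0 \<le> y ^ 4" by simp
  moreover have "- y\<^sup>2 / 2 = - (y\<^sup>2 / 2)" by simp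
  ultimately show ?thesis by (simp only:)
qed

text \<open>\<open>E m\<close> spans the first m members of a dense sequence. The spans need not be
  nested: each member of the sequence lies in all but finitely many of them, and best approximation
  does the rest.\<close>

lemma dense_projections:
  obtains E :: "nat \<Rightarrow> 'k::{real_inner, second_countable_topology} set"
  where "\<And>m. finite_orthonormal (E m)" "\<And>x. (\<lambda>m. x - proj (E m) x) \<longlonglongrightarrow> 0"
proof -
  obtain D :: "'k set" where D: "countable D" "\<And>X. open X \<Longrightarrow> X \<noteq> {} \<Longrightarrow> \<exists>d\<in>D. d \<in> X"
    by (rule countable_dense_setE) blast
  have "D \<noteq> {}" using D(2)[of UNIV] by auto
  define d where "d = from_nat_into D"
  have rd: "range d = D" unfolding d_def using D(1) \<open>D \<noteq> {}\<close> by (rule range_from_nat_into[rotated])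
  have "\<forall>m. \<exists>E. finite_orthonormal E \<and> d ` {..<m} \<subseteq> span E"
    using gram_schmidt by (metis finite_imageI finite_lessThan)
  then obtain E where E: "\<And>m. finite_orthonormal (E m)" "\<And>m. d ` {..<m} \<subseteq> span (E m)" by metis
  have "(\<lambda>m. x - proj (E m) x) \<longlonglongrightarrow> 0" for x
  proof (rule LIMSEQ_I)
    fix r :: real assume r: "0 < r"
    obtain y where y: "y \<in> D" "y \<in> ball x r" using D(2)[of "ball x r"] r by auto
    then obtain k where k: "y = d k" using rd by auto
    show "\<exists>no. \<forall>m\<ge>no. norm (x - proj (E m) x - 0) < r"
    proof (intro exI[of _ "Suc k"] allI impI)
      fix m assume "Suc k \<le> m"
      then have "y \<in> span (E m)" using E(2)[of m] k by auto
      from norm_proj_residual_le[OF E(1) this, of x] show "norm (x - proj (E m) x - 0) < r"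
        using y(2) by (simp add: dist_norm)
    qed
  qed
  with E(1) show ?thesis using that by blast
qed

section \<open>Rademacher sums along the path of step functions\<close>

context besov_liouville_model
begin

definition coin_vec :: "nat \<Rightarrow> nat \<Rightarrow> 'k" where
  "coin_vec n i = jump (grid n i) /\<^sub>R sqrt (real n)"

lemma grid_in_unit: "i < n \<Longrightarrow> 0 \<le> grid n i \<and> grid n i \<le> 1"
  by simp

text \<open>The second moment is the average of the squared norms of \<open>T\<close> over the grid,
  hence bounded independently of n. It serves for the identity and for the residual of a
  projection.\<close>

lemma coin_iter_residual_sq_le:
  fixes T :: "'k \<Rightarrow> 'k"
  assumes T: "linear T" and b: "\<And>t. t \<in> {0..1} \<Longrightarrow> norm (T (jump t)) \<le> b"
  shows "coin_iter (coin_vec n) n (\<lambda>x. (norm (T x))\<^sup>2) 0 \<le> b\<^sup>2"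
proof -
  have "coin_iter (coin_vec n) n (\<lambda>x. (norm (T x))\<^sup>2) 0 = (\<Sum>i<n. (norm (T (coin_vec n i)))\<^sup>2)"
    using coin_iter_norm_sq[OF T, of "coin_vec n" n 0] linear_0[OF T] by simp
  also have "\<dots> \<le> (\<Sum>i<n. b\<^sup>2 / real n)"
  proof (rule sum_mono)
    fix i assume i: "i \<in> {..<n}"
    have "(norm (T (coin_vec n i)))\<^sup>2 = (norm (T (jump (grid n i))))\<^sup>2 / real n"
      unfolding coin_vec_def linear_scale[OF T] by (simp add: power_mult_distrib power_inverse divide_inverse mult.commute)
    also have "\<dots> \<le> b\<^sup>2 / real n"
    proof (intro divide_right_mono power_mono)
      show "norm (T (jump (grid n i))) \<le> b" using i grid_in_unit[of i n] by (intro b) auto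
    qed auto
    finally show "(norm (T (coin_vec n i)))\<^sup>2 \<le> b\<^sup>2 / real n" .
  qed
  also have "\<dots> \<le> b\<^sup>2" by simp
  finally show ?thesis .
qed

text \<open>Pointwise convergence becomes uniform because the path is compact: finitely many grid
  points approximate it within half of \<open>\<epsilon>\<close>.\<close>

lemma jump_residual_uniform:
  assumes E: "\<And>m. finite_orthonormal (E m)" and lim: "\<And>x. (\<lambda>m. x - proj (E m) x) \<longlonglongrightarrow> (0::'k)" and \<epsilon>: "0 < \<epsilon>"
  shows "\<forall>\<^sub>F m in sequentially. \<forall>t\<in>{0..1}. norm (jump t - proj (E m) (jump t)) \<le> \<epsilon>"
proof -
  have "\<forall>\<^sub>F n in sequentially. modulus n < \<epsilon> / 2" using modulus_tendsto_0 by (rule order_tendstoD) (use \<epsilon> in simp)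
  then have "\<forall>\<^sub>F n in sequentially. 0 < n \<and> modulus n < \<epsilon> / 2" using eventually_gt_at_top[of 0] by eventually_elim simp
  then obtain n where n: "0 < n" "modulus n < \<epsilon> / 2" by (auto simp: eventually_sequentially)
  have "\<forall>\<^sub>F m in sequentially. norm (jump (real i / real n) - proj (E m) (jump (real i / real n))) < \<epsilon> / 2" for i
    using tendstoD[OF lim, of "\<epsilon> / 2"] \<epsilon> by simp
  then have "\<forall>\<^sub>F m in sequentially. \<forall>i\<in>{..n}. norm (jump (real i / real n) - proj (E m) (jump (real i / real n))) < \<epsilon> / 2"
    by (intro eventually_ball_finite) auto
  then show ?thesis
  proof eventually_elim
    fix m assume m: "\<forall>i\<in>{..n}. norm (jump (real i / real n) - proj (E m) (jump (real i / real n))) < \<epsilon> / 2"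
    show "\<forall>t\<in>{0..1}. norm (jump t - proj (E m) (jump t)) \<le> \<epsilon>"
    proof
      fix t :: real assume t: "t \<in> {0..1}"
      define i where "i = nat \<lfloor>t * real n\<rfloor>"
      have i1: "real i \<le> t * real n" "t * real n < real i + 1" using t unfolding i_def by auto
      have "real i \<le> 1 * real n" using i1(1) t by (intro order_trans[OF i1(1)] mult_right_mono) auto
      then have "i \<le> n" by simp
      have "real i / real n \<le> t" "t < real i / real n + 1 / real n"
        using i1 n(1) by (simp_all add: field_simps)
      then have near: "\<bar>t - real i / real n\<bar> \<le> 1 / real n" by (simp add: abs_if)
      let ?j = "jump (real i / real n)"
      \<comment> \<open>Best approximation allows comparison with the projection of the nearby grid
        element, so the distance of the two elements is paid only once.\<close>
      have "norm (jump t - proj (E m) (jump t)) \<le> norm (jump t - proj (E m) ?j)"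
        by (rule norm_proj_residual_le[OF E proj_in_span])
      also have "\<dots> = norm ((jump t - ?j) + (?j - proj (E m) ?j))" by simp
      also have "\<dots> \<le> norm (jump t - ?j) + norm (?j - proj (E m) ?j)" by (rule norm_triangle_ineq)
      finally have "norm (jump t - proj (E m) (jump t)) \<le> norm (jump t - ?j) + norm (?j - proj (E m) ?j)" .
      moreover have "norm (jump t - ?j) \<le> modulus n"
        using t n(1) \<open>i \<le> n\<close> near by (intro norm_jump_diff_le_modulus) auto
      moreover have "norm (?j - proj (E m) ?j) < \<epsilon> / 2" using m \<open>i \<le> n\<close> by blast
      ultimately show "norm (jump t - proj (E m) (jump t)) \<le> \<epsilon>" using n(2) by linarith
    qed
  qed
qed

text \<open>The coin average is a product of cosines of
  \<open>(jump t \<bullet> u) / sqrt n\<close>. Replacing each factor by its Gaussian counterpart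
  costs \<open>K ^ 4 / n\<^sup>2\<close>, in total \<open>K ^ 4 / n\<close>, and the exponents add
  up to a Riemann sum of \<open>s\<close>.\<close>

lemma coin_char_limit:
  fixes u :: 'k
  defines "s \<equiv> (\<integral>t. indicator {0..1} t * (jump t \<bullet> u)\<^sup>2 \<partial>lborel)"
  shows "(\<lambda>n. coin_iter (coin_vec n) n (\<lambda>x. cos (u \<bullet> x + \<theta>)) 0) \<longlonglongrightarrow> exp (- s / 2) * cos \<theta>"
proof -
  let ?b = "\<lambda>t. jump t \<bullet> u"
  define K where "K = hoelder_const * norm u"
  have K0: "0 \<le> K" using hoelder_const_nonneg by (simp add: K_def)
  have bK: "\<bar>?b t\<bar> \<le> K" if "t \<in> {0..1}" for t
    unfolding K_def using that norm_jump_le[of t]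
    by (intro order_trans[OF Cauchy_Schwarz_ineq2] mult_right_mono) auto
  define S where "S n = (\<Sum>i<n. (?b (grid n i))\<^sup>2) / real n" for n
  have riemann: "\<bar>s - S n\<bar> \<le> (2 * K * norm u) * modulus n" if n: "0 < n" for n
    unfolding s_def S_def
  proof (rule riemann_sum_jump_error[OF n])
    show "continuous_on {0..1} (\<lambda>t. (?b t)\<^sup>2)" by (intro continuous_intros continuous_on_jump)
    show "\<bar>(?b r)\<^sup>2 - (?b t)\<^sup>2\<bar> \<le> 2 * K * norm u * norm (jump r - jump t)" if rt: "r \<in> {0..1}" "t \<in> {0..1}" for r t
    proof -
      have "\<bar>(?b r)\<^sup>2 - (?b t)\<^sup>2\<bar> = \<bar>?b r + ?b t\<bar> * \<bar>(jump r - jump t) \<bullet> u\<bar>"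
        unfolding abs_mult[symmetric] by (simp add: power2_eq_square inner_diff_left algebra_simps)
      also have "\<dots> \<le> (2 * K) * (norm (jump r - jump t) * norm u)"
        using bK[OF rt(1)] bK[OF rt(2)] by (intro mult_mono Cauchy_Schwarz_ineq2) (auto simp: K0)
      finally show ?thesis by (simp add: mult_ac)
    qed
  qed (simp add: K0)
  have "\<forall>\<^sub>F n in sequentially. norm (S n - s) \<le> (2 * K * norm u) * modulus n"
    using eventually_gt_at_top[of 0] by eventually_elim (use riemann in \<open>simp add: abs_minus_commute\<close>)
  moreover have "(\<lambda>n. (2 * K * norm u) * modulus n) \<longlonglongrightarrow> 0"
    using tendsto_mult_left[OF modulus_tendsto_0, of "2 * K * norm u"] by simp
  ultimately have "(\<lambda>n. S n - s) \<longlonglongrightarrow> 0" by (rule Lim_null_comparison)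
  then have "S \<longlonglongrightarrow> s" by (simp add: LIM_zero_iff)
  then have L1: "(\<lambda>n. exp (- S n / 2)) \<longlonglongrightarrow> exp (- s / 2)" by (intro tendsto_intros) auto
  have product: "\<bar>(\<Prod>i<n. cos (u \<bullet> coin_vec n i)) - exp (- S n / 2)\<bar> \<le> K ^ 4 / real n" if n: "0 < n" for n
  proof -
    let ?y = "\<lambda>i. u \<bullet> coin_vec n i"
    have y: "?y i = ?b (grid n i) / sqrt (real n)" for i
      by (simp add: coin_vec_def inner_commute divide_inverse mult.commute)
    have y2: "(?y i)\<^sup>2 = (?b (grid n i))\<^sup>2 / real n" for i
      unfolding y by (simp add: power_divide)
    have "- S n / 2 = (\<Sum>i<n. - (?y i)\<^sup>2 / 2)"
      by (simp add: S_def y2 sum_divide_distrib sum_negf)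
    then have "exp (- S n / 2) = (\<Prod>i<n. exp (- (?y i)\<^sup>2 / 2))" by (simp add: exp_sum)
    \<comment> \<open>All factors have modulus at most 1, so the products differ by at most the sum
      of the differences.\<close>
    then have "\<bar>(\<Prod>i<n. cos (?y i)) - exp (- S n / 2)\<bar> \<le> (\<Sum>i<n. \<bar>cos (?y i) - exp (- (?y i)\<^sup>2 / 2)\<bar>)"
      using norm_prod_diff[of "{..<n}" "\<lambda>i. cos (?y i)" "\<lambda>i. exp (- (?y i)\<^sup>2 / 2)"] by simp
    also have "\<dots> \<le> (\<Sum>i<n. K ^ 4 / (real n)\<^sup>2)"
    proof (rule sum_mono)
      fix i assume i: "i \<in> {..<n}"
      have "\<bar>cos (?y i) - exp (- (?y i)\<^sup>2 / 2)\<bar> \<le> (?y i) ^ 4" by (rule cos_exp_diff_le)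
      also have "\<dots> = \<bar>?b (grid n i)\<bar> ^ 4 / (real n)\<^sup>2"
      proof -
        have "(?y i) ^ 4 = ((?y i)\<^sup>2)\<^sup>2" by simp
        also have "\<dots> = ((?b (grid n i))\<^sup>2)\<^sup>2 / (real n)\<^sup>2" unfolding y2 by (simp add: power_divide)
        finally show ?thesis by simp
      qed
      also have "\<dots> \<le> K ^ 4 / (real n)\<^sup>2"
        using i grid_in_unit[of i n] by (intro divide_right_mono power_mono bK) auto
      finally show "\<bar>cos (?y i) - exp (- (?y i)\<^sup>2 / 2)\<bar> \<le> K ^ 4 / (real n)\<^sup>2" .
    qed
    also have "\<dots> = K ^ 4 / real n" using n by (simp add: power2_eq_square)
    finally show ?thesis .
  qed
  have "\<forall>\<^sub>F n in sequentially. norm ((\<Prod>i<n. cos (u \<bullet> coin_vec n i)) - exp (- S n / 2)) \<le> K ^ 4 * (1 / real n)"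
    using eventually_gt_at_top[of 0] by eventually_elim (use product in simp)
  moreover have "(\<lambda>n. K ^ 4 * (1 / real n)) \<longlonglongrightarrow> 0"
    using tendsto_mult_left[OF lim_1_over_n, of "K ^ 4"] by simp
  ultimately have "(\<lambda>n. (\<Prod>i<n. cos (u \<bullet> coin_vec n i)) - exp (- S n / 2)) \<longlonglongrightarrow> 0" by (rule Lim_null_comparison)
  from tendsto_add[OF this L1] have "(\<lambda>n. \<Prod>i<n. cos (u \<bullet> coin_vec n i)) \<longlonglongrightarrow> exp (- s / 2)" by simp
  from tendsto_mult_right[OF this, of "cos \<theta>"] show ?thesis by (simp add: coin_iter_cos)
qed

text \<open>The law of \<open>Z \<omega> \<bullet> u\<close> is Gaussian, with variance the
  quadratic form of the covariance operator at \<open>u\<close>; the weak integral formula evaluates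
  it.\<close>

lemma brownian_char:
  assumes Z: "brownian_motion_on \<beta> \<rho> P Z"
  shows "(\<integral>\<omega>. cos (u \<bullet> Z \<omega> + \<theta>) \<partial>P) = exp (- (\<integral>t. indicator {0..1} t * (jump t \<bullet> u)\<^sup>2 \<partial>lborel) / 2) * cos \<theta>"
proof -
  have gv: "gaussian_variable P Z" and Z2: "integrable P (\<lambda>\<omega>. (norm (Z \<omega>))\<^sup>2)" and Z0: "(\<integral>\<omega>. Z \<omega> \<partial>P) = 0"
    and cov: "AE s in unit_leb. \<rho> (covariance_operator P Z u) s = brownian_covariance \<beta> (\<rho> u) s"
    using Z unfolding brownian_motion_on_def by blast+
  interpret prob_space P using gv by (simp add: gaussian_variable_def)
  have Zm [measurable]: "Z \<in> borel_measurable P" and gl: "gaussian_law (distr P borel (\<lambda>\<omega>. Z \<omega> \<bullet> u))"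
    using gv by (auto simp: gaussian_variable_def)
  have Zi: "integrable P Z" by (rule integrable_of_square_norm[OF Zm Z2])
  \<comment> \<open>Needed to move the inner product inside the Bochner integral that defines the
    covariance operator.\<close>
  have Ci: "integrable P (\<lambda>\<omega>. (Z \<omega> \<bullet> u) *\<^sub>R Z \<omega>)"
  proof (rule Bochner_Integration.integrable_bound)
    show "integrable P (\<lambda>\<omega>. norm u * (norm (Z \<omega>))\<^sup>2)" using Z2 by simp
    have "norm ((x \<bullet> u) *\<^sub>R x) \<le> norm (norm u * (norm x)\<^sup>2)" for x :: 'k
      using mult_right_mono[OF Cauchy_Schwarz_ineq2[of x u] norm_ge_zero[of x]]
      by (simp add: power2_eq_square abs_mult mult_ac)
    then show "AE \<omega> in P. norm ((Z \<omega> \<bullet> u) *\<^sub>R Z \<omega>) \<le> norm (norm u * (norm (Z \<omega>))\<^sup>2)" by (intro AE_I2)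
  qed measurable
  let ?\<mu> = "distr P borel (\<lambda>\<omega>. Z \<omega> \<bullet> u)"
  have "(\<integral>x. x \<partial>?\<mu>) = (\<integral>\<omega>. Z \<omega> \<bullet> u \<partial>P)" by (subst integral_distr) auto
  also have "\<dots> = (\<integral>\<omega>. Z \<omega> \<partial>P) \<bullet> u" using Zi by (rule integral_inner_left)
  finally have m1: "(\<integral>x. x \<partial>?\<mu>) = 0" by (simp add: Z0)
  have "(\<integral>x. x\<^sup>2 \<partial>?\<mu>) = (\<integral>\<omega>. (Z \<omega> \<bullet> u)\<^sup>2 \<partial>P)" by (subst integral_distr) auto
  also have "\<dots> = (\<integral>\<omega>. ((Z \<omega> \<bullet> u) *\<^sub>R Z \<omega>) \<bullet> u \<partial>P)" by (simp add: power2_eq_square)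
  also have "\<dots> = covariance_operator P Z u \<bullet> u"
    unfolding covariance_operator_def using Ci by (rule integral_inner_left)
  also have "\<dots> = (\<integral>t. indicator {0..1} t * (jump t \<bullet> u)\<^sup>2 \<partial>lborel)"
    by (subst inner_brownian_covariance[OF cov]) (simp add: power2_eq_square)
  finally have m2: "(\<integral>x. x\<^sup>2 \<partial>?\<mu>) = (\<integral>t. indicator {0..1} t * (jump t \<bullet> u)\<^sup>2 \<partial>lborel)" .
  have "(\<integral>\<omega>. cos (u \<bullet> Z \<omega> + \<theta>) \<partial>P) = (\<integral>x. cos (x + \<theta>) \<partial>?\<mu>)"
    by (subst integral_distr) (auto simp: inner_commute)
  then show ?thesis using gaussian_law_cos[OF gl m1 m2, of \<theta>] by simp
qed

lemma coin_iter_tendsto_brownian: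
  assumes Z: "brownian_motion_on \<beta> \<rho> P Z" and f: "1-lipschitz_on UNIV f"
  shows "(\<lambda>n. coin_iter (coin_vec n) n f 0) \<longlonglongrightarrow> (\<integral>\<omega>. f (Z \<omega>) \<partial>P)"
proof (rule coin_iter_tendsto[OF _ _ _ _ _ _ f])
  show P: "prob_space P" and Zm [measurable]: "Z \<in> borel_measurable P" and Z2: "integrable P (\<lambda>\<omega>. (norm (Z \<omega>))\<^sup>2)"
    using Z by (auto simp: brownian_motion_on_def gaussian_variable_def)
  interpret prob_space P by fact
  show "(\<lambda>n. coin_iter (coin_vec n) n (\<lambda>x. cos (u \<bullet> x + \<theta>)) 0) \<longlonglongrightarrow> (\<integral>\<omega>. cos (u \<bullet> Z \<omega> + \<theta>) \<partial>P)" for u \<theta>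
    unfolding brownian_char[OF Z] by (rule coin_char_limit)
  show "coin_iter (coin_vec n) n (\<lambda>x. (norm x)\<^sup>2) 0 \<le> hoelder_const\<^sup>2" for n
    using norm_jump_le by (intro coin_iter_residual_sq_le[OF linear_ident]) auto
  fix \<epsilon> :: real assume \<epsilon>: "0 < \<epsilon>"
  obtain E :: "nat \<Rightarrow> 'k set" where E: "\<And>m. finite_orthonormal (E m)" "\<And>x. (\<lambda>m. x - proj (E m) x) \<longlonglongrightarrow> 0"
    by (rule dense_projections) blast
  have Z1: "integrable P (\<lambda>\<omega>. norm (Z \<omega>))"
    by (rule integrable_norm[OF integrable_of_square_norm[OF Zm Z2]])
  have pm [measurable]: "proj (E m) \<in> borel_measurable borel" for m
    by (rule borel_measurable_continuous_onI[OF continuous_on_proj])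
  \<comment> \<open>Residuals of projections are dominated by
    \<open>norm (Z \<omega>)\<close>.\<close>
  have "(\<lambda>m. \<integral>\<omega>. norm (Z \<omega> - proj (E m) (Z \<omega>)) \<partial>P) \<longlonglongrightarrow> (\<integral>\<omega>. 0 \<partial>P)"
  proof (rule integral_dominated_convergence[OF _ _ Z1])
    show "AE \<omega> in P. (\<lambda>m. norm (Z \<omega> - proj (E m) (Z \<omega>))) \<longlonglongrightarrow> 0"
      using E(2) by (intro AE_I2 tendsto_norm_zero)
    show "AE \<omega> in P. norm (norm (Z \<omega> - proj (E m) (Z \<omega>))) \<le> norm (Z \<omega>)" for m
      using norm_proj_residual_le[OF E(1) span_zero] by (intro AE_I2) simp
  qed measurable
  then have "\<forall>\<^sub>F m in sequentially. (\<integral>\<omega>. norm (Z \<omega> - proj (E m) (Z \<omega>)) \<partial>P) < \<epsilon>"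
    using \<epsilon> by (intro order_tendstoD) simp_all
  \<comment> \<open>A single \<open>E m\<close> must serve the whole path, hence all coin sums, and
    \<open>Z\<close> at once.\<close>
  with jump_residual_uniform[OF E \<epsilon>]
  have "\<forall>\<^sub>F m in sequentially. (\<forall>t\<in>{0..1}. norm (jump t - proj (E m) (jump t)) \<le> \<epsilon>) \<and> (\<integral>\<omega>. norm (Z \<omega> - proj (E m) (Z \<omega>)) \<partial>P) < \<epsilon>"
    by eventually_elim simp
  then obtain m where mm: "(\<forall>t\<in>{0..1}. norm (jump t - proj (E m) (jump t)) \<le> \<epsilon>) \<and> (\<integral>\<omega>. norm (Z \<omega> - proj (E m) (Z \<omega>)) \<partial>P) < \<epsilon>"
    unfolding eventually_sequentially by (meson order_refl)
  note m = mm[THEN conjunct1, rule_format] mm[THEN conjunct2]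
  have "linear (\<lambda>x. x - proj (E m) x)" by (intro linear_compose_sub linear_ident linear_proj)
  from coin_iter_residual_sq_le[OF this m(1)] E(1) m(2)
  show "\<exists>E. finite_orthonormal E \<and> (\<forall>n. coin_iter (coin_vec n) n (\<lambda>x. (norm (x - proj E x))\<^sup>2) 0 \<le> \<epsilon>\<^sup>2)
      \<and> (\<integral>\<omega>. norm (Z \<omega> - proj E (Z \<omega>)) \<partial>P) \<le> \<epsilon>"
    by (intro exI[of _ "E m"]) auto
qed

end


subsection \<open>The rate of convergence\<close>

text \<open>The Lipschitz bound is the mean value inequality. For the third derivative the
  one-element orthonormal family of the normalized direction shows that the Hilbert-Schmidt norm
  bounds the form on the diagonal; homogeneity supplies the cube of the norm.\<close>

lemma Cb3_norm_le_1D: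
  fixes h :: "'k::real_inner \<Rightarrow> real"
  assumes h: "thrice_differentiable h" and n: "Cb3_norm h \<le> 1"
  shows "1-lipschitz_on UNIV h" "has_taylor2 h"
proof -
  have le: "ennreal (norm (fderiv h x)) \<le> 1" "tensor3_norm (fderiv (fderiv (fderiv h)) x) \<le> 1" for x
  proof -
    let ?S = "{ennreal (norm (fderiv h x)), tensor2_norm (fderiv (fderiv h) x), tensor3_norm (fderiv (fderiv (fderiv h)) x)}"
    have "Sup ?S \<le> Cb3_norm h" unfolding Cb3_norm_def by (rule SUP_upper) simp
    then have S: "Sup ?S \<le> 1" using n by (rule order_trans)
    show "ennreal (norm (fderiv h x)) \<le> 1" by (rule order_trans[OF Sup_upper S]) simp
    show "tensor3_norm (fderiv (fderiv (fderiv h)) x) \<le> 1" by (rule order_trans[OF Sup_upper S]) simp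
  qed
  show "1-lipschitz_on UNIV h"
  proof (rule lipschitz_onI)
    fix x y :: 'k
    have "norm (h x - h y) \<le> 1 * norm (x - y)"
    proof (rule differentiable_bound[of UNIV])
      show "(h has_derivative blinfun_apply (fderiv h z)) (at z within UNIV)" for z
        using h fderiv_works[of h z] by (simp add: thrice_differentiable_def)
      show "onorm (blinfun_apply (fderiv h z)) \<le> 1" for z
        using le(1)[of z] by (simp add: norm_blinfun.rep_eq)
    qed auto
    then show "dist (h x) (h y) \<le> 1 * dist x y" by (simp add: dist_norm)
  qed simp
  show "has_taylor2 h"
  proof (rule thrice_differentiable_taylor2[OF h])
    fix x w :: 'k
    let ?T = "fderiv (fderiv (fderiv h)) x"
    show "\<bar>blinfun_apply (blinfun_apply (blinfun_apply ?T w) w) w\<bar> \<le> norm w ^ 3"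
    proof (cases "w = 0")
      case False
      define u where "u = w /\<^sub>R norm w"
      have "finite_orthonormal {u}" using False by (simp add: finite_orthonormal_def u_def)
      then have "ennreal (sqrt (\<Sum>a\<in>{u}. \<Sum>b\<in>{u}. \<Sum>c\<in>{u}. (blinfun_apply (blinfun_apply (blinfun_apply ?T a) b) c)\<^sup>2)) \<le> tensor3_norm ?T"
        unfolding tensor3_norm_def by (intro SUP_upper) simp
      also have "\<dots> \<le> 1" by (rule le)
      finally have "\<bar>blinfun_apply (blinfun_apply (blinfun_apply ?T u) u) u\<bar> \<le> 1" by simp
      then have "norm w ^ 3 * \<bar>blinfun_apply (blinfun_apply (blinfun_apply ?T u) u) u\<bar> \<le> norm w ^ 3 * 1"
        by (intro mult_left_mono) auto
      moreover have "blinfun_apply (blinfun_apply (blinfun_apply ?T w) w) w = norm w ^ 3 * blinfun_apply (blinfun_apply (blinfun_apply ?T u) u) u"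
      proof -
        have w: "w = norm w *\<^sub>R u" using False by (simp add: u_def)
        show ?thesis
          by (subst (1 2 3) w) (simp only: blinfun.scaleR_left blinfun.scaleR_right power3_eq_cube, simp)
      qed
      ultimately show ?thesis by (simp add: abs_mult)
    qed simp
  qed
qed

context besov_liouville_model
begin

lemma normalized_poisson_brownian_bound:
  assumes pp: "poisson_process M l N" and l: "0 < l" and Z: "brownian_motion_on \<beta> \<rho> P Z"
    and lip: "1-lipschitz_on UNIV h" and taylor: "has_taylor2 h"
  shows "\<bar>(\<integral>\<omega>. h (normalized_poisson \<rho> l N \<omega>) \<partial>M) - (\<integral>\<omega>. h (Z \<omega>) \<partial>P)\<bar> \<le> hoelder_const ^ 3 / 6 / sqrt l"
proof -
  let ?X = "\<integral>\<omega>. h (normalized_poisson \<rho> l N \<omega>) \<partial>M" and ?Z = "\<integral>\<omega>. h (Z \<omega>) \<partial>P"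
  let ?B = "\<lambda>n. coin_iter (coin_vec n) n h 0"
  let ?r = "\<lambda>n. 1 / sqrt l + 2 * sqrt l * (1 / real n) + 1 / sqrt (real n)"
  let ?c = "hoelder_const ^ 3 / 6"
  have step: "\<bar>?X - ?Z\<bar> \<le> 2 * 1 * sqrt l * modulus n + ?c * ?r n + \<bar>?B n - ?Z\<bar>" if n: "0 < n" for n
  proof -
    have "\<bar>?X - poisson_iter (l / real n) (\<lambda>i. jump (grid n i) /\<^sub>R sqrt l) n h 0\<bar> \<le> 2 * 1 * sqrt l * modulus n"
      by (rule normalized_poisson_approx[OF pp l lip n])
    moreover have "\<bar>poisson_iter (l / real n) (\<lambda>i. jump (grid n i) /\<^sub>R sqrt l) n h 0 - ?B n\<bar>
        \<le> real n * (?c * (1 / sqrt l + 2 * sqrt l / real n + 1 / sqrt (real n)) / real n)"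
    proof (rule lindeberg_replacement[OF _ lip])
      fix i x assume i: "i < n"
      show "\<bar>poisson_step (l / real n) (jump (grid n i) /\<^sub>R sqrt l) h x - coin_step (coin_vec n i) h x\<bar>
        \<le> ?c * (1 / sqrt l + 2 * sqrt l / real n + 1 / sqrt (real n)) / real n"
        unfolding coin_vec_def using grid_in_unit[OF i]
        by (intro poisson_step_coin_step_diff[OF l n lip taylor] norm_jump_le) auto
    qed (use l n in simp)
    moreover have "real n * (?c * (1 / sqrt l + 2 * sqrt l / real n + 1 / sqrt (real n)) / real n) = ?c * ?r n"
      using n by simp
    ultimately show ?thesis by linarith
  qed
  have s0: "(\<lambda>n. 1 / sqrt (real n)) \<longlonglongrightarrow> 0"
    using tendsto_real_sqrt[OF lim_1_over_n] by (simp add: real_sqrt_divide)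
  \<comment> \<open>With \<open>l\<close> fixed, all terms vanish as n grows, except the leading
    part of the Poisson third moment.\<close>
  have "(\<lambda>n. 2 * 1 * sqrt l * modulus n + ?c * ?r n + \<bar>?B n - ?Z\<bar>)
      \<longlonglongrightarrow> 2 * 1 * sqrt l * 0 + ?c * (1 / sqrt l + 2 * sqrt l * 0 + 0) + \<bar>?Z - ?Z\<bar>"
    by (intro tendsto_intros modulus_tendsto_0 lim_1_over_n s0 coin_iter_tendsto_brownian[OF Z lip])
  then have "(\<lambda>n. 2 * 1 * sqrt l * modulus n + ?c * ?r n + \<bar>?B n - ?Z\<bar>) \<longlonglongrightarrow> ?c / sqrt l" by simp
  moreover have "\<exists>n0. \<forall>n\<ge>n0. \<bar>?X - ?Z\<bar> \<le> 2 * 1 * sqrt l * modulus n + ?c * ?r n + \<bar>?B n - ?Z\<bar>"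
    using step by (intro exI[of _ 1]) simp
  ultimately show ?thesis by (rule LIMSEQ_le_const)
qed

end

theorem theorem5:
  fixes \<beta> :: real
    and \<rho> :: "'k::{real_inner, banach, second_countable_topology} \<Rightarrow> real \<Rightarrow> real"
    and M :: "real \<Rightarrow> 'a measure"
    and N :: "real \<Rightarrow> real \<Rightarrow> 'a \<Rightarrow> nat"
    and P :: "'b measure"
    and Z :: "'b \<Rightarrow> 'k"
  assumes "0 < \<beta>" and "\<beta> < 1 / 2"
    and "is_besov_liouville_space \<beta> \<rho>"
    and "\<And>l. l > 0 \<Longrightarrow> poisson_process (M l) l (N l)"
    and "brownian_motion_on \<beta> \<rho> P Z"
  shows "\<exists>C. \<forall>\<^sub>F l in at_top.
           d3 (M l) (normalized_poisson \<rho> l (N l)) P Z \<le> ennreal (C / sqrt l)"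
proof -
  interpret besov_liouville_model \<beta> \<rho> by unfold_locales (fact assms)+
  \<comment> \<open>The bound holds for every positive \<open>l\<close>, with a constant that
    depends on \<beta> alone.\<close>
  have bound: "d3 (M l) (normalized_poisson \<rho> l (N l)) P Z \<le> ennreal ((hoelder_const ^ 3 / 6) / sqrt l)" if l: "0 < l" for l
    unfolding d3_def
  proof (rule SUP_least)
    fix h :: "'k \<Rightarrow> real" assume "h \<in> {h \<in> Cb3. Cb3_norm h \<le> 1}"
    then have "thrice_differentiable h" "Cb3_norm h \<le> 1" by (auto simp: Cb3_def)
    note h = Cb3_norm_le_1D[OF this]
    show "ennreal \<bar>(\<integral>\<omega>. h (normalized_poisson \<rho> l (N l) \<omega>) \<partial>M l) - (\<integral>\<omega>. h (Z \<omega>) \<partial>P)\<bar> \<le> ennreal ((hoelder_const ^ 3 / 6) / sqrt l)"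
      by (intro ennreal_leI normalized_poisson_brownian_bound[OF assms(4)[OF l] l assms(5) h])
  qed
  have "\<forall>\<^sub>F l in at_top. d3 (M l) (normalized_poisson \<rho> l (N l)) P Z \<le> ennreal ((hoelder_const ^ 3 / 6) / sqrt l)"
    by (rule eventually_mono[OF eventually_gt_at_top[of 0] bound])
  then show ?thesis by blast
qed

end
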